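(* Let $S_n\in L^\infty(\mathscr F_n,\mathbb R^d)$, $n=0,\dots,N$, be a process satisfying the NA property. Then for an element $f\in L^1_{++}(\mathscr F)$ the following conditions are equivalent: (i) $v:=\sup\{\mathsf E(fX):\ \|X^-\|_\infty\le 1,\ X\in K\}<\infty$, where $K=\{G_N^\gamma:\ \gamma_n\in L^\infty(\mathscr F_{n-1},D_{n-1}),\ n=1,\dots,N\}$; (ii) there exists a martingale measure $\mathsf Q$, equivalent to $\mathsf P$, whose density satisfies the inequality $d\mathsf Q/d\mathsf P\ge cf$ (a.s.) with some constant $c>0$; (iii) the recurrence relation $$\beta_N=f,\qquad \beta_n=\mathsf E(\beta_{n+1}|\mathscr F_n)+\mu(-a_n|\mathrm{conv}\,\varkappa_n),\quad a_n=\mathsf E(\beta_{n+1}\Delta S_{n+1}|\mathscr F_n),\quad n=N-1,\dots,0,$$ specifies a $\mathsf P$-integrable sequence $(\beta_n)_{n=0}^N$ (that is, $\beta_n\in L^1(\mathscr F_n)$ for all $n=0,\dots,N$).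
   Context: $(\Omega,\mathscr F,\mathsf P)$ is a probability space with a discrete-time filtration $(\mathscr F_n)_{n=0}^N$, $\mathscr F_N=\mathscr F$; $\mathsf E$ is expectation with respect to $\mathsf P$; $(a,b)$ is the scalar product in $\mathbb R^d$; $X^-=\max\{-X,0\}$. $S=(S_n)_{n=0}^N$ is a $d$-dimensional adapted process, $\Delta S_n=S_n-S_{n-1}$. For a $d$-dimensional predictable process $\gamma=(\gamma_n)_{n=1}^N$ (i.e. $\gamma_n$ is $\mathscr F_{n-1}$-measurable) the gain process is $$G_n^\gamma=\sum_{k=1}^n(\gamma_k,\Delta S_k),\quad n=1,\dots,N.$$ The No Arbitrage (NA) property: for every predictable $\gamma$, $G_N^\gamma\ge 0$ a.s. implies $G_N^\gamma=0$ a.s. A probability measure $\mathsf Q$ on $\mathscr F$ is a martingale measure if $S$ is a $\mathsf Q$-martingale; measures are equivalent if they have the same null sets. For $n=1,\dots,N$, $\varkappa_{n-1}(\omega)\subset\mathbb R^d$ is the (closed) support of the regular conditional distribution $\mathsf P_{n-1}(\omega,dx)$ of $\Delta S_n$ with respect to $\mathscr F_{n-1}$, and $D_{n-1}(\omega)$ is the linear span of $\varkappa_{n-1}(\omega)$. $\mathrm{conv}$ denotes the convex hull, and $\mu(x|A)=\inf\{\lambda>0:x\in\lambda A\}$ is the Minkowski function of a set $A\subset\mathbb R^d$; $\mu(-a_n|\mathrm{conv}\,\varkappa_n)$ is the random variable $\omega\mapsto\mu(-a_n(\omega)|\mathrm{conv}\,\varkappa_n(\omega))$. $L^p(\mathscr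 G)$ are the usual spaces of (classes of) real $\mathscr G$-measurable functions with norm $\|\cdot\|_p$; $L^1_{++}(\mathscr F)$ is the set of a.s. strictly positive elements of $L^1(\mathscr F)$. For a set-valued mapping $F$ with $F(\omega)\subset\mathbb R^d$ (in particular $F\equiv\mathbb R^d$), $L^\infty(\mathscr G,F)$ is the set of classes of essentially bounded $\mathscr G$-measurable $\mathbb R^d$-valued functions $\eta$ with $\eta\in F$ a.s. Functions measurable with respect to the $\mathsf P$-completion of $\mathscr F_n$ are identified with $\mathscr F_n$-measurable modifications. *)

theory Defs
  imports "HOL-Probability.Probability"
begin

text \<open>Time runs over \<open>0..N\<close>; values of \<open>F\<close>, \<open>S\<close>, ... at other indices are irrelevant.
  Only the space and the sigma-algebra of \<open>F n\<close> matter, not its measure.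
  Elements of the spaces of classes are given by representatives that are measurable with respect
  to the stated sigma-algebra.\<close>

definition discrete_filtration :: "'a measure \<Rightarrow> (nat \<Rightarrow> 'a measure) \<Rightarrow> nat \<Rightarrow> bool" where
  "discrete_filtration M F N \<longleftrightarrow>
     (\<forall>n\<le>N. subalgebra M (F n)) \<and>
     (\<forall>n\<le>N. \<forall>m\<le>n. subalgebra (F n) (F m)) \<and>
     sets (F N) = sets M"

definition Linf_norm :: "'a measure \<Rightarrow> ('a \<Rightarrow> 'b::real_normed_vector) \<Rightarrow> ereal" where
  "Linf_norm M \<eta> = esssup M (\<lambda>\<omega>. ereal (norm (\<eta> \<omega>)))"

definition Linf :: "'a measure \<Rightarrow> 'a measure \<Rightarrow> ('a \<Rightarrow> (real ^ 'd) set) \<Rightarrow> ('a \<Rightarrow> real ^ 'd) set" where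
  "Linf M G A = {\<eta> \<in> borel_measurable G. Linf_norm M \<eta> < \<infinity> \<and> (AE \<omega> in M. \<eta> \<omega> \<in> A \<omega>)}"

definition L1pp :: "'a measure \<Rightarrow> ('a \<Rightarrow> real) set" where
  "L1pp M = {f. integrable M f \<and> (AE \<omega> in M. 0 < f \<omega>)}"

definition vec_cond_exp ::
    "'a measure \<Rightarrow> 'a measure \<Rightarrow> ('a \<Rightarrow> real ^ 'd) \<Rightarrow> 'a \<Rightarrow> real ^ 'd" where
  "vec_cond_exp M G X \<omega> = (\<chi> i. real_cond_exp M G (\<lambda>\<omega>'. X \<omega>' $ i) \<omega>)"

text \<open>Used for \<open>n \<ge> 1\<close> only.\<close>
definition increment :: "(nat \<Rightarrow> 'a \<Rightarrow> real ^ 'd) \<Rightarrow> nat \<Rightarrow> 'a \<Rightarrow> real ^ 'd" where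
  "increment S n \<omega> = S n \<omega> - S (n - 1) \<omega>"

definition predictable ::
    "(nat \<Rightarrow> 'a measure) \<Rightarrow> nat \<Rightarrow> (nat \<Rightarrow> 'a \<Rightarrow> real ^ 'd) \<Rightarrow> bool" where
  "predictable F N \<gamma> \<longleftrightarrow> (\<forall>n\<in>{1..N}. \<gamma> n \<in> borel_measurable (F (n - 1)))"

definition gain ::
    "(nat \<Rightarrow> 'a \<Rightarrow> real ^ 'd) \<Rightarrow> (nat \<Rightarrow> 'a \<Rightarrow> real ^ 'd) \<Rightarrow> nat \<Rightarrow> 'a \<Rightarrow> real" where
  "gain S \<gamma> n \<omega> = (\<Sum>k=1..n. \<gamma> k \<omega> \<bullet> increment S k \<omega>)"

definition no_arbitrage ::
    "'a measure \<Rightarrow> (nat \<Rightarrow> 'a measure) \<Rightarrow> nat \<Rightarrow> (nat \<Rightarrow> 'a \<Rightarrow> real ^ 'd) \<Rightarrow> bool" where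
  "no_arbitrage M F N S \<longleftrightarrow>
     (\<forall>\<gamma>. predictable F N \<gamma> \<longrightarrow> (AE \<omega> in M. gain S \<gamma> N \<omega> \<ge> 0) \<longrightarrow> (AE \<omega> in M. gain S \<gamma> N \<omega> = 0))"

definition is_martingale ::
    "'a measure \<Rightarrow> (nat \<Rightarrow> 'a measure) \<Rightarrow> nat \<Rightarrow> (nat \<Rightarrow> 'a \<Rightarrow> real ^ 'd) \<Rightarrow> bool" where
  "is_martingale Q F N S \<longleftrightarrow>
     (\<forall>n\<le>N. S n \<in> borel_measurable (F n) \<and> integrable Q (S n)) \<and>
     (\<forall>n\<le>N. \<forall>m\<le>n. AE \<omega> in Q. vec_cond_exp Q (F m) (S n) \<omega> = S m \<omega>)"

definition martingale_measure ::
    "'a measure \<Rightarrow> (nat \<Rightarrow> 'a measure) \<Rightarrow> nat \<Rightarrow> (nat \<Rightarrow> 'a \<Rightarrow> real ^ 'd) \<Rightarrow> 'a measure \<Rightarrow> bool" where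
  "martingale_measure M F N S Q \<longleftrightarrow>
     prob_space Q \<and> sets Q = sets M \<and> is_martingale Q F N S"

definition equivalent_measures :: "'a measure \<Rightarrow> 'a measure \<Rightarrow> bool" where
  "equivalent_measures M Q \<longleftrightarrow> sets Q = sets M \<and> null_sets Q = null_sets M"

text \<open>\<open>K\<close> is a version of the regular conditional distribution of \<open>X\<close> with respect to \<open>G\<close>.\<close>
definition regular_cond_distr ::
    "'a measure \<Rightarrow> 'a measure \<Rightarrow> ('a \<Rightarrow> real ^ 'd) \<Rightarrow> ('a \<Rightarrow> (real ^ 'd) measure) \<Rightarrow> bool" where
  "regular_cond_distr M G X K \<longleftrightarrow>
     K \<in> measurable G (prob_algebra borel) \<and>
     (\<forall>B\<in>sets borel. AE \<omega> in M.
        measure (K \<omega>) B = real_cond_exp M G (\<lambda>\<omega>'. indicator B (X \<omega>')) \<omega>)"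

definition closed_support :: "'b::topological_space measure \<Rightarrow> 'b set" where
  "closed_support \<mu> = {x. \<forall>U. open U \<longrightarrow> x \<in> U \<longrightarrow> emeasure \<mu> U > 0}"

text \<open>The infimum is taken in the extended reals, so that it is \<open>\<infinity>\<close> when no dilation
  of \<open>A\<close> contains \<open>x\<close>.\<close>
definition minkowski :: "'b::real_vector \<Rightarrow> 'b set \<Rightarrow> ereal" where
  "minkowski x A = Inf {ereal t | t. t > 0 \<and> x \<in> (\<lambda>y. t *\<^sub>R y) ` A}"

text \<open>\<open>P n \<omega>\<close> is the conditional distribution of \<open>increment S (Suc n)\<close> given \<open>F n\<close>.\<close>

definition supp_span :: "(nat \<Rightarrow> 'a \<Rightarrow> (real ^ 'd) measure) \<Rightarrow> nat \<Rightarrow> 'a \<Rightarrow> (real ^ 'd) set" where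
  "supp_span P n \<omega> = span (closed_support (P n \<omega>))"

definition bounded_gains ::
    "'a measure \<Rightarrow> (nat \<Rightarrow> 'a measure) \<Rightarrow> nat \<Rightarrow> (nat \<Rightarrow> 'a \<Rightarrow> real ^ 'd) \<Rightarrow>
     (nat \<Rightarrow> 'a \<Rightarrow> (real ^ 'd) measure) \<Rightarrow> ('a \<Rightarrow> real) set" where
  "bounded_gains M F N S P =
     {gain S \<gamma> N | \<gamma>. \<forall>n\<in>{1..N}. \<gamma> n \<in> Linf M (F (n - 1)) (supp_span P (n - 1))}"

text \<open>The Minkowski term is in general only measurable with respect to the completion of
  \<open>F n\<close>, and the recurrence determines \<open>\<beta> n\<close> only up to null sets; hence it is stated almost
  surely, with \<open>\<beta> n\<close> an \<open>F n\<close>-measurable modification. The equation holds in the extended reals,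
  so it forces the Minkowski term to be finite almost surely.\<close>
definition integrable_beta_recursion ::
    "'a measure \<Rightarrow> (nat \<Rightarrow> 'a measure) \<Rightarrow> nat \<Rightarrow> (nat \<Rightarrow> 'a \<Rightarrow> real ^ 'd) \<Rightarrow>
     (nat \<Rightarrow> 'a \<Rightarrow> (real ^ 'd) measure) \<Rightarrow> ('a \<Rightarrow> real) \<Rightarrow> (nat \<Rightarrow> 'a \<Rightarrow> real) \<Rightarrow> bool" where
  "integrable_beta_recursion M F N S P f \<beta> \<longleftrightarrow>
     (\<forall>n\<le>N. \<beta> n \<in> borel_measurable (F n) \<and> integrable M (\<beta> n)) \<and>
     (AE \<omega> in M. \<beta> N \<omega> = f \<omega>) \<and>
     (\<forall>n<N.
        let a = vec_cond_exp M (F n) (\<lambda>\<omega>. \<beta> (Suc n) \<omega> *\<^sub>R increment S (Suc n) \<omega>)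
        in AE \<omega> in M. ereal (\<beta> n \<omega>) =
             ereal (real_cond_exp M (F n) (\<beta> (Suc n)) \<omega>)
             + minkowski (- a \<omega>) (convex hull (closed_support (P n \<omega>))))"

end

theory Submission
  imports Defs
begin

text \<open>
  The three conditions are proved equivalent in a cycle. Everything happens one period at a time and,
  given the past \<open>w\<close>, inside the conditional law \<open>P n w\<close> of the increment. Let \<open>C\<close> be the convex hull and
  \<open>D\<close> the span of its support. Absence of arbitrage implies that almost every conditional law is free
  of arbitrage (\<open>AE_arbitrage_free\<close>), so that \<open>0\<close> is a relative interior point of \<open>C\<close>
  (\<open>hull_neighbourhood\<close>). The Minkowski functional has two descriptions, and each of them carries one
  implication.

  By duality \<open>\<mu>(-a | C)\<close> is the supremum of \<open>h \<bullet> a\<close> over the positions \<open>h\<close> in \<open>D\<close> whose gain is at least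
  \<open>-1\<close> (\<open>minkowski_eq_SUP\<close>). If \<open>X \<ge> -1\<close> is a gain up to time \<open>n\<close>, then so is
  \<open>(1 + X)(1 + h \<bullet> \<Delta>S\<^sub>n\<^sub>+\<^sub>1) - 1\<close> up to time \<open>n + 1\<close>; optimising over \<open>h\<close> turns a bound of
  \<open>E(\<beta>\<^sub>n\<^sub>+\<^sub>1 (1 + X))\<close> over the gains up to time \<open>n + 1\<close> into the same bound of \<open>E(\<beta>\<^sub>n (1 + X))\<close> over the gains up
  to time \<open>n\<close> (\<open>backward_step\<close>). Starting from \<open>\<beta>\<^sub>N = f\<close>, bounded gains thus yield an integrable
  recurrence (\<open>recursion_of_bounded_gains\<close>).

  On the other hand \<open>\<mu>(-a | C) \<le> l\<close> means that \<open>-a\<close> is in \<open>l C\<close>. As \<open>0\<close> is a relative interior point, there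
  is a non-negative function \<open>H\<close> of the increment with conditional mass at most \<open>2 l\<close> and conditional
  mean exactly \<open>-a\<close> (\<open>balancing_density\<close>). Then \<open>\<beta>\<^sub>n\<^sub>+\<^sub>1 + H\<close> is conditionally orthogonal to the
  increment and has conditional mass at most \<open>3 \<beta>\<^sub>n\<close>. Its normalisation is a one-step martingale
  density (\<open>one_step_density\<close>), and the product of these densities dominates a multiple of \<open>f\<close>
  (\<open>martingale_measure_of_recursion\<close>).

  Finally, under a martingale measure a gain has expectation zero, so its positive part is as large
  as its negative part in the mean, which bounds \<open>E(f X)\<close>
  (\<open>gains_bounded_of_martingale_measure\<close>).

  All selections that depend on \<open>w\<close> are made from one countable family, the means of the conditional law
  with respect to rational step densities. They are dense in the relevant cones and in \<open>D\<close>; hence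
  choosing a least index, the best of the first \<open>k\<close> candidates, or a nearest point
  (\<open>measurable_closest_point\<close>) is measurable.
\<close>

section \<open>The support of a bounded law\<close>

definition base_set :: "nat \<Rightarrow> 'b::second_countable_topology set" where
  "base_set = from_nat_into (SOME B. countable B \<and> topological_basis B)"

text \<open>A countable supply of non-negative densities; negative coefficients are cut off, so that every
  list of the countable type is admissible.\<close>
definition step_density :: "(rat \<times> nat) list \<Rightarrow> 'b::second_countable_topology \<Rightarrow> real" where
  "step_density L x = (\<Sum>(c, i)\<leftarrow>L. max 0 (of_rat c) * indicat_real (base_set i) x)"

lemma base_set_basis:
  "open (base_set i :: 'b::second_countable_topology set)"
  "\<And>U (x::'b). open U \<Longrightarrow> x \<in> U \<Longrightarrow> \<exists>i. x \<in> base_set i \<and> base_set i \<subseteq> U"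
proof -
  define B :: "'b set set" where "B = (SOME B. countable B \<and> topological_basis B)"
  have B: "countable B" "topological_basis B"
    using someI_ex[OF ex_countable_basis] unfolding B_def by auto
  have "B \<noteq> {}"
    using B(2) by (metis UNIV_I empty_iff open_UNIV topological_basisE)
  have base: "base_set = from_nat_into B"
    unfolding base_set_def B_def ..
  show "open (base_set i :: 'b set)"
    unfolding base using B(2) \<open>B \<noteq> {}\<close> by (metis from_nat_into topological_basis_open)
  show "\<exists>i. x \<in> base_set i \<and> base_set i \<subseteq> U" if "open U" "x \<in> U" for U and x :: 'b
    unfolding base using B that by (metis from_nat_into_surj topological_basisE)
qed

lemma measurable_base_set [measurable]: "base_set i \<in> sets borel"
  by (rule borel_open) (rule base_set_basis(1))

lemma step_density_simps [simp]:
  "step_density [] x = 0"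
  "step_density ((c, i) # L) x = max 0 (of_rat c) * indicat_real (base_set i) x + step_density L x"
  "step_density (L @ L') x = step_density L x + step_density L' x"
  by (simp_all add: step_density_def)

lemma step_density_nonneg [simp]: "0 \<le> step_density L x"
  by (induction L) auto

lemma step_density_measurable [measurable]: "step_density L \<in> borel_measurable borel"
proof (induction L)
  case (Cons a L)
  then show ?case by (cases a) simp
qed simp

lemma step_density_bounded: "\<exists>B. \<forall>x::'b::second_countable_topology. step_density L x \<le> B"
proof (induction L)
  case (Cons a L)
  then obtain B where B: "\<forall>x::'b. step_density L x \<le> B" by auto
  obtain c i where "a = (c, i)" by force
  then have "step_density (a # L) x \<le> max 0 (of_rat c) + B" for x :: 'b
    using B[rule_format, of x] by (auto simp: indicator_def)
  then show ?case by blast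
qed (auto intro: exI[of _ 0])

lemma closed_closed_support [simp]: "closed (closed_support \<mu>)"
proof -
  have "- closed_support \<mu> = \<Union>{U. open U \<and> emeasure \<mu> U = 0}"
    by (auto simp: closed_support_def not_gr_zero)
  then show ?thesis
    unfolding closed_def by auto
qed

definition arbitrage_free :: "'b::real_inner measure \<Rightarrow> bool" where
  "arbitrage_free \<mu> \<longleftrightarrow>
     (\<forall>h. (AE x in \<mu>. 0 \<le> h \<bullet> x) \<longrightarrow> (AE x in \<mu>. h \<bullet> x = 0))"

locale bounded_law = prob_space \<mu> for \<mu> :: "'b::euclidean_space measure" +
  fixes r :: real
  assumes sets_eq [measurable_cong]: "sets \<mu> = sets borel"
    and AE_bounded: "AE x in \<mu>. norm x \<le> r"
begin

definition dmass :: "(rat \<times> nat) list \<Rightarrow> real" where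
  "dmass L = (\<integral>x. step_density L x \<partial>\<mu>)"

definition dmean :: "(rat \<times> nat) list \<Rightarrow> 'b" where
  "dmean L = (\<integral>x. step_density L x *\<^sub>R x \<partial>\<mu>)"

abbreviation "supp \<equiv> closed_support \<mu>"
abbreviation "hull_supp \<equiv> convex hull (closed_support \<mu>)"

lemma space_eq: "space \<mu> = UNIV"
  using sets_eq_imp_space_eq[OF sets_eq] by simp

lemma AE_support: "AE x in \<mu>. x \<in> supp"
proof -
  define I where "I = {i. emeasure \<mu> (base_set i) = 0}"
  have "AE x in \<mu>. \<forall>i\<in>I. x \<notin> base_set i"
    unfolding AE_ball_countable[OF countableI_type]
    by (auto simp: I_def space_eq intro!: AE_I[of _ _ "base_set _"])
  moreover have "x \<in> supp" if *: "\<forall>i\<in>I. x \<notin> base_set i" for x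
    unfolding closed_support_def
  proof (clarify)
    fix U :: "'b set" assume "open U" "x \<in> U"
    then obtain i where i: "x \<in> base_set i" "base_set i \<subseteq> U"
      using base_set_basis(2) by blast
    then have "0 < emeasure \<mu> (base_set i)"
      using * by (auto simp: I_def zero_less_iff_neq_zero)
    also have "\<dots> \<le> emeasure \<mu> U"
      using i \<open>open U\<close> by (intro emeasure_mono) (auto simp: sets_eq)
    finally show "0 < emeasure \<mu> U" .
  qed
  ultimately show ?thesis by (auto elim: eventually_mono)
qed

lemma AE_closed_iff:
  assumes "closed A"
  shows "(AE x in \<mu>. x \<in> A) \<longleftrightarrow> supp \<subseteq> A"
proof
  assume "supp \<subseteq> A"
  then show "AE x in \<mu>. x \<in> A" using AE_support by (auto elim: eventually_mono)
next
  assume *: "AE x in \<mu>. x \<in> A"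
  have "emeasure \<mu> (- A) = 0"
    using * assms by (subst (asm) AE_iff_measurable[of "- A"])
      (auto simp: sets_eq space_eq)
  then show "supp \<subseteq> A"
    using assms by (force simp: closed_support_def closed_def)
qed

lemma AE_inner_le_iff: "(AE x in \<mu>. q \<bullet> x \<le> t) \<longleftrightarrow> (\<forall>x\<in>supp. q \<bullet> x \<le> t)"
  using AE_closed_iff[of "{x. q \<bullet> x \<le> t}"] by (auto simp: closed_halfspace_le)

lemma AE_inner_ge_iff: "(AE x in \<mu>. q \<bullet> x \<ge> t) \<longleftrightarrow> (\<forall>x\<in>supp. q \<bullet> x \<ge> t)"
  using AE_closed_iff[of "{x. q \<bullet> x \<ge> t}"] by (auto simp: closed_halfspace_ge)

lemma AE_inner_eq_iff: "(AE x in \<mu>. q \<bullet> x = t) \<longleftrightarrow> (\<forall>x\<in>supp. q \<bullet> x = t)"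
  using AE_closed_iff[of "{x. q \<bullet> x = t}"] by (auto simp: closed_hyperplane)

lemma supp_bounded: "x \<in> supp \<Longrightarrow> norm x \<le> r"
  using AE_closed_iff[of "cball 0 r"] AE_bounded by auto

lemma r_nonneg: "0 \<le> r"
proof -
  have "\<exists>x\<in>UNIV. norm (x::'b) \<le> r"
    using AE_bounded AE_False by (metis (no_types, lifting) UNIV_I eventually_mono)
  then show ?thesis using norm_ge_zero order_trans by blast
qed

lemma supp_nonempty: "supp \<noteq> {}"
  using AE_support AE_False by force

lemma compact_supp: "compact supp"
  using supp_bounded by (auto simp: compact_eq_bounded_closed bounded_iff)

lemma compact_hull: "compact hull_supp"
  by (simp add: compact_convex_hull compact_supp)

lemma hull_subset_span: "hull_supp \<subseteq> span supp"
  by (simp add: convex_hull_subset_span)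

lemma integrable_step_density [simp]: "integrable \<mu> (step_density L)"
proof -
  obtain B where "\<forall>x::'b. step_density L x \<le> B" using step_density_bounded by blast
  then show ?thesis
    by (intro integrable_const_bound[where B=B] AE_I2) auto
qed

lemma integrable_step_density_vec [simp]: "integrable \<mu> (\<lambda>x. step_density L x *\<^sub>R x)"
proof -
  obtain B where B: "\<forall>x::'b. step_density L x \<le> B" using step_density_bounded by blast
  then have "0 \<le> B" using order_trans step_density_nonneg by blast
  have "AE x in \<mu>. norm (step_density L x *\<^sub>R x) \<le> B * r"
    using AE_bounded by eventually_elim (use B \<open>0 \<le> B\<close> in \<open>auto intro!: mult_mono\<close>)
  then show ?thesis
    by (intro integrable_const_bound[where B="B * r"]) auto
qed

lemma integrable_id [simp]: "integrable \<mu> (\<lambda>x. x)"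
  using AE_bounded by (intro integrable_const_bound[where B=r]) auto

lemma dmass_nonneg [simp]: "0 \<le> dmass L"
  by (simp add: dmass_def)

lemma dmass_append [simp]: "dmass (L @ L') = dmass L + dmass L'"
  by (simp add: dmass_def)

lemma dmean_append [simp]: "dmean (L @ L') = dmean L + dmean L'"
  by (simp add: dmean_def scaleR_left_distrib)

lemma dmass_Nil [simp]: "dmass [] = 0" and dmean_Nil [simp]: "dmean [] = 0"
  by (simp_all add: dmass_def dmean_def)

lemma inner_dmean: "h \<bullet> dmean L = (\<integral>x. step_density L x * (h \<bullet> x) \<partial>\<mu>)"
  unfolding dmean_def by (subst integral_inner_right[symmetric]) auto

text \<open>The barycentre of a density lies in the closed convex hull, by separation.\<close>
lemma dmean_in_hull: "\<exists>c\<in>hull_supp. dmean L = dmass L *\<^sub>R c"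
proof (cases "dmass L = 0")
  case True
  then have "AE x in \<mu>. step_density L x = 0"
    unfolding dmass_def by (subst (asm) integral_nonneg_eq_0_iff_AE) auto
  then have "dmean L = 0"
    unfolding dmean_def by (subst integral_cong_AE[of _ _ "\<lambda>_. 0"]) auto
  moreover obtain c where "c \<in> supp" using supp_nonempty by blast
  ultimately show ?thesis using True by (auto intro!: bexI[of _ c] hull_inc)
next
  case False
  then have pos: "dmass L > 0" using dmass_nonneg[of L] by linarith
  define y where "y = dmean L /\<^sub>R dmass L"
  have "y \<in> hull_supp"
  proof (rule ccontr)
    assume "y \<notin> hull_supp"
    then obtain a b where ab: "a \<bullet> y < b" "\<forall>x\<in>hull_supp. a \<bullet> x > b"
      using separating_hyperplane_closed_point[of hull_supp y] compact_hull compact_imp_closed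
      by auto
    have "AE x in \<mu>. step_density L x * b \<le> step_density L x * (a \<bullet> x)"
      using AE_support by eventually_elim (use ab in \<open>auto intro!: mult_left_mono intro: less_imp_le hull_inc\<close>)
    then have "(\<integral>x. step_density L x * b \<partial>\<mu>) \<le> (\<integral>x. step_density L x * (a \<bullet> x) \<partial>\<mu>)"
      by (intro integral_mono_AE)
        (auto intro: integrable_inner_right[OF integrable_step_density_vec, of a L, simplified])
    then have "dmass L * b \<le> a \<bullet> dmean L"
      by (simp add: inner_dmean dmass_def)
    moreover have "a \<bullet> dmean L = dmass L * (a \<bullet> y)"
      using pos by (simp add: y_def)
    ultimately show False using ab(1) pos by simp
  qed
  then show ?thesis using pos by (auto simp: y_def intro!: bexI[of _ y])
qed

lemma dmean_in_span: "dmean L \<in> span supp"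
  using dmean_in_hull[of L] hull_subset_span by (metis span_scale subsetD)

text \<open>The density sits on a small basic neighbourhood of the point, which has positive mass; its
  coefficient is a rational approximation from below to the one that would give mass exactly \<open>w\<close>.\<close>
lemma dmean_approx_point:
  assumes x0: "x0 \<in> supp" and w: "0 \<le> w" and e: "0 < e"
  shows "\<exists>L. dmass L \<le> w \<and> norm (dmean L - w *\<^sub>R x0) < e"
proof -
  define d where "d = e / (2 * (w + 1))"
  have d: "0 < d" using w e by (simp add: d_def)
  obtain i where i: "x0 \<in> base_set i" "base_set i \<subseteq> ball x0 d"
    using base_set_basis(2)[of "ball x0 d" x0] d by auto
  define m where "m = measure \<mu> (base_set i)"
  have m: "0 < m"
    using x0 i(1) base_set_basis(1)[of i]
    by (auto simp: closed_support_def m_def emeasure_eq_measure)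
  define s where "s = e / (2 * (r + 1))"
  have s: "0 < s" using e r_nonneg by (simp add: s_def)
  obtain c where c: "w / m - s / m < of_rat c" "of_rat c < w / m + 0 \<or> of_rat c = (0::real)" "0 \<le> c"
  proof (cases "w = 0")
    case True
    then show ?thesis using that[of 0] s m by simp
  next
    case False
    then have "max 0 (w / m - s / m) < w / m" using w m s by (simp add: divide_strict_right_mono)
    then obtain c where "max 0 (w / m - s / m) < of_rat c" "of_rat c < w / m"
      using of_rat_dense by blast
    then show ?thesis using that[of c] by auto
  qed
  have cm: "of_rat c * m \<le> w" "w - s < of_rat c * m"
    using c m w by (auto simp: field_simps)
  let ?L = "[(c, i)]"
  have c0: "max 0 (of_rat c) = (of_rat c :: real)" using c(3) by (simp add: max_def)
  have mass: "dmass ?L = of_rat c * m"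
    unfolding dmass_def m_def step_density_simps c0 by (simp add: sets_eq space_eq)
  have "dmean ?L - of_rat c *\<^sub>R m *\<^sub>R x0 = (\<integral>x. step_density ?L x *\<^sub>R (x - x0) \<partial>\<mu>)"
  proof -
    have "(\<integral>x. step_density ?L x *\<^sub>R (x - x0) \<partial>\<mu>)
        = dmean ?L - (\<integral>x. step_density ?L x *\<^sub>R x0 \<partial>\<mu>)"
      unfolding dmean_def scaleR_diff_right
      by (rule Bochner_Integration.integral_diff[OF integrable_step_density_vec])
        (intro integrable_scaleR_left integrable_step_density)
    also have "(\<integral>x. step_density ?L x *\<^sub>R x0 \<partial>\<mu>) = dmass ?L *\<^sub>R x0"
      unfolding dmass_def by (intro integral_scaleR_left integrable_step_density)
    finally show ?thesis by (simp add: mass)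
  qed
  also have "norm \<dots> \<le> (\<integral>x. step_density ?L x * d \<partial>\<mu>)"
  proof (rule order_trans[OF integral_norm_bound integral_mono])
    show "integrable \<mu> (\<lambda>x. norm (step_density ?L x *\<^sub>R (x - x0)))"
      unfolding scaleR_diff_right
      by (intro integrable_norm Bochner_Integration.integrable_diff[OF integrable_step_density_vec])
        (intro integrable_scaleR_left integrable_step_density)
    fix x
    show "norm (step_density ?L x *\<^sub>R (x - x0)) \<le> step_density ?L x * d"
      using i(2) by (auto simp: indicator_def dist_norm norm_minus_commute subset_eq
          intro!: mult_left_mono intro: less_imp_le)
  qed (intro integrable_mult_left integrable_step_density)
  also have "\<dots> = of_rat c * m * d" using mass by (simp add: dmass_def)
  also have "\<dots> \<le> w * d" using cm(1) d by (intro mult_right_mono) auto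
  also have "\<dots> < e / 2"
    using w e by (simp add: d_def field_simps)
  finally have 1: "norm (dmean ?L - of_rat c *\<^sub>R m *\<^sub>R x0) < e / 2" .
  have "norm (of_rat c *\<^sub>R m *\<^sub>R x0 - w *\<^sub>R x0) = \<bar>of_rat c * m - w\<bar> * norm x0"
    by (metis norm_scaleR scaleR_diff_left scaleR_scaleR)
  also have "\<dots> \<le> s * r"
    using cm supp_bounded[OF x0] by (intro mult_mono) auto
  also have "\<dots> < e / 2" using r_nonneg e by (simp add: s_def field_simps)
  finally have "norm (of_rat c *\<^sub>R m *\<^sub>R x0 - w *\<^sub>R x0) < e / 2" .
  with 1 have "norm (dmean ?L - w *\<^sub>R x0) < e / 2 + e / 2"
    by (metis (no_types) norm_diff_triangle_less)
  then show ?thesis using mass cm(1) by (intro exI[of _ ?L]) auto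
qed

lemma dmean_approx:
  assumes c: "c \<in> hull_supp" and lam: "0 \<le> lam" and e: "0 < e"
  shows "\<exists>L. dmass L \<le> lam \<and> norm (dmean L - lam *\<^sub>R c) < e"
proof -
  from c obtain s u where s: "finite s" "s \<subseteq> supp" and u: "\<forall>x\<in>s. 0 \<le> u x" "sum u s = 1"
    and cs: "(\<Sum>x\<in>s. u x *\<^sub>R x) = c"
    unfolding convex_hull_explicit by blast
  have gen: "\<exists>L :: (rat \<times> nat) list. dmass L \<le> lam * sum u t \<and> norm (dmean L - lam *\<^sub>R (\<Sum>x\<in>t. u x *\<^sub>R x)) \<le> e' * card t"
    if "finite t" "t \<subseteq> s" "0 < e'" for t and e' :: real
    using that
  proof (induction t rule: finite_induct)
    case empty
    then show ?case by (intro exI[of _ "[]"]) simp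
  next
    case (insert x t)
    then obtain L where L: "dmass L \<le> lam * sum u t"
      "norm (dmean L - lam *\<^sub>R (\<Sum>x\<in>t. u x *\<^sub>R x)) \<le> e' * card t" by auto
    obtain L' where L': "dmass L' \<le> lam * u x" "norm (dmean L' - (lam * u x) *\<^sub>R x) < e'"
      using dmean_approx_point[of x "lam * u x" e'] insert s u lam by auto
    have "norm (dmean (L' @ L) - lam *\<^sub>R (\<Sum>x\<in>insert x t. u x *\<^sub>R x))
        = norm ((dmean L' - (lam * u x) *\<^sub>R x) + (dmean L - lam *\<^sub>R (\<Sum>x\<in>t. u x *\<^sub>R x)))"
      using insert by (simp add: algebra_simps)
    also have "\<dots> \<le> e' * card (insert x t)"
      using L(2) L'(2) insert norm_triangle_ineq[of "dmean L' - (lam * u x) *\<^sub>R x"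
          "dmean L - lam *\<^sub>R (\<Sum>x\<in>t. u x *\<^sub>R x)"] by (simp add: algebra_simps)
    finally show ?case using L(1) L'(1) insert
      by (intro exI[of _ "L' @ L"]) (auto simp: algebra_simps)
  qed
  have "s \<noteq> {}" using u by auto
  then have card: "0 < card s" using s by (simp add: card_gt_0_iff)
  have "e / (2 * real (card s)) * card s = e / 2" "0 < e / (2 * real (card s))"
    using card e by simp_all
  with gen[of s "e / (2 * real (card s))"] s u cs
  obtain L where L: "dmass L \<le> lam" "norm (dmean L - lam *\<^sub>R c) \<le> e / 2"
    by (metis mult.right_neutral order_refl)
  then show ?thesis using e by (intro exI[of _ L]) auto
qed

text \<open>This identifies the closure of a countable set with a convex cone, so that projections to it
  obey the variational inequality.\<close>
lemma closure_range_dmean: "closure (range dmean) = closure (cone hull hull_supp)"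
proof (rule antisym)
  have "range dmean \<subseteq> cone hull hull_supp"
    unfolding cone_hull_expl using dmean_in_hull dmass_nonneg by blast
  then show "closure (range dmean) \<subseteq> closure (cone hull hull_supp)"
    by (rule closure_mono)
  have "x \<in> closure (range dmean)" if x: "x \<in> cone hull hull_supp" for x
  proof -
    from x obtain l c where lc: "x = l *\<^sub>R c" "0 \<le> l" "c \<in> hull_supp"
      unfolding cone_hull_expl by blast
    show ?thesis
      unfolding closure_approachable
    proof (intro allI impI)
      fix e :: real assume "0 < e"
      then show "\<exists>y\<in>range dmean. dist y x < e"
        using dmean_approx[OF lc(3,2)] lc(1) by (force simp: dist_norm)
    qed
  qed
  then show "closure (cone hull hull_supp) \<subseteq> closure (range dmean)"
    by (intro closure_minimal subsetI) auto
qed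

section \<open>Bounded laws without arbitrage\<close>

text \<open>A functional that is non-negative on the support is non-negative on the cone, hence also at minus
  the mean; so its expectation vanishes.\<close>
lemma arbitrage_freeI:
  assumes "- (\<integral>x. x \<partial>\<mu>) \<in> closure (range dmean)"
  shows "arbitrage_free \<mu>"
  unfolding arbitrage_free_def
proof (intro allI impI)
  fix h assume h: "AE x in \<mu>. 0 \<le> h \<bullet> x"
  have "range dmean \<subseteq> {y. h \<bullet> y \<ge> 0}"
    using h by (auto simp: inner_dmean intro!: integral_nonneg_AE elim!: eventually_mono)
  then have "closure (range dmean) \<subseteq> {y. h \<bullet> y \<ge> 0}"
    by (intro closure_minimal) (auto simp: closed_halfspace_ge)
  then have "h \<bullet> (\<integral>x. x \<partial>\<mu>) \<le> 0" using assms by auto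
  then have "(\<integral>x. h \<bullet> x \<partial>\<mu>) \<le> 0"
    by (subst integral_inner_right) auto
  moreover have "(\<integral>x. h \<bullet> x \<partial>\<mu>) \<ge> 0" using h by (rule integral_nonneg_AE)
  ultimately have "(\<integral>x. h \<bullet> x \<partial>\<mu>) = 0" by simp
  then show "AE x in \<mu>. h \<bullet> x = 0"
    using h by (subst (asm) integral_nonneg_eq_0_iff_AE) (auto intro: integrable_inner_right)
qed

text \<open>Let \<open>p\<close> be the projection of minus the mean \<open>m\<close> onto the closed cone. Then \<open>h = p + m\<close> is
  non-negative on the cone and orthogonal to \<open>p\<close>, so \<open>h \<bullet> m\<close> is its squared length. Unless it vanishes,
  \<open>h\<close> is therefore an arbitrage, and unlike an arbitrary one it is a limit of explicit functions of
  the law; this replaces a measurable selection theorem.\<close>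
lemma projection_arbitrage:
  defines "m \<equiv> (\<integral>x. x \<partial>\<mu>)"
  defines "h \<equiv> closest_point (closure (range dmean)) (- m) + m"
  shows "AE x in \<mu>. 0 \<le> h \<bullet> x"
    and "(AE x in \<mu>. h \<bullet> x = 0) \<Longrightarrow> arbitrage_free \<mu>"
proof -
  define V where "V = closure (range dmean)"
  have V: "closed V" "convex V" "V \<noteq> {}" "cone V"
  proof -
    show "closed V" "V \<noteq> {}" by (simp_all add: V_def)
    show "convex V" unfolding V_def closure_range_dmean
      by (intro convex_closure convex_cone_hull convex_convex_hull)
    show "cone V" unfolding V_def closure_range_dmean
      by (intro cone_closure cone_cone_hull)
  qed
  define p where "p = closest_point V (- m)"
  have hp: "h = p + m" by (simp add: h_def p_def V_def)
  have pV: "p \<in> V" unfolding p_def by (intro closest_point_in_set V)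
  have var: "(- m - p) \<bullet> (y - p) \<le> 0" if "y \<in> V" for y
    unfolding p_def by (intro closest_point_dot V that)
  have orth: "h \<bullet> p = 0"
  proof -
    have "2 *\<^sub>R p \<in> V" "0 \<in> V"
      using V(4) pV mem_cone[of V p 2] mem_cone[of V p 0] by auto
    from var[OF this(1)] var[OF this(2)] show ?thesis
      by (simp add: hp inner_simps algebra_simps scaleR_2)
  qed
  have pos: "0 \<le> h \<bullet> y" if "y \<in> V" for y
    using var[OF that] orth by (simp add: hp inner_simps algebra_simps)
  have "x \<in> V" if "x \<in> supp" for x
  proof -
    have "x \<in> cone hull hull_supp" using that by (meson hull_inc)
    then show ?thesis unfolding V_def closure_range_dmean using closure_subset by blast
  qed
  then show "AE x in \<mu>. 0 \<le> h \<bullet> x" using pos by (auto simp: AE_inner_ge_iff)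
  assume "AE x in \<mu>. h \<bullet> x = 0"
  then have "(\<integral>x. h \<bullet> x \<partial>\<mu>) = 0" by (rule integral_eq_zero_AE)
  moreover have "(\<integral>x. h \<bullet> x \<partial>\<mu>) = h \<bullet> m"
    unfolding m_def by (rule integral_inner_right) simp
  ultimately have "h \<bullet> m = 0" by simp
  then have "h \<bullet> h = 0" using orth by (metis hp inner_add_right add_0)
  then have "p = - m" using hp by (simp add: eq_neg_iff_add_eq_0)
  then show "arbitrage_free \<mu>" using pV by (intro arbitrage_freeI) (simp add: V_def m_def)
qed

text \<open>A hyperplane that separates the origin from the hull, or supports the hull at the origin, would
  be an arbitrage; so the origin lies in the relative interior.\<close>
lemma hull_neighbourhood:
  assumes "arbitrage_free \<mu>"
  shows "0 \<in> hull_supp" "\<exists>e>0. \<forall>x\<in>span supp. norm x \<le> e \<longrightarrow> x \<in> hull_supp"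
proof -
  have af: "\<forall>x\<in>hull_supp. h \<bullet> x = 0" if "\<forall>x\<in>hull_supp. 0 \<le> h \<bullet> x" for h
  proof -
    have "\<forall>x\<in>supp. h \<bullet> x = 0"
      using assms that by (auto simp: arbitrage_free_def AE_inner_ge_iff AE_inner_eq_iff hull_inc)
    then have "supp \<subseteq> {x. h \<bullet> x = 0}" by auto
    then have "hull_supp \<subseteq> {x. h \<bullet> x = 0}" by (intro hull_minimal convex_hyperplane)
    then show ?thesis by auto
  qed
  have ne: "hull_supp \<noteq> {}" using supp_nonempty by simp
  show 0: "0 \<in> hull_supp"
  proof (rule ccontr)
    assume "0 \<notin> hull_supp"
    then obtain a b where "0 < b" "\<forall>x\<in>hull_supp. a \<bullet> x > b"
      using separating_hyperplane_closed_0[of hull_supp] compact_hull compact_imp_closed by auto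
    then show False using af[of a] ne by fastforce
  qed
  have "0 \<in> rel_interior hull_supp"
  proof (rule ccontr)
    assume n: "0 \<notin> rel_interior hull_supp"
    obtain a where a: "\<And>y. y \<in> hull_supp \<Longrightarrow> a \<bullet> 0 \<le> a \<bullet> y"
      "\<And>y. y \<in> rel_interior hull_supp \<Longrightarrow> a \<bullet> 0 < a \<bullet> y"
      using supporting_hyperplane_rel_boundary[OF convex_convex_hull 0 n] by metis
    obtain y where "y \<in> rel_interior hull_supp"
      using rel_interior_eq_empty[OF convex_convex_hull] ne by blast
    then show False using a af[of a] rel_interior_subset by fastforce
  qed
  moreover have "affine hull hull_supp = span supp"
  proof -
    have "affine hull hull_supp = span hull_supp"
      by (rule affine_hull_span_0) (rule hull_inc[OF 0])
    also have "\<dots> = span supp"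
      by (intro antisym span_minimal hull_subset_span subspace_span span_mono hull_subset)
    finally show ?thesis .
  qed
  ultimately obtain e where "0 < e" "cball 0 e \<inter> span supp \<subseteq> hull_supp"
    unfolding rel_interior_cball by auto
  then show "\<exists>e>0. \<forall>x\<in>span supp. norm x \<le> e \<longrightarrow> x \<in> hull_supp" by (intro exI[of _ e]) auto
qed

lemma dmean_dense_span:
  assumes "arbitrage_free \<mu>" "x \<in> span supp" "0 < e"
  shows "\<exists>L. norm (dmean L - x) < e"
proof -
  obtain d where d: "0 < d" "\<forall>x\<in>span supp. norm x \<le> d \<longrightarrow> x \<in> hull_supp"
    using hull_neighbourhood(2)[OF assms(1)] by blast
  define l where "l = norm x / d + 1"
  have l: "0 < l" using d by (simp add: l_def add_nonneg_pos)
  have "norm (x /\<^sub>R l) \<le> d"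
    using d l by (simp add: l_def field_simps)
  then have "x /\<^sub>R l \<in> hull_supp" using d assms(2) by (simp add: span_scale)
  from dmean_approx[OF this less_imp_le[OF l] assms(3)] show ?thesis using l by auto
qed

text \<open>A sufficiently close approximation leaves a remainder in the small ball of the span that
  \<open>hull_neighbourhood\<close> puts inside the hull.\<close>
lemma halving_step:
  assumes "arbitrage_free \<mu>" "0 < l" "b \<in> (\<lambda>y. l *\<^sub>R y) ` hull_supp"
  shows "\<exists>L. dmass L \<le> l \<and> b - dmean L \<in> (\<lambda>y. (l / 2) *\<^sub>R y) ` hull_supp"
proof -
  obtain c where c: "c \<in> hull_supp" "b = l *\<^sub>R c" using assms(3) by blast
  obtain d where d: "0 < d" "\<forall>x\<in>span supp. norm x \<le> d \<longrightarrow> x \<in> hull_supp"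
    using hull_neighbourhood(2)[OF assms(1)] by blast
  obtain L where L: "dmass L \<le> l" "norm (dmean L - b) < d * (l / 2)"
    using dmean_approx[OF c(1), of l "d * (l / 2)"] d(1) assms(2) c(2) by auto
  define y where "y = (b - dmean L) /\<^sub>R (l / 2)"
  have "y \<in> span supp"
    unfolding y_def c(2)
    by (intro span_scale span_diff dmean_in_span subsetD[OF hull_subset_span c(1)])
  moreover have "norm y \<le> d"
    using L(2) assms(2) unfolding y_def norm_scaleR
    by (simp add: norm_minus_commute divide_simps mult.commute)
  ultimately have "y \<in> hull_supp" using d by blast
  moreover have "b - dmean L = (l / 2) *\<^sub>R y" using assms(2) by (simp add: y_def)
  ultimately show ?thesis using L by blast
qed

section \<open>The Minkowski functional as a countable supremum\<close>

lemma inner_le_of_dilation: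
  assumes "b \<in> (\<lambda>y. t *\<^sub>R y) ` hull_supp" "0 \<le> t" "\<forall>x\<in>supp. q \<bullet> x \<le> 1"
  shows "q \<bullet> b \<le> t"
proof -
  obtain c where c: "c \<in> hull_supp" "b = t *\<^sub>R c" using assms(1) by blast
  have "hull_supp \<subseteq> {x. q \<bullet> x \<le> 1}"
    using assms(3) by (intro hull_minimal convex_halfspace_le) auto
  then show ?thesis using c assms(2) mult_left_mono[of "q \<bullet> c" 1 t] by auto
qed

text \<open>The converse is the bipolar theorem. For \<open>t = 0\<close> the test vectors are the small multiples of \<open>b\<close>,
  which are admissible because the support is bounded.\<close>
lemma dilation_of_inner_le:
  assumes "0 \<in> hull_supp" "0 \<le> t" "\<And>q. \<forall>x\<in>supp. q \<bullet> x \<le> 1 \<Longrightarrow> q \<bullet> b \<le> t"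
  shows "b \<in> (\<lambda>y. t *\<^sub>R y) ` hull_supp"
proof (cases "t = 0")
  case True
  have "b = 0"
  proof (rule ccontr)
    assume "b \<noteq> 0"
    define s where "s = 1 / (norm b * r + 1)"
    have s: "0 < s" using r_nonneg by (simp add: s_def add_nonneg_pos)
    have "\<forall>x\<in>supp. (s *\<^sub>R b) \<bullet> x \<le> 1"
    proof
      fix x assume "x \<in> supp"
      then have "b \<bullet> x \<le> norm b * r"
        by (meson supp_bounded mult_left_mono norm_cauchy_schwarz norm_ge_zero order_trans)
      then have "s * (b \<bullet> x) \<le> s * (norm b * r)" using s by simp
      also have "\<dots> \<le> 1" using r_nonneg by (simp add: s_def divide_simps add_nonneg_pos)
      finally show "(s *\<^sub>R b) \<bullet> x \<le> 1" by simp
    qed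
    then have "s * (b \<bullet> b) \<le> 0" using assms(3)[of "s *\<^sub>R b"] True by simp
    moreover have "0 < b \<bullet> b" using \<open>b \<noteq> 0\<close> by simp
    ultimately show False using s by (simp add: mult_le_0_iff)
  qed
  then show ?thesis using True assms(1) by force
next
  case False
  then have t: "0 < t" using assms(2) by simp
  have "b /\<^sub>R t \<in> hull_supp"
  proof (rule ccontr)
    assume "b /\<^sub>R t \<notin> hull_supp"
    then obtain a d where ad: "a \<bullet> (b /\<^sub>R t) < d" "\<forall>x\<in>hull_supp. a \<bullet> x > d"
      using separating_hyperplane_closed_point[of hull_supp "b /\<^sub>R t"] compact_hull
        compact_imp_closed by auto
    have d: "d < 0" using ad(2) assms(1) by force
    have "\<forall>x\<in>supp. (a /\<^sub>R d) \<bullet> x \<le> 1"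
    proof
      fix x assume "x \<in> supp"
      then have "d < a \<bullet> x" using ad(2) by (simp add: hull_inc)
      then show "(a /\<^sub>R d) \<bullet> x \<le> 1" using d by (simp add: field_simps)
    qed
    then have "(a /\<^sub>R d) \<bullet> b \<le> t" by (rule assms(3))
    moreover have "(a /\<^sub>R d) \<bullet> b > t" using ad(1) d t by (simp add: field_simps)
    ultimately show False by simp
  qed
  then show ?thesis using t by (intro image_eqI[of _ _ "b /\<^sub>R t"]) auto
qed

text \<open>A test vector is first projected to the subspace and then shrunk a little, which leaves room
  for moving it into the dense set.\<close>
lemma polar_dense:
  assumes E: "subspace E" "supp \<subseteq> E" "b \<in> E"
    and T: "\<And>y e. y \<in> E \<Longrightarrow> 0 < e \<Longrightarrow> \<exists>q\<in>T. norm (q - y) < e"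
    and q: "\<forall>x\<in>supp. q \<bullet> x \<le> 1" and d: "0 < d"
  shows "\<exists>q'\<in>T. (\<forall>x\<in>supp. q' \<bullet> x \<le> 1) \<and> q \<bullet> b - d < q' \<bullet> b"
proof -
  obtain p z where pz: "p \<in> span E" "\<And>w. w \<in> span E \<Longrightarrow> orthogonal z w" "q = p + z"
    using orthogonal_subspace_decomp_exists[of E q] by blast
  have qp: "q \<bullet> w = p \<bullet> w" if "w \<in> E" for w
    using pz(2)[of w] pz(3) that by (simp add: orthogonal_def inner_add_left span_base)
  have p: "p \<in> E" using pz(1) E(1) by (metis span_eq_iff)
  define u where "u = d / (2 * (\<bar>q \<bullet> b\<bar> + d))"
  have u: "0 < u" "u \<le> 1" "u * \<bar>q \<bullet> b\<bar> \<le> d / 2"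
    using d by (auto simp: u_def field_simps)
  define e where "e = min (u / (r + 1)) (d / (2 * (norm b + 1)))"
  have e: "0 < e" "e * r \<le> u" "e * norm b < d / 2"
  proof -
    show "0 < e" using u d r_nonneg by (auto simp: e_def add_nonneg_pos intro!: divide_pos_pos)
    have "e * r \<le> u / (r + 1) * r" using r_nonneg by (intro mult_right_mono) (auto simp: e_def)
    also have "\<dots> \<le> u" using r_nonneg u by (simp add: field_simps)
    finally show "e * r \<le> u" .
    have "e * norm b \<le> d / (2 * (norm b + 1)) * norm b" by (intro mult_right_mono) (auto simp: e_def)
    also have "\<dots> = d / 2 * (norm b / (norm b + 1))" by simp
    also have "\<dots> < d / 2 * 1" using d by (intro mult_strict_left_mono) (auto simp: add_nonneg_pos)
    also have "\<dots> = d / 2" by simp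
    finally show "e * norm b < d / 2" .
  qed
  have "(1 - u) *\<^sub>R p \<in> E" using p E(1) by (simp add: subspace_scale)
  from T[OF this e(1)] obtain q' where q': "q' \<in> T" "norm (q' - (1 - u) *\<^sub>R p) < e" by blast
  define w where "w = q' - (1 - u) *\<^sub>R p"
  have q'w: "q' = (1 - u) *\<^sub>R p + w" by (simp add: w_def)
  have wx: "\<bar>w \<bullet> x\<bar> \<le> e * norm x" for x
    using q'(2) Cauchy_Schwarz_ineq2[of w x]
    by (metis less_imp_le mult_right_mono norm_ge_zero order_trans w_def)
  have "q' \<bullet> x \<le> 1" if x: "x \<in> supp" for x
  proof -
    have "p \<bullet> x \<le> 1" using q qp[of x] x E(2) by (metis subsetD)
    then have "(1 - u) * (p \<bullet> x) \<le> 1 - u" using u mult_left_mono[of "p \<bullet> x" 1 "1 - u"] by simp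
    moreover have "w \<bullet> x \<le> e * r"
      using wx[of x] supp_bounded[OF x] e(1) mult_left_mono[of "norm x" r e] by linarith
    ultimately show ?thesis using e(2) by (simp add: q'w inner_add_left)
  qed
  moreover have "q \<bullet> b - d < q' \<bullet> b"
  proof -
    have "q' \<bullet> b = q \<bullet> b - u * (q \<bullet> b) + w \<bullet> b"
      using qp[OF E(3)] by (simp add: q'w inner_add_left algebra_simps)
    moreover have "u * (q \<bullet> b) \<le> d / 2"
      using u mult_left_mono[of "q \<bullet> b" "\<bar>q \<bullet> b\<bar>" u] by linarith
    ultimately show ?thesis using wx[of b] e(3) by linarith
  qed
  ultimately show ?thesis using q'(1) by blast
qed

text \<open>With a countable \<open>T\<close> this makes membership in a dilation of the hull a measurable condition.\<close>
lemma dilation_iff_dense: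
  assumes "0 \<in> hull_supp" "0 \<le> t" "subspace E" "supp \<subseteq> E" "b \<in> E"
    and "\<And>y e. y \<in> E \<Longrightarrow> 0 < e \<Longrightarrow> \<exists>q\<in>T. norm (q - y) < e"
  shows "b \<in> (\<lambda>y. t *\<^sub>R y) ` hull_supp \<longleftrightarrow> (\<forall>q\<in>T. (\<forall>x\<in>supp. q \<bullet> x \<le> 1) \<longrightarrow> q \<bullet> b \<le> t)"
proof
  show "\<forall>q\<in>T. (\<forall>x\<in>supp. q \<bullet> x \<le> 1) \<longrightarrow> q \<bullet> b \<le> t" if "b \<in> (\<lambda>y. t *\<^sub>R y) ` hull_supp"
    using inner_le_of_dilation[OF that assms(2)] by blast
  assume *: "\<forall>q\<in>T. (\<forall>x\<in>supp. q \<bullet> x \<le> 1) \<longrightarrow> q \<bullet> b \<le> t"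
  show "b \<in> (\<lambda>y. t *\<^sub>R y) ` hull_supp"
  proof (rule dilation_of_inner_le[OF assms(1,2)])
    fix q assume q: "\<forall>x\<in>supp. q \<bullet> x \<le> 1"
    show "q \<bullet> b \<le> t"
    proof (rule field_le_epsilon)
      fix d :: real assume "0 < d"
      from polar_dense[OF assms(3-6) q this] obtain q' where
        "q' \<in> T" "\<forall>x\<in>supp. q' \<bullet> x \<le> 1" "q \<bullet> b - d < q' \<bullet> b" by blast
      then show "q \<bullet> b \<le> t + d" using * by fastforce
    qed
  qed
qed

lemma minkowski_eq_SUP:
  assumes "0 \<in> hull_supp" "subspace E" "supp \<subseteq> E" "b \<in> E"
    and T: "\<And>y e. y \<in> E \<Longrightarrow> 0 < e \<Longrightarrow> \<exists>q\<in>T. norm (q - y) < e"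
  shows "minkowski b hull_supp = (SUP q\<in>{q\<in>T. \<forall>x\<in>supp. q \<bullet> x \<le> 1}. ereal (q \<bullet> b))"
    (is "_ = ?s")
proof (rule antisym)
  have sneg: "ereal (- d) \<le> ?s" if d: "0 < d" for d
  proof -
    obtain q where q: "q \<in> T" "\<forall>x\<in>supp. q \<bullet> x \<le> 1" "- d < q \<bullet> b"
      using polar_dense[OF assms(2-5), of 0 d] d by auto
    have "ereal (- d) \<le> ereal (q \<bullet> b)" using q(3) by simp
    also have "\<dots> \<le> ?s" using q by (intro SUP_upper) auto
    finally show ?thesis .
  qed
  show "minkowski b hull_supp \<le> ?s"
  proof (cases ?s)
    case (real t)
    have t: "0 \<le> t"
    proof (rule field_le_epsilon)
      fix e :: real assume "0 < e"
      then have "ereal (- e) \<le> ereal t" using sneg[of e] unfolding real by simp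
      then show "0 \<le> t + e" by simp
    qed
    have le: "q \<bullet> b \<le> t" if "q \<in> T" "\<forall>x\<in>supp. q \<bullet> x \<le> 1" for q
    proof -
      have "ereal (q \<bullet> b) \<le> ?s" using that by (intro SUP_upper) auto
      then show ?thesis by (simp add: real)
    qed
    show ?thesis unfolding real
    proof (rule ereal_le_epsilon2)
      fix e :: real assume e: "0 < e"
      have "b \<in> (\<lambda>y. (t + e) *\<^sub>R y) ` hull_supp"
        using dilation_iff_dense[OF assms(1) _ assms(2-5), of "t + e"] le t e by force
      then show "minkowski b hull_supp \<le> ereal t + ereal e"
        unfolding minkowski_def using t e by (intro Inf_lower) auto
    qed
  next
    case MInf
    then show ?thesis using sneg[of 1] by simp
  qed simp
  show "?s \<le> minkowski b hull_supp"
    unfolding minkowski_def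
  proof (intro SUP_least Inf_greatest)
    fix q u assume q: "q \<in> {q \<in> T. \<forall>x\<in>supp. q \<bullet> x \<le> 1}"
      and "u \<in> {ereal t |t. 0 < t \<and> b \<in> (\<lambda>y. t *\<^sub>R y) ` hull_supp}"
    then obtain t where "u = ereal t" "0 < t" "b \<in> (\<lambda>y. t *\<^sub>R y) ` hull_supp" by blast
    then show "ereal (q \<bullet> b) \<le> u" using inner_le_of_dilation[of b t q] q by simp
  qed
qed

end
section \<open>Measurable projections\<close>

text \<open>The best of the first \<open>k\<close> candidates is a measurable choice; by the variational inequality
  for the projection, a minimising sequence in a convex set converges to the projection.\<close>
lemma measurable_closest_point:
  fixes y :: "nat \<Rightarrow> 'a \<Rightarrow> 'b::euclidean_space"
  assumes [measurable]: "\<And>j. y j \<in> borel_measurable G" "m \<in> borel_measurable G"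
  shows "\<exists>p\<in>borel_measurable G. \<forall>w. convex (closure (range (\<lambda>j. y j w))) \<longrightarrow>
           p w = closest_point (closure (range (\<lambda>j. y j w))) (m w)"
proof -
  define z where "z = rec_nat (y 0) (\<lambda>k u w. if dist (m w) (y (Suc k) w) < dist (m w) (u w)
      then y (Suc k) w else u w)"
  have z_simps: "z 0 = y 0" "\<And>k. z (Suc k) = (\<lambda>w. if dist (m w) (y (Suc k) w) < dist (m w) (z k w)
      then y (Suc k) w else z k w)" by (simp_all only: z_def nat.rec)
  have [measurable]: "z k \<in> borel_measurable G" for k
    by (induction k) (simp_all add: z_simps)
  have z_range: "z k w \<in> range (\<lambda>j. y j w)" for k w
    by (induction k) (auto simp: z_simps)
  have z_le: "dist (m w) (z k w) \<le> dist (m w) (y j w)" if "j \<le> k" for j k w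
    using that by (induction k) (auto simp: z_simps le_Suc_eq)
  have conv: "(\<lambda>k. z k w) \<longlonglongrightarrow> closest_point (closure (range (\<lambda>j. y j w))) (m w)"
    if cv: "convex (closure (range (\<lambda>j. y j w)))" for w
  proof -
    define V where "V = closure (range (\<lambda>j. y j w))"
    define c where "c = closest_point V (m w)"
    have V: "closed V" "V \<noteq> {}" "convex V" using cv by (auto simp: V_def)
    have cV: "c \<in> V" unfolding c_def using V by (intro closest_point_in_set)
    have zV: "z k w \<in> V" for k unfolding V_def using z_range closure_subset by blast
    have le: "dist (m w) c \<le> dist (m w) (z k w)" for k
      unfolding c_def by (rule closest_point_le[OF V(1) zV])
    have pyth: "(dist (z k w) c)\<^sup>2 \<le> (dist (m w) (z k w))\<^sup>2 - (dist (m w) c)\<^sup>2" for k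
    proof -
      have "(m w - c) \<bullet> (z k w - c) \<le> 0"
        unfolding c_def by (rule closest_point_dot[OF V(3,1) zV])
      then show ?thesis
        by (simp add: dist_norm power2_norm_eq_inner inner_simps algebra_simps inner_commute)
    qed
    have "(\<lambda>k. dist (m w) (z k w)) \<longlonglongrightarrow> dist (m w) c"
    proof (rule LIMSEQ_I)
      fix e :: real assume "0 < e"
      then obtain j where j: "dist (y j w) c < e"
        using cV unfolding V_def closure_approachable by blast
      have "norm (dist (m w) (z k w) - dist (m w) c) < e" if "j \<le> k" for k
        using le[of k] z_le[OF that, of w] j dist_triangle[of "m w" "y j w" c]
        by (simp add: dist_commute)
      then show "\<exists>no. \<forall>k\<ge>no. norm (dist (m w) (z k w) - dist (m w) c) < e" by blast
    qed
    then have "(\<lambda>k. (dist (m w) (z k w))\<^sup>2 - (dist (m w) c)\<^sup>2) \<longlonglongrightarrow> (dist (m w) c)\<^sup>2 - (dist (m w) c)\<^sup>2"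
      by (intro tendsto_diff tendsto_power tendsto_const)
    then have sq: "(\<lambda>k. (dist (m w) (z k w))\<^sup>2 - (dist (m w) c)\<^sup>2) \<longlonglongrightarrow> 0"
      unfolding diff_self .
    have "(\<lambda>k. (dist (z k w) c)\<^sup>2) \<longlonglongrightarrow> 0"
      by (rule tendsto_sandwich[OF _ _ tendsto_const sq]) (intro always_eventually allI pyth zero_le_power2)+
    from tendsto_real_sqrt[OF this] have "(\<lambda>k. dist (z k w) c) \<longlonglongrightarrow> 0" by simp
    then show ?thesis unfolding c_def V_def
      by (rule iffD2[OF tendsto_dist_iff])
  qed
  show ?thesis
    by (rule bexI[of _ "\<lambda>w. lim (\<lambda>k. z k w)"]) (use conv in \<open>auto intro: limI\<close>)
qed

section \<open>Disintegration along the conditional distribution\<close>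

locale cond_law = prob_space M for M :: "'a measure" +
  fixes G :: "'a measure" and X :: "'a \<Rightarrow> real ^ 'd" and K :: "'a \<Rightarrow> (real ^ 'd) measure" and r :: real
  assumes subalg: "subalgebra M G"
    and X_measurable [measurable]: "X \<in> borel_measurable M"
    and X_bounded: "AE w in M. norm (X w) \<le> r"
    and rcd: "regular_cond_distr M G X K"

sublocale cond_law \<subseteq> finite_measure_subalgebra M G
  by unfold_locales (rule subalg)

context cond_law
begin

lemma G_measurable: "f \<in> borel_measurable G \<Longrightarrow> f \<in> borel_measurable M"
  by (rule measurable_from_subalg[OF subalg])

lemma space_G: "space G = space M"
  using subalg by (simp add: subalgebra_def)

lemma sets_G: "A \<in> sets G \<Longrightarrow> A \<in> sets M"
  using subalg by (auto simp: subalgebra_def)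

lemma K_prob [measurable]: "K \<in> G \<rightarrow>\<^sub>M prob_algebra borel"
  using rcd by (simp add: regular_cond_distr_def)

lemma K_subprob [measurable]: "K \<in> G \<rightarrow>\<^sub>M subprob_algebra borel"
  by (rule measurable_prob_algebraD[OF K_prob])

lemma K_law:
  assumes "w \<in> space M"
  shows "prob_space (K w)" "sets (K w) = sets borel" "space (K w) = UNIV"
proof -
  have "K w \<in> space (prob_algebra borel)"
    using measurable_space[OF K_prob] assms by (simp add: space_G)
  then show "prob_space (K w)" and *: "sets (K w) = sets borel"
    by (simp_all add: space_prob_algebra)
  show "space (K w) = UNIV" using sets_eq_imp_space_eq[OF *] by simp
qed

lemma pair_measurable [measurable]: "(\<lambda>w. (w, X w)) \<in> M \<rightarrow>\<^sub>M G \<Otimes>\<^sub>M borel"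
  by (intro measurable_Pair X_measurable measurable_from_subalg[OF subalg] measurable_ident_sets refl)

lemma rectangle:
  assumes A: "A \<in> sets G" and B: "B \<in> sets borel"
  shows "emeasure M {w\<in>space M. w \<in> A \<and> X w \<in> B} = (\<integral>\<^sup>+w. indicator A w * emeasure (K w) B \<partial>M)"
proof -
  have [measurable]: "A \<in> sets M" using sets_G[OF A] .
  note [measurable] = A B
  let ?c = "real_cond_exp M G (\<lambda>w. indicator B (X w))"
  have int: "integrable M (\<lambda>w. indicat_real A w * indicat_real B (X w))"
    by (intro integrable_const_bound[where B=1]) (auto simp: indicator_def)
  have "AE w in M. measure (K w) B = ?c w"
    using rcd B by (auto simp: regular_cond_distr_def)
  then have "AE w in M. indicator A w * emeasure (K w) B = ennreal (indicat_real A w * ?c w)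
      \<and> 0 \<le> indicat_real A w * ?c w"
    using AE_space
  proof eventually_elim
    case (elim w)
    interpret Kw: prob_space "K w" using K_law elim by simp
    show ?case
      unfolding elim(1)[symmetric] by (simp add: Kw.emeasure_eq_measure indicator_def)
  qed
  then have "(\<integral>\<^sup>+w. indicator A w * emeasure (K w) B \<partial>M) = (\<integral>\<^sup>+w. ennreal (indicat_real A w * ?c w) \<partial>M)"
    and nn: "AE w in M. 0 \<le> indicat_real A w * ?c w"
    by (auto intro: nn_integral_cong_AE)
  note this(1)
  also have "(\<integral>\<^sup>+w. ennreal (indicat_real A w * ?c w) \<partial>M) = ennreal (\<integral>w. indicat_real A w * ?c w \<partial>M)"
    by (intro nn_integral_eq_integral nn real_cond_exp_intg(1)[OF int]) auto
  also have "(\<integral>w. indicat_real A w * ?c w \<partial>M) = (\<integral>w. indicat_real A w * indicat_real B (X w) \<partial>M)"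
    by (intro real_cond_exp_intg(2)[OF int]) auto
  also have "\<dots> = (\<integral>w. indicat_real {w\<in>space M. w \<in> A \<and> X w \<in> B} w \<partial>M)"
    by (intro Bochner_Integration.integral_cong) (auto simp: indicator_def)
  also have "ennreal \<dots> = emeasure M {w\<in>space M. w \<in> A \<and> X w \<in> B}"
    by (simp add: emeasure_eq_measure Int_absorb2 subset_eq)
  finally show ?thesis ..
qed

lemma kernel_graph_measurable:
  "(\<lambda>w. distr (K w) (G \<Otimes>\<^sub>M borel) (Pair w)) \<in> restr_to_subalg M G \<rightarrow>\<^sub>M subprob_algebra (G \<Otimes>\<^sub>M borel)"
  by (intro measurable_distr2[where M=borel] measurable_in_subalg[OF subalg] K_subprob) simp

text \<open>Both sides agree on rectangles, by the defining property of the conditional distribution.\<close>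
lemma joint_law:
  "distr M (G \<Otimes>\<^sub>M borel) (\<lambda>w. (w, X w))
   = restr_to_subalg M G \<bind> (\<lambda>w. distr (K w) (G \<Otimes>\<^sub>M borel) (Pair w))" (is "?L = ?R")
proof (rule measure_eqI_generator_eq)
  let ?E = "{A \<times> B | A B. A \<in> sets G \<and> B \<in> sets (borel :: (real^'d) measure)}"
  show "Int_stable ?E" by (rule Int_stable_pair_measure_generator)
  show "?E \<subseteq> Pow (space G \<times> space borel)" by (rule pair_measure_closed)
  show "sets ?L = sigma_sets (space G \<times> space borel) ?E" by (simp add: sets_pair_measure)
  show "sets ?R = sigma_sets (space G \<times> space borel) ?E"
    by (subst sets_bind[where N="G \<Otimes>\<^sub>M borel"])
      (auto simp: space_restr_to_subalg not_empty sets_pair_measure)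
  show "range (\<lambda>_::nat. space G \<times> space borel) \<subseteq> ?E"
    using sets.top[of G] sets.top[of borel] by fast
  show "(\<Union>i::nat. space G \<times> space borel) = space G \<times> space borel" by simp
  interpret D: prob_space ?L by (rule prob_space_distr) measurable
  show "emeasure ?L (space G \<times> space borel) \<noteq> \<infinity>" for i :: nat by simp
  fix C assume "C \<in> ?E"
  then obtain A B where C: "C = A \<times> B" and A: "A \<in> sets G" and B: "B \<in> sets borel" by blast
  have "emeasure ?L C = emeasure M {w\<in>space M. w \<in> A \<and> X w \<in> B}"
    using A B unfolding C by (subst emeasure_distr) (auto intro!: arg_cong[where f="emeasure M"])
  also have "\<dots> = (\<integral>\<^sup>+w. indicator A w * emeasure (K w) B \<partial>M)"
    by (rule rectangle[OF A B])
  also have "\<dots> = (\<integral>\<^sup>+w. emeasure (distr (K w) (G \<Otimes>\<^sub>M borel) (Pair w)) C \<partial>M)"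
  proof (intro nn_integral_cong)
    fix w assume in_M: "w \<in> space M"
    have Pm: "Pair w \<in> K w \<rightarrow>\<^sub>M G \<Otimes>\<^sub>M borel"
      using K_law[OF in_M] in_M by (subst measurable_cong_sets[OF K_law(2)[OF in_M] refl]) (auto simp: space_G)
    have "emeasure (distr (K w) (G \<Otimes>\<^sub>M borel) (Pair w)) C
        = emeasure (K w) (Pair w -` C \<inter> space (K w))"
      unfolding C by (rule emeasure_distr[OF Pm pair_measureI[OF A B]])
    also have "Pair w -` C \<inter> space (K w) = (if w \<in> A then B else {})"
      unfolding K_law(3)[OF in_M] C by auto
    finally show "indicator A w * emeasure (K w) B = emeasure (distr (K w) (G \<Otimes>\<^sub>M borel) (Pair w)) C"
      by (simp add: indicator_def)
  qed
  also have "\<dots> = (\<integral>\<^sup>+w. emeasure (distr (K w) (G \<Otimes>\<^sub>M borel) (Pair w)) C \<partial>restr_to_subalg M G)"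
  proof (rule nn_integral_subalgebra2[OF subalg, symmetric])
    have "(\<lambda>w. distr (K w) (G \<Otimes>\<^sub>M borel) (Pair w)) \<in> G \<rightarrow>\<^sub>M subprob_algebra (G \<Otimes>\<^sub>M borel)"
      by (intro measurable_distr2[where M=borel] K_subprob) simp
    then show "(\<lambda>w. emeasure (distr (K w) (G \<Otimes>\<^sub>M borel) (Pair w)) C) \<in> borel_measurable G"
      by (rule measurable_compose[OF _ measurable_emeasure_subprob_algebra]) (use A B C in auto)
  qed
  also have "\<dots> = emeasure ?R C"
    by (subst emeasure_bind[OF _ kernel_graph_measurable])
      (use A B C in \<open>auto simp: space_restr_to_subalg not_empty\<close>)
  finally show "emeasure ?L C = emeasure ?R C" .
qed

lemma disintegration_nn:
  assumes [measurable]: "H \<in> borel_measurable (G \<Otimes>\<^sub>M borel)"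
  shows "(\<integral>\<^sup>+w. H (w, X w) \<partial>M) = (\<integral>\<^sup>+w. (\<integral>\<^sup>+x. H (w, x) \<partial>K w) \<partial>M)"
proof -
  have "(\<integral>\<^sup>+w. H (w, X w) \<partial>M) = (\<integral>\<^sup>+z. H z \<partial>distr M (G \<Otimes>\<^sub>M borel) (\<lambda>w. (w, X w)))"
    by (simp add: nn_integral_distr)
  also have "\<dots> = (\<integral>\<^sup>+w. (\<integral>\<^sup>+z. H z \<partial>distr (K w) (G \<Otimes>\<^sub>M borel) (Pair w)) \<partial>restr_to_subalg M G)"
    unfolding joint_law by (rule nn_integral_bind[OF assms kernel_graph_measurable])
  also have "\<dots> = (\<integral>\<^sup>+w. (\<integral>\<^sup>+x. H (w, x) \<partial>K w) \<partial>restr_to_subalg M G)"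
  proof (intro nn_integral_cong)
    fix w assume "w \<in> space (restr_to_subalg M G)"
    then have in_M: "w \<in> space M" by (simp add: space_restr_to_subalg)
    have "Pair w \<in> K w \<rightarrow>\<^sub>M G \<Otimes>\<^sub>M borel"
      using in_M by (subst measurable_cong_sets[OF K_law(2)[OF in_M] refl]) (auto simp: space_G)
    then show "(\<integral>\<^sup>+z. H z \<partial>distr (K w) (G \<Otimes>\<^sub>M borel) (Pair w)) = (\<integral>\<^sup>+x. H (w, x) \<partial>K w)"
      by (rule nn_integral_distr) (subst measurable_distr_eq1, rule assms)
  qed
  also have "\<dots> = (\<integral>\<^sup>+w. (\<integral>\<^sup>+x. H (w, x) \<partial>K w) \<partial>M)"
    by (intro nn_integral_subalgebra2[OF subalg] nn_integral_measurable_subprob_algebra2[where N=borel]) auto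
  finally show ?thesis .
qed

lemma kernel_nn_integral_measurable:
  assumes "H \<in> borel_measurable (G \<Otimes>\<^sub>M borel)"
  shows "(\<lambda>w. \<integral>\<^sup>+x. H (w, x) \<partial>K w) \<in> borel_measurable G"
  using assms by (intro nn_integral_measurable_subprob_algebra2[where N=borel]) auto

lemma section_measurable:
  assumes "H \<in> borel_measurable (G \<Otimes>\<^sub>M borel)" "w \<in> space M"
  shows "(\<lambda>x. H (w, x)) \<in> borel_measurable (K w)"
  using assms K_law(2)[OF assms(2)]
  by (subst measurable_cong_sets[OF K_law(2)[OF assms(2)] refl]) (auto simp: space_G)

lemma disintegration_AE:
  assumes [measurable]: "Measurable.pred (G \<Otimes>\<^sub>M borel) P"
  shows "(AE w in M. P (w, X w)) \<longleftrightarrow> (AE w in M. AE x in K w. P (w, x))"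
proof -
  let ?H = "\<lambda>z. indicator {z. \<not> P z} z :: ennreal"
  have [measurable]: "?H \<in> borel_measurable (G \<Otimes>\<^sub>M borel)"
  proof -
    have "(\<lambda>z. if P z then 0 else 1 :: ennreal) \<in> borel_measurable (G \<Otimes>\<^sub>M borel)" by measurable
    also have "(\<lambda>z. if P z then 0 else 1 :: ennreal) = ?H" by (auto simp: indicator_def)
    finally show ?thesis .
  qed
  note Hm = this
  have [measurable]: "(\<lambda>w. ?H (w, X w)) \<in> borel_measurable M"
    by (rule measurable_compose[OF pair_measurable]) measurable
  have "(AE w in M. P (w, X w)) \<longleftrightarrow> (AE w in M. ?H (w, X w) = 0)"
    by (simp add: indicator_eq_0_iff)
  also have "\<dots> \<longleftrightarrow> (\<integral>\<^sup>+w. ?H (w, X w) \<partial>M) = 0" by (subst nn_integral_0_iff_AE) auto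
  also have "\<dots> \<longleftrightarrow> (AE w in M. (\<integral>\<^sup>+x. ?H (w, x) \<partial>K w) = 0)"
    by (subst disintegration_nn)
      (auto intro!: nn_integral_0_iff_AE G_measurable kernel_nn_integral_measurable)
  also have "\<dots> \<longleftrightarrow> (AE w in M. AE x in K w. P (w, x))"
  proof (rule AE_cong)
    fix w assume in_M: "w \<in> space M"
    show "(\<integral>\<^sup>+x. ?H (w, x) \<partial>K w) = 0 \<longleftrightarrow> (AE x in K w. P (w, x))"
      by (subst nn_integral_0_iff_AE[OF section_measurable[OF Hm in_M]])
        (simp only: indicator_eq_0_iff mem_Collect_eq not_not)
  qed
  finally show ?thesis .
qed

text \<open>The inner integral enters through a measurable version \<open>v\<close>, since \<open>h (w, x)\<close> need not be
  integrable in \<open>x\<close> for every \<open>w\<close>.\<close>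
lemma disintegration_integral:
  assumes [measurable]: "h \<in> borel_measurable (G \<Otimes>\<^sub>M borel)"
    and int: "integrable M (\<lambda>w. h (w, X w) :: real)"
    and v: "v \<in> borel_measurable M" "AE w in M. (\<integral>x. h (w, x) \<partial>K w) = v w"
  shows "integrable M v" "(\<integral>w. v w \<partial>M) = (\<integral>w. h (w, X w) \<partial>M)"
proof -
  define p n where "p w = (\<integral>\<^sup>+x. ennreal (h (w, x)) \<partial>K w)"
    and "n w = (\<integral>\<^sup>+x. ennreal (- h (w, x)) \<partial>K w)" for w
  have [measurable]: "p \<in> borel_measurable M" "n \<in> borel_measurable M"
    unfolding p_def n_def by (intro G_measurable kernel_nn_integral_measurable; simp)+
  have hX: "(\<lambda>w. h (w, X w)) \<in> borel_measurable M" using int by simp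
  have P: "(\<integral>\<^sup>+w. ennreal (h (w, X w)) \<partial>M) = (\<integral>\<^sup>+w. p w \<partial>M)"
    unfolding p_def by (rule disintegration_nn) simp
  have N: "(\<integral>\<^sup>+w. ennreal (- h (w, X w)) \<partial>M) = (\<integral>\<^sup>+w. n w \<partial>M)"
    unfolding n_def by (rule disintegration_nn) simp
  have fin: "(\<integral>\<^sup>+w. p w \<partial>M) \<noteq> \<infinity>" "(\<integral>\<^sup>+w. n w \<partial>M) \<noteq> \<infinity>"
    unfolding P[symmetric] N[symmetric] using int by (auto simp: real_integrable_def)
  have fAE: "AE w in M. p w \<noteq> \<infinity>" "AE w in M. n w \<noteq> \<infinity>"
    using fin by (intro nn_integral_noteq_infinite; simp)+
  have vpn: "AE w in M. v w = enn2real (p w) - enn2real (n w)"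
    using fAE v(2) AE_space
  proof eventually_elim
    case (elim w)
    have "integrable (K w) (\<lambda>x. h (w, x))"
      unfolding real_integrable_def
      using elim(1,2) section_measurable[OF assms(1) elim(4)] unfolding p_def n_def by blast
    from real_lebesgue_integral_def[OF this] show ?case
      unfolding p_def n_def elim(3) .
  qed
  have ep: "(\<integral>\<^sup>+w. ennreal (enn2real (p w)) \<partial>M) = (\<integral>\<^sup>+w. p w \<partial>M)"
    by (intro nn_integral_cong_AE) (use fAE(1) in \<open>auto elim!: eventually_mono simp: less_top\<close>)
  have en: "(\<integral>\<^sup>+w. ennreal (enn2real (n w)) \<partial>M) = (\<integral>\<^sup>+w. n w \<partial>M)"
    by (intro nn_integral_cong_AE) (use fAE(2) in \<open>auto elim!: eventually_mono simp: less_top\<close>)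
  have ip: "integrable M (\<lambda>w. enn2real (p w))" "integrable M (\<lambda>w. enn2real (n w))"
    using ep en fin by (auto intro!: integrableI_nonneg simp: less_top)
  show "integrable M v"
    using vpn v(1) ip by (subst integrable_cong_AE[where g="\<lambda>w. enn2real (p w) - enn2real (n w)"]) auto
  have "(\<integral>w. v w \<partial>M) = (\<integral>w. enn2real (p w) - enn2real (n w) \<partial>M)"
    using vpn v(1) by (intro integral_cong_AE) auto
  also have "\<dots> = (\<integral>w. enn2real (p w) \<partial>M) - (\<integral>w. enn2real (n w) \<partial>M)"
    using ip by simp
  also have "(\<integral>w. enn2real (p w) \<partial>M) = enn2real (\<integral>\<^sup>+w. p w \<partial>M)"
    using ep by (subst integral_eq_nn_integral) auto
  also have "(\<integral>w. enn2real (n w) \<partial>M) = enn2real (\<integral>\<^sup>+w. n w \<partial>M)"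
    using en by (subst integral_eq_nn_integral) auto
  also have "enn2real (\<integral>\<^sup>+w. p w \<partial>M) - enn2real (\<integral>\<^sup>+w. n w \<partial>M) = (\<integral>w. h (w, X w) \<partial>M)"
    unfolding P[symmetric] N[symmetric] using int by (simp add: real_lebesgue_integral_def)
  finally show "(\<integral>w. v w \<partial>M) = (\<integral>w. h (w, X w) \<partial>M)" .
qed

text \<open>Adding the bound reduces the claim to integrals of non-negative functions.\<close>
lemma kernel_integral_measurable:
  assumes [measurable]: "h \<in> borel_measurable borel" and B: "\<And>x. \<bar>h x\<bar> \<le> (B::real)"
  shows "(\<lambda>w. \<integral>x. h x \<partial>K w) \<in> borel_measurable G"
proof -
  have "(\<lambda>w. enn2real (\<integral>\<^sup>+x. ennreal (h (snd (w, x)) + B) \<partial>K w) - B) \<in> borel_measurable G"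
    by (intro borel_measurable_diff borel_measurable_const measurable_compose[OF kernel_nn_integral_measurable])
      auto
  moreover have "(\<integral>x. h x \<partial>K w) = enn2real (\<integral>\<^sup>+x. ennreal (h (snd (w, x)) + B) \<partial>K w) - B"
    if in_M: "w \<in> space G" for w
  proof -
    have in_M: "w \<in> space M" using in_M by (simp add: space_G)
    interpret Kw: prob_space "K w" by (rule K_law(1)[OF in_M])
    have [measurable]: "h \<in> borel_measurable (K w)"
      using assms(1) measurable_cong_sets[OF K_law(2)[OF in_M] refl] by blast
    have i: "integrable (K w) h" using B by (intro Kw.integrable_const_bound[where B=B]) auto
    have "0 \<le> h x + B" for x using B[of x] by linarith
    then have "enn2real (\<integral>\<^sup>+x. ennreal (h (snd (w, x)) + B) \<partial>K w) = (\<integral>x. h x + B \<partial>K w)"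
      by (subst integral_eq_nn_integral) auto
    also have "\<dots> = (\<integral>x. h x \<partial>K w) + B" using i by (simp add: Kw.prob_space)
    finally show ?thesis by simp
  qed
  ultimately show ?thesis by (subst measurable_cong) auto
qed

lemma AE_bounded_law: "AE w in M. bounded_law (K w) r"
proof -
  have "AE w in M. AE x in K w. norm (snd (w, x)) \<le> r"
    using disintegration_AE[of "\<lambda>z. norm (snd z) \<le> r"] X_bounded by simp
  then show ?thesis using AE_space
    by eventually_elim (auto intro!: bounded_law.intro bounded_law_axioms.intro K_law)
qed

end
lemma borel_measurable_vecI:
  fixes f :: "'a \<Rightarrow> real ^ 'n"
  assumes "\<And>i. (\<lambda>w. f w $ i) \<in> borel_measurable M"
  shows "f \<in> borel_measurable M"
  using assms by (subst borel_measurable_euclidean_space) (auto simp: Basis_vec_def inner_axis)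

lemma borel_measurable_vec_nth [measurable (raw)]:
  fixes f :: "'a \<Rightarrow> real ^ 'n"
  assumes [measurable]: "f \<in> borel_measurable M"
  shows "(\<lambda>w. f w $ i) \<in> borel_measurable M"
  unfolding cart_eq_inner_axis by measurable

lemma borel_measurable_nth [measurable]: "(\<lambda>x::real ^ 'n. x $ i) \<in> borel_measurable borel"
  by (rule borel_measurable_vec_nth) simp

lemma measurable_cball [measurable]: "cball x e \<in> sets borel"
  by simp

lemma borel_measurable_vec_cond_exp [measurable]: "vec_cond_exp M G f \<in> borel_measurable G"
  unfolding vec_cond_exp_def by (rule borel_measurable_vecI) simp

context cond_law
begin

text \<open>The cut-off makes the integrals measurable in \<open>w\<close> without exceptional sets.\<close>
definition kernel_mean :: "(real ^ 'd \<Rightarrow> real) \<Rightarrow> 'a \<Rightarrow> real ^ 'd" where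
  "kernel_mean \<phi> w = (\<chi> i. \<integral>x. \<phi> x * (indicat_real (cball 0 r) x * x $ i) \<partial>K w)"

lemma cut_off_bound:
  fixes x :: "real ^ 'd"
  assumes "\<bar>\<phi> x\<bar> \<le> B"
  shows "\<bar>\<phi> x * (indicat_real (cball 0 r) x * x $ i)\<bar> \<le> B * \<bar>r\<bar>"
proof -
  have "\<bar>indicat_real (cball 0 r) x * x $ i\<bar> \<le> \<bar>r\<bar>"
    using component_le_norm_cart[of x i] by (auto simp: indicator_def)
  then show ?thesis using assms by (simp add: abs_mult mult_mono)
qed

lemma kernel_mean_measurable:
  assumes "\<phi> \<in> borel_measurable borel" "\<And>x. \<bar>\<phi> x\<bar> \<le> B"
  shows "kernel_mean \<phi> \<in> borel_measurable G"
  unfolding kernel_mean_def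
proof (rule borel_measurable_vecI, simp only: vec_lambda_beta, rule kernel_integral_measurable)
  show "\<bar>\<phi> x * (indicat_real (cball 0 r) x * x $ i)\<bar> \<le> B * \<bar>r\<bar>" for x i
    by (rule cut_off_bound[OF assms(2)])
qed (use assms(1) in measurable)

lemma kernel_mean_bounded:
  assumes "\<phi> \<in> borel_measurable borel" "\<And>x. \<bar>\<phi> x\<bar> \<le> B" "w \<in> space M"
  shows "norm (kernel_mean \<phi> w) \<le> CARD('d) * (B * \<bar>r\<bar>)"
proof -
  interpret Kw: prob_space "K w" by (rule K_law(1)[OF assms(3)])
  have "\<bar>\<integral>x. \<phi> x * (indicat_real (cball 0 r) x * x $ i) \<partial>K w\<bar> \<le> B * \<bar>r\<bar>" for i
  proof -
    have "\<bar>\<integral>x. \<phi> x * (indicat_real (cball 0 r) x * x $ i) \<partial>K w\<bar>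
        \<le> (\<integral>x. \<bar>\<phi> x * (indicat_real (cball 0 r) x * x $ i)\<bar> \<partial>K w)"
      by (rule integral_abs_bound)
    also have "\<dots> \<le> (\<integral>x. B * \<bar>r\<bar> \<partial>K w)"
      using cut_off_bound[of \<phi> _ B i, OF assms(2)] order_trans[OF abs_ge_zero cut_off_bound[of \<phi> _ B i, OF assms(2)]]
      by (intro integral_mono') auto
    finally show ?thesis by (simp add: Kw.prob_space)
  qed
  then have "(\<Sum>i\<in>UNIV. \<bar>kernel_mean \<phi> w $ i\<bar>) \<le> (\<Sum>i\<in>(UNIV::'d set). B * \<bar>r\<bar>)"
    by (intro sum_mono) (simp add: kernel_mean_def)
  then show ?thesis
    using norm_le_l1_cart[of "kernel_mean \<phi> w"] by simp
qed

lemma kernel_mean_eq: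
  assumes \<phi>: "\<phi> \<in> borel_measurable borel" "\<And>x. \<bar>\<phi> x\<bar> \<le> B" and law: "bounded_law (K w) r"
  shows "kernel_mean \<phi> w = (\<integral>x. \<phi> x *\<^sub>R x \<partial>K w)"
proof -
  interpret L: bounded_law "K w" r by (rule law)
  have m [measurable]: "\<phi> \<in> borel_measurable (K w)"
    using \<phi>(1) measurable_cong_sets[OF L.sets_eq refl] by blast
  have [measurable]: "(\<lambda>x. x) \<in> borel_measurable (K w)" by (rule measurable_ident_sets[OF L.sets_eq])
  have "AE x in K w. norm (\<phi> x *\<^sub>R x) \<le> B * r"
    using L.AE_bounded by eventually_elim (use \<phi>(2) L.r_nonneg in \<open>auto intro!: mult_mono order_trans[OF abs_ge_zero \<phi>(2)]\<close>)
  then have int: "integrable (K w) (\<lambda>x. \<phi> x *\<^sub>R x)"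
    by (intro L.integrable_const_bound[where B="B * r"]) auto
  have "(\<integral>x. \<phi> x *\<^sub>R x \<partial>K w) $ i = (\<integral>x. \<phi> x * (indicat_real (cball 0 r) x * x $ i) \<partial>K w)" for i
  proof -
    have "(\<integral>x. \<phi> x *\<^sub>R x \<partial>K w) $ i = axis i 1 \<bullet> (\<integral>x. \<phi> x *\<^sub>R x \<partial>K w)"
      by (simp add: cart_eq_inner_axis inner_commute)
    also have "\<dots> = (\<integral>x. axis i 1 \<bullet> (\<phi> x *\<^sub>R x) \<partial>K w)"
      by (rule integral_inner_right[symmetric]) (rule int)
    also have "\<dots> = (\<integral>x. \<phi> x * (indicat_real (cball 0 r) x * x $ i) \<partial>K w)"
    proof (rule integral_cong_AE)
      show "AE x in K w. axis i 1 \<bullet> (\<phi> x *\<^sub>R x) = \<phi> x * (indicat_real (cball 0 r) x * x $ i)"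
        using L.AE_bounded by eventually_elim (simp add: cart_eq_inner_axis inner_commute)
    qed (use int in measurable)
    finally show ?thesis .
  qed
  then show ?thesis by (simp add: kernel_mean_def vec_eq_iff)
qed

definition mean_seq :: "nat \<Rightarrow> 'a \<Rightarrow> real ^ 'd" where
  "mean_seq j = kernel_mean (step_density (from_nat j))"

definition mass_seq :: "nat \<Rightarrow> 'a \<Rightarrow> real" where
  "mass_seq j w = (\<integral>x. step_density (from_nat j) x \<partial>K w)"

lemma step_density_abs_bounded: "\<exists>B. \<forall>x::real^'d. \<bar>step_density L x\<bar> \<le> B"
  using step_density_bounded[of L] by simp

lemma mean_seq_measurable [measurable]: "mean_seq j \<in> borel_measurable G"
  unfolding mean_seq_def using step_density_abs_bounded kernel_mean_measurable step_density_measurable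
  by blast

lemma mass_seq_measurable [measurable]: "mass_seq j \<in> borel_measurable G"
  unfolding mass_seq_def using step_density_abs_bounded kernel_integral_measurable step_density_measurable
  by blast

lemma mean_seq_bounded: "\<exists>B. \<forall>w\<in>space M. norm (mean_seq j w) \<le> B"
  unfolding mean_seq_def using step_density_abs_bounded kernel_mean_bounded step_density_measurable
  by meson

lemma mean_seq_eq: "bounded_law (K w) r \<Longrightarrow> mean_seq j w = bounded_law.dmean (K w) (from_nat j)"
  unfolding mean_seq_def bounded_law.dmean_def
  using step_density_abs_bounded kernel_mean_eq step_density_measurable by blast

lemma mass_seq_eq: "bounded_law (K w) r \<Longrightarrow> mass_seq j w = bounded_law.dmass (K w) (from_nat j)"
  by (simp add: mass_seq_def bounded_law.dmass_def)

lemma range_mean_seq: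
  assumes "bounded_law (K w) r"
  shows "range (\<lambda>j. mean_seq j w) = range (bounded_law.dmean (K w))"
proof -
  have "range (\<lambda>j. mean_seq j w)
      = bounded_law.dmean (K w) ` range (from_nat :: nat \<Rightarrow> (rat \<times> nat) list)"
    by (simp only: mean_seq_eq[OF assms] image_image)
  then show ?thesis by (simp only: surj_from_nat)
qed

section \<open>One-step absence of arbitrage\<close>

text \<open>The arbitrage of \<open>projection_arbitrage\<close> is a measurable function of \<open>w\<close>, hence a strategy. Absence
  of arbitrage makes its gain vanish, which by \<open>projection_arbitrage\<close> means that the law was free of
  arbitrage.\<close>
lemma AE_arbitrage_free:
  assumes NA: "\<And>h. h \<in> borel_measurable G \<Longrightarrow> AE w in M. 0 \<le> h w \<bullet> X w \<Longrightarrow> AE w in M. h w \<bullet> X w = 0"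
  shows "AE w in M. arbitrage_free (K w)"
proof -
  define m where "m = kernel_mean (\<lambda>_. 1)"
  have [measurable]: "m \<in> borel_measurable G"
    unfolding m_def by (rule kernel_mean_measurable[where B=1]) auto
  obtain p where [measurable]: "p \<in> borel_measurable G"
    and p: "\<And>w. convex (closure (range (\<lambda>j. mean_seq j w))) \<Longrightarrow>
           p w = closest_point (closure (range (\<lambda>j. mean_seq j w))) (- m w)"
    using measurable_closest_point[of mean_seq G "\<lambda>w. - m w"] by auto
  define h where "h w = p w + m w" for w
  have [measurable]: "h \<in> borel_measurable G" unfolding h_def by measurable
  have h_eq: "h w = closest_point (closure (range (bounded_law.dmean (K w)))) (- (\<integral>x. x \<partial>K w)) + (\<integral>x. x \<partial>K w)"
    if law: "bounded_law (K w) r" for w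
  proof -
    interpret L: bounded_law "K w" r by (rule law)
    have "convex (closure (range L.dmean))"
      unfolding L.closure_range_dmean by (intro convex_closure convex_cone_hull convex_convex_hull)
    then show ?thesis
      using p[of w] kernel_mean_eq[of "\<lambda>_. 1" 1, OF _ _ law]
      by (simp add: h_def m_def range_mean_seq[OF law])
  qed
  have "AE w in M. AE x in K w. 0 \<le> h w \<bullet> x"
    using AE_bounded_law
    by eventually_elim (simp only: h_eq bounded_law.projection_arbitrage(1))
  then have "AE w in M. 0 \<le> h w \<bullet> X w"
    using disintegration_AE[of "\<lambda>z. 0 \<le> h (fst z) \<bullet> snd z"] by simp
  then have "AE w in M. h w \<bullet> X w = 0" by (intro NA) auto
  then have "AE w in M. AE x in K w. h w \<bullet> x = 0"
    using disintegration_AE[of "\<lambda>z. h (fst z) \<bullet> snd z = 0"] by simp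
  then show ?thesis
    using AE_bounded_law
    by eventually_elim (metis h_eq bounded_law.projection_arbitrage(2))
qed

lemma cond_exp_inner:
  assumes \<beta>: "integrable M \<beta>" and u [measurable]: "u \<in> borel_measurable G"
    and B: "\<And>w. w \<in> space M \<Longrightarrow> norm (u w) \<le> B"
  defines "a \<equiv> vec_cond_exp M G (\<lambda>w. \<beta> w *\<^sub>R X w)"
  shows "integrable M (\<lambda>w. \<beta> w * (u w \<bullet> X w))" "integrable M (\<lambda>w. u w \<bullet> a w)"
    "(\<integral>w. u w \<bullet> a w \<partial>M) = (\<integral>w. \<beta> w * (u w \<bullet> X w) \<partial>M)"
proof -
  have [measurable]: "\<beta> \<in> borel_measurable M" "u \<in> borel_measurable M"
    using \<beta> G_measurable[OF u] by auto
  have int: "integrable M (\<lambda>w. u w $ i * (\<beta> w * X w $ i))" for i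
  proof (rule Bochner_Integration.integrable_bound)
    show "integrable M (\<lambda>w. B * r * \<beta> w)" using \<beta> by simp
    show "AE w in M. norm (u w $ i * (\<beta> w * X w $ i)) \<le> norm (B * r * \<beta> w)"
      using X_bounded AE_space
    proof eventually_elim
      case (elim w)
      have "\<bar>u w $ i\<bar> \<le> B" "\<bar>X w $ i\<bar> \<le> r"
        using B[OF elim(2)] elim(1) component_le_norm_cart order_trans by blast+
      then have "\<bar>u w $ i\<bar> * \<bar>X w $ i\<bar> \<le> B * r" "0 \<le> B * r" by (auto intro!: mult_mono mult_nonneg_nonneg)
      then have "(\<bar>u w $ i\<bar> * \<bar>X w $ i\<bar>) * \<bar>\<beta> w\<bar> \<le> B * r * \<bar>\<beta> w\<bar>" by (intro mult_right_mono) auto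
      then show ?case
        unfolding real_norm_def abs_mult[of "B * r"] abs_of_nonneg[OF \<open>0 \<le> B * r\<close>]
        by (simp add: abs_mult mult_ac)
    qed
  qed measurable
  have gi: "a w $ i = real_cond_exp M G (\<lambda>w. \<beta> w * X w $ i) w" for i w
    by (simp add: a_def vec_cond_exp_def)
  have int': "integrable M (\<lambda>w. u w $ i * a w $ i)"
    "(\<integral>w. u w $ i * a w $ i \<partial>M) = (\<integral>w. u w $ i * (\<beta> w * X w $ i) \<partial>M)" for i
    unfolding gi by (intro real_cond_exp_intg int; measurable)+
  have eq: "\<beta> w * (u w \<bullet> X w) = (\<Sum>i\<in>UNIV. u w $ i * (\<beta> w * X w $ i))" for w
    by (simp add: inner_vec_def sum_distrib_left mult_ac)
  have eq': "u w \<bullet> a w = (\<Sum>i\<in>UNIV. u w $ i * a w $ i)" for w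
    by (simp add: inner_vec_def)
  show "integrable M (\<lambda>w. \<beta> w * (u w \<bullet> X w))" unfolding eq using int by simp
  show "integrable M (\<lambda>w. u w \<bullet> a w)" unfolding eq' using int' by simp
  show "(\<integral>w. u w \<bullet> a w \<partial>M) = (\<integral>w. \<beta> w * (u w \<bullet> X w) \<partial>M)"
    unfolding eq eq' using int int' by (simp add: Bochner_Integration.integral_sum)
qed

lemma kernel_AE_pred:
  assumes P [measurable]: "Measurable.pred (G \<Otimes>\<^sub>M borel) P"
  shows "Measurable.pred G (\<lambda>w. AE x in K w. P (w, x))"
proof -
  let ?H = "\<lambda>z. if P z then 0 else 1 :: ennreal"
  have H: "?H \<in> borel_measurable (G \<Otimes>\<^sub>M borel)" by measurable
  note [measurable] = kernel_nn_integral_measurable[OF H]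
  have "Measurable.pred G (\<lambda>w. (\<integral>\<^sup>+x. ?H (w, x) \<partial>K w) = 0)" by measurable
  moreover have eq: "(\<integral>\<^sup>+x. ?H (w, x) \<partial>K w) = 0 \<longleftrightarrow> (AE x in K w. P (w, x))" if "w \<in> space G" for w
  proof -
    have in_M: "w \<in> space M" using that by (simp add: space_G)
    show ?thesis
      by (subst nn_integral_0_iff_AE[OF section_measurable[OF H in_M]]) (rule AE_cong, simp)
  qed
  ultimately show ?thesis by (rule iffD1[OF measurable_cong, rotated])
qed

end

locale na_law = cond_law M G X K r
  for M :: "'a measure" and G and X :: "'a \<Rightarrow> real ^ 'd" and K and r +
  assumes AE_af: "AE w in M. arbitrage_free (K w)"
begin

lemma AE_good: "AE w in M. bounded_law (K w) r \<and> arbitrage_free (K w)"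
  using AE_bounded_law AE_af by eventually_elim simp

lemma closure_mean_seq:
  assumes "bounded_law (K w) r" "arbitrage_free (K w)"
  shows "closure (range (\<lambda>j. mean_seq j w)) = span (closed_support (K w))"
proof -
  interpret L: bounded_law "K w" r by (rule assms)
  show ?thesis
    unfolding range_mean_seq[OF assms(1)]
  proof (rule antisym)
    show "closure (range L.dmean) \<subseteq> span L.supp"
      by (intro closure_minimal closed_span) (auto simp: L.dmean_in_span)
    show "span L.supp \<subseteq> closure (range L.dmean)"
    proof
      fix x assume x: "x \<in> span L.supp"
      show "x \<in> closure (range L.dmean)"
        unfolding closure_approachable dist_norm
        using L.dmean_dense_span[OF assms(2) x] by blast
    qed
  qed
qed

lemma mean_seq_dense:
  assumes "bounded_law (K w) r" "arbitrage_free (K w)" "x \<in> span (closed_support (K w))" "0 < e"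
  shows "\<exists>q\<in>range (\<lambda>j. mean_seq j w). norm (q - x) < e"
  using assms(3,4) unfolding closure_mean_seq[OF assms(1,2), symmetric] closure_approachable
  by (auto simp: dist_norm)

text \<open>The component of the conditional mean that is orthogonal to the span of the support would be
  a measurable direction in which the increment vanishes.\<close>
lemma cond_mean_in_span:
  assumes \<beta>: "integrable M \<beta>"
  shows "AE w in M. vec_cond_exp M G (\<lambda>w. \<beta> w *\<^sub>R X w) w \<in> span (closed_support (K w))"
proof -
  define a where "a = vec_cond_exp M G (\<lambda>w. \<beta> w *\<^sub>R X w)"
  have [measurable]: "a \<in> borel_measurable G" by (simp add: a_def)
  obtain p where [measurable]: "p \<in> borel_measurable G"
    and p: "\<And>w. convex (closure (range (\<lambda>j. mean_seq j w))) \<Longrightarrow>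
           p w = closest_point (closure (range (\<lambda>j. mean_seq j w))) (a w)"
    using measurable_closest_point[of mean_seq G a] by auto
  \<comment> \<open>Normalised, since the duality with the conditional mean is used for bounded vectors only.\<close>
  define u where "u w = sgn (a w - p w)" for w
  have [measurable]: "u \<in> borel_measurable G" unfolding u_def sgn_div_norm by measurable
  have props: "p w \<in> span (closed_support (K w)) \<and> (AE x in K w. u w \<bullet> x = 0)
      \<and> u w \<bullet> a w = norm (a w - p w)"
    if good: "bounded_law (K w) r" "arbitrage_free (K w)" for w
  proof -
    interpret L: bounded_law "K w" r by (rule good)
    define V where "V = span L.supp"
    have V: "convex V" "closed V" "V \<noteq> {}"
      using span_zero[of L.supp] by (auto simp: V_def subspace_imp_convex)
    have pw: "p w = closest_point V (a w)"
      using p[of w] V by (simp add: closure_mean_seq[OF good] V_def)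
    have pV: "p w \<in> V" unfolding pw by (intro closest_point_in_set V)
    have orth: "(a w - p w) \<bullet> x = 0" if x: "x \<in> V" for x
    proof -
      have "p w + x \<in> V" "p w - x \<in> V" using pV x by (auto simp: V_def span_add span_diff)
      then have "(a w - p w) \<bullet> (p w + x - p w) \<le> 0" "(a w - p w) \<bullet> (p w - x - p w) \<le> 0"
        unfolding pw by (intro closest_point_dot V; simp)+
      then show ?thesis by (simp add: inner_simps)
    qed
    have "u w \<bullet> x = 0" if "x \<in> V" for x
      using orth[OF that] by (simp add: u_def sgn_div_norm)
    then have "\<forall>x\<in>L.supp. u w \<bullet> x = 0" by (auto simp: V_def span_base)
    moreover have "u w \<bullet> a w = norm (a w - p w)"
    proof -
      have "(a w - p w) \<bullet> a w = (a w - p w) \<bullet> (a w - p w)"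
        using orth[OF pV] by (simp add: inner_diff_right)
      also have "\<dots> = norm (a w - p w) * norm (a w - p w)"
        by (simp add: power2_norm_eq_inner[symmetric] power2_eq_square)
      finally show ?thesis by (cases "a w = p w") (simp_all add: u_def sgn_div_norm)
    qed
    ultimately show ?thesis using pV by (simp add: V_def L.AE_inner_eq_iff)
  qed
  have "AE w in M. AE x in K w. u w \<bullet> x = 0"
    using AE_good by eventually_elim (use props in blast)
  then have uX: "AE w in M. u w \<bullet> X w = 0"
    using disintegration_AE[of "\<lambda>z. u (fst z) \<bullet> snd z = 0"] by simp
  have nu: "norm (u w) \<le> 1" for w by (simp add: u_def norm_sgn)
  note ci = cond_exp_inner[OF \<beta> \<open>u \<in> borel_measurable G\<close> nu]
  have "(\<integral>w. u w \<bullet> a w \<partial>M) = (\<integral>w. \<beta> w * (u w \<bullet> X w) \<partial>M)"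
    unfolding a_def by (rule ci(3))
  also have "\<dots> = 0" by (rule integral_eq_zero_AE) (use uX in \<open>auto elim!: eventually_mono\<close>)
  finally have z: "(\<integral>w. u w \<bullet> a w \<partial>M) = 0" .
  have nonneg: "AE w in M. 0 \<le> u w \<bullet> a w"
    using AE_good by eventually_elim (use props in force)
  have "AE w in M. u w \<bullet> a w = 0"
    using z integral_nonneg_eq_0_iff_AE[OF ci(2)[folded a_def] nonneg] by simp
  then have "AE w in M. a w \<in> span (closed_support (K w))"
    using AE_good
  proof eventually_elim
    case (elim w)
    then have "norm (a w - p w) = 0" "p w \<in> span (closed_support (K w))" using props by auto
    then show ?case by simp
  qed
  then show ?thesis by (simp add: a_def)
qed

end
section \<open>Strategies that attain the Minkowski functional\<close>

lemma minkowski_nonneg: "0 \<le> minkowski x A"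
  unfolding minkowski_def by (rule Inf_greatest) auto

context na_law
begin

text \<open>By duality the Minkowski functional of \<open>-a\<close> is the supremum of \<open>h \<bullet> a\<close> over the admissible
  positions \<open>h\<close>; the best admissible one among the first \<open>J\<close> members of the dense sequence is a
  measurable choice.\<close>
lemma approximating_strategies:
  assumes a [measurable]: "a \<in> borel_measurable G"
    and span_a: "AE w in M. a w \<in> span (closed_support (K w))"
  obtains \<gamma> :: "nat \<Rightarrow> 'a \<Rightarrow> real ^ 'd" where
    "\<And>J. \<gamma> J \<in> borel_measurable G"
    "\<And>J. \<exists>B. \<forall>w\<in>space M. norm (\<gamma> J w) \<le> B"
    "\<And>J. AE w in M. \<gamma> J w \<in> span (closed_support (K w))"
    "\<And>J. AE w in M. - 1 \<le> \<gamma> J w \<bullet> X w"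
    "\<And>J w. 0 \<le> \<gamma> J w \<bullet> a w"
    "\<And>w. incseq (\<lambda>J. \<gamma> J w \<bullet> a w)"
    "AE w in M. minkowski (- a w) (convex hull (closed_support (K w))) = (SUP J. ereal (\<gamma> J w \<bullet> a w))"
proof -
  define ok where "ok J w \<longleftrightarrow> (AE x in K w. mean_seq J w \<bullet> x \<le> 1)" for J w
  have [measurable]: "Measurable.pred G (ok J)" for J
    unfolding ok_def
    using kernel_AE_pred[of "\<lambda>z. mean_seq J (fst z) \<bullet> snd z \<le> 1"] by simp
  define \<gamma> where "\<gamma> = rec_nat (\<lambda>_. 0) (\<lambda>J u w. if ok J w \<and> u w \<bullet> a w < - mean_seq J w \<bullet> a w
      then - mean_seq J w else u w)"
  have \<gamma>_simps: "\<gamma> 0 = (\<lambda>_. 0)"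
    "\<And>J. \<gamma> (Suc J) = (\<lambda>w. if ok J w \<and> \<gamma> J w \<bullet> a w < - mean_seq J w \<bullet> a w then - mean_seq J w else \<gamma> J w)"
    by (simp_all only: \<gamma>_def nat.rec)
  have meas [measurable]: "\<gamma> J \<in> borel_measurable G" for J
    by (induction J) (simp_all add: \<gamma>_simps)
  have cases: "\<gamma> J w = 0 \<or> (\<exists>j. \<gamma> J w = - mean_seq j w \<and> ok j w)" for J w
    by (induction J) (auto simp: \<gamma>_simps)
  have bdd: "\<exists>B. \<forall>w\<in>space M. norm (\<gamma> J w) \<le> B" for J
  proof (induction J)
    case (Suc J)
    then obtain B where B: "\<forall>w\<in>space M. norm (\<gamma> J w) \<le> B" by blast
    obtain B' where B': "\<forall>w\<in>space M. norm (mean_seq J w) \<le> B'" using mean_seq_bounded by blast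
    have "\<forall>w\<in>space M. norm (\<gamma> (Suc J) w) \<le> max B B'"
      using B B' by (auto simp: \<gamma>_simps le_max_iff_disj)
    then show ?case by blast
  qed (auto simp: \<gamma>_simps)
  have span: "AE w in M. \<gamma> J w \<in> span (closed_support (K w))" for J
    using AE_good
  proof eventually_elim
    case (elim w)
    have "mean_seq j w \<in> span (closed_support (K w))" for j
      unfolding closure_mean_seq[OF conjunct1[OF elim] conjunct2[OF elim], symmetric]
      by (rule subsetD[OF closure_subset]) simp
    then show ?case using cases[of J w]
      by (elim disjE exE conjE) (simp_all add: span_zero span_neg)
  qed
  have "AE x in K w. - 1 \<le> \<gamma> J w \<bullet> x" for J w
    using cases[of J w]
  proof
    assume "\<exists>j. \<gamma> J w = - mean_seq j w \<and> ok j w"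
    then obtain j where "\<gamma> J w = - mean_seq j w" "AE x in K w. mean_seq j w \<bullet> x \<le> 1"
      by (auto simp: ok_def)
    then show ?thesis by (auto elim!: eventually_mono)
  qed simp
  then have adm: "AE w in M. - 1 \<le> \<gamma> J w \<bullet> X w" for J
    using disintegration_AE[of "\<lambda>z. - 1 \<le> \<gamma> J (fst z) \<bullet> snd z"] by simp
  have step: "\<gamma> J w \<bullet> a w \<le> \<gamma> (Suc J) w \<bullet> a w" for J w by (simp add: \<gamma>_simps)
  have inc: "incseq (\<lambda>J. \<gamma> J w \<bullet> a w)" for w by (rule incseq_SucI) (rule step)
  have nonneg: "0 \<le> \<gamma> J w \<bullet> a w" for J w
    using incseqD[OF inc, of 0 J] by (simp add: \<gamma>_simps)
  have "AE w in M. minkowski (- a w) (convex hull (closed_support (K w))) = (SUP J. ereal (\<gamma> J w \<bullet> a w))"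
    using AE_good span_a
  proof eventually_elim
    case (elim w)
    then interpret L: bounded_law "K w" r by simp
    have okj: "ok j w \<longleftrightarrow> (\<forall>x\<in>L.supp. mean_seq j w \<bullet> x \<le> 1)" for j
      unfolding ok_def by (rule L.AE_inner_le_iff)
    have "minkowski (- a w) L.hull_supp
        = (SUP q\<in>{q\<in>range (\<lambda>j. mean_seq j w). \<forall>x\<in>L.supp. q \<bullet> x \<le> 1}. ereal (q \<bullet> (- a w)))"
      using elim mean_seq_dense[of w]
      by (intro L.minkowski_eq_SUP[where E="span L.supp"] L.hull_neighbourhood)
        (auto simp: span_neg span_superset subspace_span)
    also have "\<dots> = (SUP j\<in>{j. ok j w}. ereal (mean_seq j w \<bullet> (- a w)))"
      unfolding okj by (rule arg_cong[where f=Sup]) auto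
    finally have eq: "minkowski (- a w) L.hull_supp = (SUP j\<in>{j. ok j w}. ereal (mean_seq j w \<bullet> (- a w)))" .
    show ?case
    proof (rule antisym)
      show "minkowski (- a w) L.hull_supp \<le> (SUP J. ereal (\<gamma> J w \<bullet> a w))"
        unfolding eq
      proof (rule SUP_least)
        fix j assume "j \<in> {j. ok j w}"
        then have "mean_seq j w \<bullet> (- a w) \<le> \<gamma> (Suc j) w \<bullet> a w" by (auto simp: \<gamma>_simps)
        then show "ereal (mean_seq j w \<bullet> (- a w)) \<le> (SUP J. ereal (\<gamma> J w \<bullet> a w))"
          by (intro SUP_upper2[of "Suc j"]) auto
      qed
      show "(SUP J. ereal (\<gamma> J w \<bullet> a w)) \<le> minkowski (- a w) L.hull_supp"
      proof (rule SUP_least)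
        fix J
        consider "\<gamma> J w = 0" | j where "\<gamma> J w = - mean_seq j w" "ok j w" using cases[of J w] by blast
        then show "ereal (\<gamma> J w \<bullet> a w) \<le> minkowski (- a w) L.hull_supp"
        proof cases
          case 1
          then show ?thesis using minkowski_nonneg by (simp add: zero_ereal_def[symmetric])
        next
          case 2
          then show ?thesis unfolding eq by (intro SUP_upper2[of j]) auto
        qed
      qed
    qed
  qed
  with meas bdd span adm nonneg inc show thesis by (rule that)
qed

end

section \<open>Densities that balance a given vector\<close>

text \<open>The series of densities may diverge on a null set, where \<open>enn2real\<close> turns its value into zero.\<close>
lemma (in bounded_law) series_density:
  fixes Ls :: "nat \<Rightarrow> (rat \<times> nat) list"
  assumes lam: "0 \<le> lam" and mass: "\<And>k. dmass (Ls k) \<le> lam / 2 ^ k"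
    and sums_b: "(\<lambda>k. dmean (Ls k)) sums b"
  defines "H \<equiv> \<lambda>x::'b. enn2real (\<Sum>k. ennreal (step_density (Ls k) x))"
  shows "(\<integral>\<^sup>+x. ennreal (H x) \<partial>\<mu>) \<le> ennreal (2 * lam)"
    and "integrable \<mu> (\<lambda>x. H x *\<^sub>R x)" and "(\<integral>x. H x *\<^sub>R x \<partial>\<mu>) = b"
proof -
  define D where "D x = (\<Sum>k. ennreal (step_density (Ls k) x))" for x :: 'b
  have [measurable]: "D \<in> borel_measurable borel" unfolding D_def by measurable
  have [measurable]: "H \<in> borel_measurable borel" unfolding H_def by measurable
  have geo: "(\<lambda>k. lam / 2 ^ k) sums (2 * lam)"
    using sums_mult[OF geometric_sums[of "1/2::real"], of lam] by (simp add: power_one_over field_simps)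
  have "(\<integral>\<^sup>+x. D x \<partial>\<mu>) = (\<Sum>k. \<integral>\<^sup>+x. ennreal (step_density (Ls k) x) \<partial>\<mu>)"
    unfolding D_def by (rule nn_integral_suminf) measurable
  also have "\<dots> = (\<Sum>k. ennreal (dmass (Ls k)))"
    by (simp add: dmass_def nn_integral_eq_integral)
  also have "\<dots> \<le> (\<Sum>k. ennreal (lam / 2 ^ k))"
    by (intro suminf_le summableI ennreal_leI mass)
  also have "\<dots> = ennreal (2 * lam)"
    using lam by (intro suminf_ennreal_eq geo) simp
  finally have D_le: "(\<integral>\<^sup>+x. D x \<partial>\<mu>) \<le> ennreal (2 * lam)" .
  have "ennreal (H x) \<le> D x" for x
    unfolding H_def D_def[symmetric] by (cases "D x") auto
  then have "(\<integral>\<^sup>+x. ennreal (H x) \<partial>\<mu>) \<le> (\<integral>\<^sup>+x. D x \<partial>\<mu>)" by (rule nn_integral_mono)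
  with D_le show "(\<integral>\<^sup>+x. ennreal (H x) \<partial>\<mu>) \<le> ennreal (2 * lam)" by (rule order_trans[rotated])
  have "(\<integral>\<^sup>+x. D x \<partial>\<mu>) \<noteq> \<infinity>" using D_le by (auto simp: top_unique)
  then have "AE x in \<mu>. D x \<noteq> \<infinity>" by (intro nn_integral_noteq_infinite) auto
  then have AE_sum: "AE x in \<mu>. summable (\<lambda>k. step_density (Ls k) x) \<and> H x = (\<Sum>k. step_density (Ls k) x)"
  proof eventually_elim
    case (elim x)
    have s: "summable (\<lambda>k. step_density (Ls k) x)"
      using elim by (intro summable_suminf_not_top) (auto simp: D_def)
    then show ?case
      unfolding H_def using suminf_nonneg[OF s] by (simp add: suminf_ennreal2)
  qed
  let ?g = "\<lambda>k x. step_density (Ls k) x *\<^sub>R x"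
  have AE_g: "AE x in \<mu>. summable (\<lambda>k. norm (?g k x))"
    using AE_sum by eventually_elim (simp add: summable_mult2)
  have AE_eq: "AE x in \<mu>. (\<Sum>k. ?g k x) = H x *\<^sub>R x"
    using AE_sum
  proof eventually_elim
    case (elim x)
    then have "(\<lambda>k. step_density (Ls k) x) sums H x" by (simp add: summable_sums)
    then have "(\<lambda>k. ?g k x) sums (H x *\<^sub>R x)" by (rule sums_scaleR_left)
    then show ?case by (rule sums_unique[symmetric])
  qed
  have norm_g: "(\<integral>x. norm (?g k x) \<partial>\<mu>) \<le> r * (lam / 2 ^ k)" for k
  proof -
    have "(\<integral>x. norm (?g k x) \<partial>\<mu>) \<le> (\<integral>x. r * step_density (Ls k) x \<partial>\<mu>)"
    proof (rule integral_mono_AE)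
      show "AE x in \<mu>. norm (?g k x) \<le> r * step_density (Ls k) x"
        using AE_bounded by eventually_elim (simp add: mult.commute mult_right_mono)
    qed (rule integrable_norm, simp, rule integrable_mult_right, simp)
    also have "\<dots> = r * dmass (Ls k)" by (simp add: dmass_def)
    also have "\<dots> \<le> r * (lam / 2 ^ k)" by (intro mult_left_mono mass r_nonneg)
    finally show ?thesis .
  qed
  have sum_norm: "summable (\<lambda>k. \<integral>x. norm (?g k x) \<partial>\<mu>)"
    by (rule summable_comparison_test'[OF summable_mult[OF sums_summable[OF geo], of r], of 0])
      (use norm_g in simp)
  have int: "integrable \<mu> (?g k)" for k by simp
  note res = integrable_suminf[OF int AE_g sum_norm] sums_integral[OF int AE_g sum_norm]
  have [measurable]: "(\<lambda>x. \<Sum>k. ?g k x) \<in> borel_measurable \<mu>"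
    using res(1) by (rule borel_measurable_integrable)
  have m2 [measurable]: "(\<lambda>x. H x *\<^sub>R x) \<in> borel_measurable \<mu>" by measurable
  show "integrable \<mu> (\<lambda>x. H x *\<^sub>R x)"
    by (rule integrable_cong_AE_imp[OF res(1) m2]) (use AE_eq in \<open>auto elim!: eventually_mono\<close>)
  have "(\<integral>x. H x *\<^sub>R x \<partial>\<mu>) = (\<integral>x. (\<Sum>k. ?g k x) \<partial>\<mu>)"
    by (rule integral_cong_AE) (use AE_eq in \<open>auto elim!: eventually_mono\<close>)
  also have "\<dots> = b" using res(2) sums_b unfolding dmean_def by (rule sums_unique2)
  finally show "(\<integral>x. H x *\<^sub>R x \<partial>\<mu>) = b" .
qed

context na_law
begin

text \<open>The greedy selection: at every stage the remaining vector lies in half of the previous dilation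
  of the hull, so the selected means exhaust the vector while the masses form a geometric series.\<close>
lemma balancing_density:
  assumes [measurable]: "b \<in> borel_measurable G" "l \<in> borel_measurable G"
    and l: "AE w in M. 0 < l w"
    and mink: "AE w in M. minkowski (b w) (convex hull (closed_support (K w))) \<le> ereal (l w)"
  obtains H :: "'a \<times> (real ^ 'd) \<Rightarrow> real" where
    "H \<in> borel_measurable (G \<Otimes>\<^sub>M borel)" "\<And>z. 0 \<le> H z"
    "AE w in M. (\<integral>\<^sup>+x. ennreal (H (w, x)) \<partial>K w) \<le> ennreal (2 * l w)"
    "AE w in M. integrable (K w) (\<lambda>x. H (w, x) *\<^sub>R x) \<and> (\<integral>x. H (w, x) *\<^sub>R x \<partial>K w) = b w"
proof -
  obtain T :: "(real ^ 'd) set" where T: "countable T" "\<And>U. open U \<Longrightarrow> U \<noteq> {} \<Longrightarrow> \<exists>d\<in>T. d \<in> U"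
    using countable_dense_setE by blast
  define ok where "ok v t w \<longleftrightarrow> (\<forall>q\<in>T. (AE x in K w. q \<bullet> x \<le> 1) \<longrightarrow> q \<bullet> v \<le> t)" for v t w
  have ok_measurable: "Measurable.pred G (\<lambda>w. ok (v w) (t w) w)"
    if [measurable]: "v \<in> borel_measurable G" "t \<in> borel_measurable G" for v t
  proof -
    have 1: "Measurable.pred G (\<lambda>w. AE x in K w. q \<bullet> x \<le> 1)" for q
      using kernel_AE_pred[of "\<lambda>z. q \<bullet> snd z \<le> 1"] by simp
    have 2: "Measurable.pred G (\<lambda>w. q \<bullet> v w \<le> t w)" for q
      unfolding pred_def
      by (rule borel_measurable_le) (intro borel_measurable_inner borel_measurable_const that)+
    show ?thesis
      unfolding ok_def by (rule measurable_pred_countable(1)[OF T(1)]) (intro pred_intros_logic 1 2)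
  qed
  \<comment> \<open>Where no index qualifies, the least-number operator returns a fixed unspecified index, so the
    selection is measurable without exceptional sets.\<close>
  define sel where "sel k v w = (LEAST j. mass_seq j w \<le> l w / 2 ^ k
      \<and> ok (v - mean_seq j w) (l w / 2 ^ Suc k) w)" for k v w
  define R where "R = rec_nat b (\<lambda>k u w. u w - mean_seq (sel k (u w) w) w)"
  have R_simps: "R 0 = b" "\<And>k. R (Suc k) = (\<lambda>w. R k w - mean_seq (sel k (R k w) w) w)"
    by (simp_all only: R_def nat.rec)
  have sel_measurable: "(\<lambda>w. sel k (v w) w) \<in> G \<rightarrow>\<^sub>M count_space UNIV"
    if [measurable]: "v \<in> borel_measurable G" for k v
    unfolding sel_def
  proof (intro measurable_Least pred_intros_logic ok_measurable)
    show "Measurable.pred G (\<lambda>w. mass_seq i w \<le> l w / 2 ^ k)" for i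
      unfolding pred_def
      by (rule borel_measurable_le) (intro mass_seq_measurable borel_measurable_divide
          borel_measurable_const assms(2))+
    show "(\<lambda>w. l w / 2 ^ Suc k) \<in> borel_measurable G"
      by (intro borel_measurable_divide borel_measurable_const assms(2))
  qed (intro borel_measurable_diff that mean_seq_measurable)
  have R_measurable [measurable]: "R k \<in> borel_measurable G" for k
  proof (induction k)
    case (Suc k)
    have "(\<lambda>w. mean_seq (sel k (R k w) w) w) \<in> borel_measurable G"
      by (rule measurable_compose_countable[OF _ sel_measurable[OF Suc]]) (rule mean_seq_measurable)
    then show ?case unfolding R_simps by (intro borel_measurable_diff Suc)
  qed (simp add: R_simps)
  define J where "J k w = sel k (R k w) w" for k w
  have J_measurable: "J k \<in> G \<rightarrow>\<^sub>M count_space UNIV" for k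
    unfolding J_def by (rule sel_measurable[OF R_measurable])
  define H where "H z = enn2real (\<Sum>k. ennreal (step_density (from_nat (J k (fst z))) (snd z)))"
    for z :: "'a \<times> (real ^ 'd)"
  have Hm: "H \<in> borel_measurable (G \<Otimes>\<^sub>M borel)"
  proof -
    have "(\<lambda>z. step_density (from_nat (J k (fst z))) (snd z :: real ^ 'd)) \<in> borel_measurable (G \<Otimes>\<^sub>M borel)" for k
      by (rule measurable_compose_countable[of "\<lambda>j z. step_density (from_nat j) (snd z)"])
        (intro measurable_compose[OF measurable_snd step_density_measurable]
          measurable_compose[OF measurable_fst J_measurable])+
    then show ?thesis unfolding H_def
      by (intro borel_measurable_enn2real borel_measurable_suminf_order
          measurable_compose[OF _ measurable_ennreal])
  qed
  have main: "AE w in M. (\<integral>\<^sup>+x. ennreal (H (w, x)) \<partial>K w) \<le> ennreal (2 * l w)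
      \<and> integrable (K w) (\<lambda>x. H (w, x) *\<^sub>R x) \<and> (\<integral>x. H (w, x) *\<^sub>R x \<partial>K w) = b w"
    using AE_good l mink
  proof eventually_elim
    case (elim w)
    then interpret L: bounded_law "K w" r by simp
    have af: "arbitrage_free (K w)" using elim by simp
    have zero: "0 \<in> L.hull_supp" by (rule L.hull_neighbourhood(1)[OF af])
    have dense: "\<exists>q\<in>T. norm (q - y) < e" if "0 < e" for y e
      using T(2)[of "ball y e"] that by (force simp: dist_norm norm_minus_commute)
    have ok_iff: "ok v t w \<longleftrightarrow> v \<in> (\<lambda>y. t *\<^sub>R y) ` L.hull_supp" if "0 \<le> t" for v t
      using L.dilation_iff_dense[OF zero that, of UNIV v T] dense
      by (simp add: ok_def L.AE_inner_le_iff)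
    have inv: "R k w \<in> (\<lambda>y. (l w / 2 ^ k) *\<^sub>R y) ` L.hull_supp \<and>
        mass_seq (J k w) w \<le> l w / 2 ^ k" for k
    proof -
      have sel: "mass_seq (J k w) w \<le> l w / 2 ^ k \<and> ok (R k w - mean_seq (J k w) w) (l w / 2 ^ Suc k) w"
        if Rk: "R k w \<in> (\<lambda>y. (l w / 2 ^ k) *\<^sub>R y) ` L.hull_supp" for k
      proof -
        obtain Lk where "L.dmass Lk \<le> l w / 2 ^ k"
          "R k w - L.dmean Lk \<in> (\<lambda>y. (l w / 2 ^ k / 2) *\<^sub>R y) ` L.hull_supp"
          using L.halving_step[OF af _ Rk] elim(2) by auto
        then have "mass_seq (to_nat Lk) w \<le> l w / 2 ^ k \<and>
            ok (R k w - mean_seq (to_nat Lk) w) (l w / 2 ^ Suc k) w"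
          using elim(1,2) by (subst ok_iff) (auto simp: mass_seq_eq mean_seq_eq mult.commute)
        then show ?thesis unfolding J_def sel_def by (rule LeastI)
      qed
      have "R k w \<in> (\<lambda>y. (l w / 2 ^ k) *\<^sub>R y) ` L.hull_supp"
      proof (induction k)
        case 0
        have "b w \<in> (\<lambda>y. l w *\<^sub>R y) ` L.hull_supp"
        proof (rule L.dilation_of_inner_le[OF zero])
          fix q assume "\<forall>x\<in>L.supp. q \<bullet> x \<le> 1"
          moreover have "minkowski (b w) L.hull_supp
              = (SUP q\<in>{q\<in>UNIV. \<forall>x\<in>L.supp. q \<bullet> x \<le> 1}. ereal (q \<bullet> b w))"
          proof (rule L.minkowski_eq_SUP[OF zero subspace_UNIV])
            show "\<exists>q\<in>UNIV. norm (q - y) < e" if "0 < e" for y :: "real ^ 'd" and e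
              using that by (intro bexI[of _ y]) auto
          qed auto
          ultimately have "ereal (q \<bullet> b w) \<le> minkowski (b w) L.hull_supp"
            by (auto intro!: SUP_upper2[of q])
          then show "q \<bullet> b w \<le> l w" using elim(3) by (metis ereal_less_eq(3) order_trans)
        qed (use elim(2) in simp)
        then show ?case by (simp add: R_simps)
      next
        case (Suc k)
        show ?case
          using sel[OF Suc] elim(2) unfolding R_simps J_def[symmetric] by (subst ok_iff[symmetric]) auto
      qed
      then show ?thesis using sel by blast
    qed
    have R_sum: "(\<Sum>k<n. mean_seq (J k w) w) = b w - R n w" for n
      by (induction n) (auto simp: R_simps J_def)
    have "(\<lambda>n. l w * r * (1 / 2) ^ n) \<longlonglongrightarrow> 0"
      by (intro tendsto_mult_right_zero LIMSEQ_realpow_zero) auto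
    then have "(\<lambda>n. l w * r / 2 ^ n) \<longlonglongrightarrow> 0" by (simp add: power_divide)
    then have "(\<lambda>n. R n w) \<longlonglongrightarrow> 0"
    proof (rule Lim_null_comparison[rotated], intro always_eventually allI)
      fix n
      obtain c where c: "c \<in> L.hull_supp" "R n w = (l w / 2 ^ n) *\<^sub>R c" using inv[of n] by blast
      have "L.hull_supp \<subseteq> cball 0 r" using L.supp_bounded by (intro hull_minimal) auto
      then show "norm (R n w) \<le> l w * r / 2 ^ n"
        using c elim(2) by (auto simp: field_simps intro!: mult_left_mono)
    qed
    then have "(\<lambda>n. b w - R n w) \<longlonglongrightarrow> b w - 0" by (intro tendsto_diff tendsto_const)
    then have sb: "(\<lambda>k. L.dmean (from_nat (J k w))) sums b w"
      unfolding sums_def using elim(1) by (simp add: R_sum mean_seq_eq[symmetric])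
    have ms: "L.dmass (from_nat (J k w)) \<le> l w / 2 ^ k" for k
      using inv[of k] elim(1) by (simp add: mass_seq_eq)
    have "H (w, x) = enn2real (\<Sum>k. ennreal (step_density (from_nat (J k w)) x))" for x
      by (simp add: H_def)
    then show ?case
      by (simp only:) (intro conjI L.series_density[OF less_imp_le[OF elim(2)] ms sb])
  qed
  show thesis
  proof (rule that[OF Hm])
    show "0 \<le> H z" for z by (simp add: H_def)
  qed (rule eventually_mono[OF main], blast)+
qed

end
section \<open>The one-step change of measure\<close>

context cond_law
begin

text \<open>For non-negative \<open>g\<close> the tower property holds for \<open>\<bar>f\<bar> g\<close> in the extended sense, which transfers
  integrability from \<open>f e\<close> to \<open>f g\<close>.\<close>
lemma integrable_mult_of_cond_exp:
  assumes g: "integrable M g" "\<And>w. 0 \<le> g w"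
    and f: "f \<in> borel_measurable G" and e: "e \<in> borel_measurable G"
    and ce: "AE w in M. real_cond_exp M G g w = e w"
    and int: "integrable M (\<lambda>w. f w * e w)"
  shows "integrable M (\<lambda>w. f w * g w)"
proof -
  have gm: "g \<in> borel_measurable M" using g(1) by simp
  have fm: "f \<in> borel_measurable M" by (rule G_measurable[OF f])
  let ?c = "real_cond_exp M G g"
  have cm: "?c \<in> borel_measurable M" by (rule G_measurable) simp
  have c0: "AE w in M. 0 \<le> ?c w" by (rule real_cond_exp_pos) (use g gm in auto)
  have ci: "integrable M ?c" by (rule real_cond_exp_int(1)[OF g(1)])
  have nn: "AE w in M. ennreal (?c w) = nn_cond_exp M G (\<lambda>w. ennreal (g w)) w"
  proof (rule nn_cond_exp_charact)
    fix A assume A: "A \<in> sets G"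
    have AM: "A \<in> sets M" by (rule sets_G[OF A])
    have "(\<integral>\<^sup>+w\<in>A. ennreal (g w) \<partial>M) = (\<integral>\<^sup>+w. ennreal (indicat_real A w * g w) \<partial>M)"
      by (intro nn_integral_cong) (auto simp: indicator_def)
    also have "\<dots> = ennreal (\<integral>w. indicat_real A w * g w \<partial>M)"
      using integrable_mult_indicator[OF AM g(1)] g(2) by (intro nn_integral_eq_integral) auto
    also have "(\<integral>w. indicat_real A w * g w \<partial>M) = (\<integral>w. indicat_real A w * ?c w \<partial>M)"
      using real_cond_exp_intA[OF g(1) A] by (simp add: set_lebesgue_integral_def)
    also have "ennreal \<dots> = (\<integral>\<^sup>+w. ennreal (indicat_real A w * ?c w) \<partial>M)"
      using integrable_mult_indicator[OF AM ci] c0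
      by (intro nn_integral_eq_integral[symmetric]) (auto elim!: eventually_mono)
    also have "\<dots> = (\<integral>\<^sup>+w\<in>A. ennreal (?c w) \<partial>M)"
      by (intro nn_integral_cong) (auto simp: indicator_def)
    finally show "(\<integral>\<^sup>+w\<in>A. ennreal (g w) \<partial>M) = (\<integral>\<^sup>+w\<in>A. ennreal (?c w) \<partial>M)" .
  qed (use gm in auto)
  have "(\<integral>\<^sup>+w. ennreal \<bar>f w * g w\<bar> \<partial>M) = (\<integral>\<^sup>+w. ennreal \<bar>f w\<bar> * ennreal (g w) \<partial>M)"
    using g(2) by (intro nn_integral_cong) (simp add: abs_mult ennreal_mult)
  also have "\<dots> = (\<integral>\<^sup>+w. ennreal \<bar>f w\<bar> * nn_cond_exp M G (\<lambda>w. ennreal (g w)) w \<partial>M)"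
    by (rule nn_cond_exp_intg[symmetric]) (use f gm in auto)
  also have "\<dots> = (\<integral>\<^sup>+w. ennreal \<bar>f w * e w\<bar> \<partial>M)"
  proof (rule nn_integral_cong_AE)
    show "AE w in M. ennreal \<bar>f w\<bar> * nn_cond_exp M G (\<lambda>w. ennreal (g w)) w = ennreal \<bar>f w * e w\<bar>"
      using nn c0 ce
    proof eventually_elim
      case (elim w)
      have "ennreal \<bar>f w\<bar> * ennreal (?c w) = ennreal \<bar>f w * ?c w\<bar>"
        using elim(2) by (simp add: abs_mult ennreal_mult)
      then show ?case unfolding elim(1)[symmetric] elim(3) .
    qed
  qed
  also have "\<dots> < \<infinity>" using int by (simp add: integrable_iff_bounded)
  finally show ?thesis
    using fm gm by (simp add: integrable_iff_bounded)
qed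

lemma cond_exp_disintegration:
  assumes h: "h \<in> borel_measurable (G \<Otimes>\<^sub>M borel)"
    and int: "integrable M (\<lambda>w. h (w, X w) :: real)"
    and v: "v \<in> borel_measurable G" "AE w in M. (\<integral>x. h (w, x) \<partial>K w) = v w"
  shows "AE w in M. real_cond_exp M G (\<lambda>w. h (w, X w)) w = v w"
proof (rule real_cond_exp_charact)
  show "integrable M v"
    by (rule disintegration_integral(1)[OF h int G_measurable[OF v(1)] v(2)])
  fix A assume A: "A \<in> sets G"
  have AM: "A \<in> sets M" by (rule sets_G[OF A])
  define hA where "hA z = indicat_real A (fst z) * h z" for z
  have "hA \<in> borel_measurable (G \<Otimes>\<^sub>M borel)"
    unfolding hA_def
    by (intro borel_measurable_times h measurable_compose[OF measurable_fst] borel_measurable_indicator A)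
  moreover have "integrable M (\<lambda>w. hA (w, X w))"
    using integrable_mult_indicator[OF AM int] by (simp add: hA_def)
  moreover have "(\<lambda>w. indicat_real A w * v w) \<in> borel_measurable M"
    by (intro borel_measurable_times borel_measurable_indicator AM G_measurable[OF v(1)])
  moreover have "AE w in M. (\<integral>x. hA (w, x) \<partial>K w) = indicat_real A w * v w"
    using v(2) by eventually_elim (simp add: hA_def)
  ultimately have "(\<integral>w. indicat_real A w * v w \<partial>M) = (\<integral>w. hA (w, X w) \<partial>M)"
    by (rule disintegration_integral(2))
  then show "(\<integral>w\<in>A. h (w, X w) \<partial>M) = (\<integral>w\<in>A. v w \<partial>M)"
    by (simp add: set_lebesgue_integral_def hA_def)
qed (use int v in auto)

lemma component_bounded: "AE w in M. \<bar>X w $ i\<bar> \<le> r"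
  using X_bounded by eventually_elim (use component_le_norm_cart order_trans in blast)

lemma integrable_times_X:
  assumes "integrable M g"
  shows "integrable M (\<lambda>w. g w * X w $ i)"
proof (rule Bochner_Integration.integrable_bound)
  show "integrable M (\<lambda>w. r * g w)" using assms by simp
  show "(\<lambda>w. g w * X w $ i) \<in> borel_measurable M"
    using assms by (intro borel_measurable_times borel_measurable_vec_nth X_measurable) simp
  show "AE w in M. norm (g w * X w $ i) \<le> norm (r * g w)"
    using component_bounded[of i]
  proof eventually_elim
    case (elim w)
    then have "\<bar>X w $ i\<bar> \<le> \<bar>r\<bar>" by linarith
    then have "\<bar>g w\<bar> * \<bar>X w $ i\<bar> \<le> \<bar>g w\<bar> * \<bar>r\<bar>" by (intro mult_left_mono) auto
    then show ?case by (simp add: abs_mult mult.commute)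
  qed
qed

end

context na_law
begin

text \<open>Adding the balancing density to \<open>\<beta>\<close> makes the weighted increment conditionally centred, at the
  cost of at most twice \<open>l\<close> of conditional mass; normalising by the conditional mass gives \<open>\<xi>\<close>.\<close>
lemma one_step_density:
  fixes \<beta> l :: "'a \<Rightarrow> real"
  assumes G': "subalgebra G' G" "subalgebra M G'"
    and X': "X \<in> borel_measurable G'"
    and \<beta>: "\<beta> \<in> borel_measurable G'" "integrable M \<beta>" "AE w in M. 0 < \<beta> w"
    and l: "l \<in> borel_measurable G" "integrable M l"
    and rec: "AE w in M. ereal (l w) = ereal (real_cond_exp M G \<beta> w)
      + minkowski (- vec_cond_exp M G (\<lambda>w. \<beta> w *\<^sub>R X w) w) (convex hull (closed_support (K w)))"
  obtains \<xi> where "\<xi> \<in> borel_measurable G'" "\<And>w. 0 \<le> \<xi> w"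
    "AE w in M. 0 < l w \<and> \<beta> w \<le> 3 * l w * \<xi> w"
    "\<And>Z. Z \<in> borel_measurable G \<Longrightarrow> integrable M Z \<Longrightarrow>
       integrable M (\<lambda>w. Z w * \<xi> w) \<and> (\<integral>w. Z w * \<xi> w \<partial>M) = (\<integral>w. Z w \<partial>M)
       \<and> (\<forall>i. (\<integral>w. Z w * \<xi> w * X w $ i \<partial>M) = 0)"
proof -
  define c where "c = real_cond_exp M G \<beta>"
  define a where "a = vec_cond_exp M G (\<lambda>w. \<beta> w *\<^sub>R X w)"
  have cG: "c \<in> borel_measurable G" by (simp add: c_def)
  have aG: "a \<in> borel_measurable G" by (simp add: a_def)
  have \<beta>M: "\<beta> \<in> borel_measurable M" using \<beta>(2) by simp
  have c_pos: "AE w in M. 0 < c w"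
    unfolding c_def by (rule real_cond_exp_gr_c[OF \<beta>(2,3)])
  have l_bounds: "AE w in M. 0 < l w \<and> c w \<le> l w \<and>
      minkowski (- a w) (convex hull (closed_support (K w))) \<le> ereal (l w)"
    using rec c_pos
  proof eventually_elim
    case (elim w)
    let ?m = "minkowski (- a w) (convex hull (closed_support (K w)))"
    have eq: "ereal (l w) = ereal (c w) + ?m" using elim(1) by (simp only: c_def a_def)
    then obtain t where t: "?m = ereal t" "0 \<le> t"
      using minkowski_nonneg[of "- a w" "convex hull (closed_support (K w))"]
      by (cases ?m) auto
    then show ?case using eq elim(2) by simp
  qed
  obtain H where H: "H \<in> borel_measurable (G \<Otimes>\<^sub>M borel)" "\<And>z. 0 \<le> H z"
    and H_mass: "AE w in M. (\<integral>\<^sup>+x. ennreal (H (w, x)) \<partial>K w) \<le> ennreal (2 * l w)"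
    and H_mean: "AE w in M. integrable (K w) (\<lambda>x. H (w, x) *\<^sub>R x) \<and> (\<integral>x. H (w, x) *\<^sub>R x \<partial>K w) = - a w"
  proof (rule balancing_density[of "\<lambda>w. - a w" l])
    show "(\<lambda>w. - a w) \<in> borel_measurable G" using aG by simp
    show "AE w in M. 0 < l w"
      "AE w in M. minkowski (- a w) (convex hull (closed_support (K w))) \<le> ereal (l w)"
      using l_bounds by (auto elim: eventually_mono)
  qed (use l in auto)
  define hX where "hX w = H (w, X w)" for w
  define mH where "mH w = enn2real (\<integral>\<^sup>+x. ennreal (H (w, x)) \<partial>K w)" for w
  have mH_G: "mH \<in> borel_measurable G"
    unfolding mH_def
    by (intro borel_measurable_enn2real kernel_nn_integral_measurable measurable_compose[OF H(1) measurable_ennreal])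
  have mH_le: "AE w in M. 0 \<le> mH w \<and> mH w \<le> 2 * l w"
    using H_mass l_bounds
  proof eventually_elim
    case (elim w)
    have "mH w \<le> enn2real (ennreal (2 * l w))"
      unfolding mH_def by (rule enn2real_mono[OF elim(1)]) simp
    then show ?case using elim(2) by (simp add: mH_def)
  qed
  have pair': "(\<lambda>w. (w, X w)) \<in> G' \<rightarrow>\<^sub>M G \<Otimes>\<^sub>M borel"
    by (intro measurable_Pair X' measurable_from_subalg[OF G'(1)] measurable_ident_sets refl)
  have hX_G': "hX \<in> borel_measurable G'"
    unfolding hX_def by (rule measurable_compose[OF pair' H(1)])
  have hX_M: "hX \<in> borel_measurable M"
    by (rule measurable_from_subalg[OF G'(2) hX_G'])
  have hX_int: "integrable M hX"
  proof (rule integrableI_nonneg[OF hX_M])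
    have "(\<integral>\<^sup>+w. ennreal (hX w) \<partial>M) = (\<integral>\<^sup>+w. (\<integral>\<^sup>+x. ennreal (H (w, x)) \<partial>K w) \<partial>M)"
      unfolding hX_def by (rule disintegration_nn) (rule measurable_compose[OF H(1) measurable_ennreal])
    also have "\<dots> \<le> (\<integral>\<^sup>+w. ennreal (2 * l w) \<partial>M)" by (rule nn_integral_mono_AE[OF H_mass])
    also have "\<dots> < \<infinity>"
    proof -
      have "(\<integral>\<^sup>+w. ennreal (2 * l w) \<partial>M) \<noteq> \<infinity>"
        using integrable_mult_right[of 2 M l, OF l(2)] unfolding real_integrable_def infinity_ennreal_def
        by blast
      then show ?thesis by (simp add: less_top)
    qed
    finally show "(\<integral>\<^sup>+w. ennreal (hX w) \<partial>M) < \<infinity>" .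
  qed (simp add: hX_def H(2))
  have ce_hX: "AE w in M. real_cond_exp M G hX w = mH w"
    unfolding hX_def[abs_def]
  proof (rule cond_exp_disintegration[OF H(1) _ mH_G])
    show "integrable M (\<lambda>w. H (w, X w))" using hX_int unfolding hX_def[abs_def] .
    show "AE w in M. (\<integral>x. H (w, x) \<partial>K w) = mH w"
      using AE_space
      by eventually_elim
        (simp add: mH_def integral_eq_nn_integral[OF section_measurable[OF H(1)]] H(2))
  qed
  have ce_hX_i: "AE w in M. real_cond_exp M G (\<lambda>w. hX w * X w $ i) w = - a w $ i" for i
  proof -
    have "AE w in M. real_cond_exp M G (\<lambda>w. H (w, X w) * snd (w, X w) $ i) w = - a w $ i"
    proof (rule cond_exp_disintegration[where h="\<lambda>z. H z * snd z $ i"])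
      show "(\<lambda>z. H z * snd z $ i) \<in> borel_measurable (G \<Otimes>\<^sub>M borel)"
        by (intro borel_measurable_times H(1) borel_measurable_vec_nth measurable_snd)
      show "integrable M (\<lambda>w. H (w, X w) * snd (w, X w) $ i)"
        using integrable_times_X[OF hX_int] by (simp add: hX_def)
      show "(\<lambda>w. - a w $ i) \<in> borel_measurable G"
        by (intro borel_measurable_uminus borel_measurable_vec_nth aG)
      show "AE w in M. (\<integral>x. H (w, x) * snd (w, x) $ i \<partial>K w) = - a w $ i"
        using H_mean
      proof eventually_elim
        case (elim w)
        have "(\<integral>x. H (w, x) * snd (w, x) $ i \<partial>K w) = (\<integral>x. (H (w, x) *\<^sub>R x) \<bullet> axis i 1 \<partial>K w)"
          by (simp add: cart_eq_inner_axis)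
        also have "\<dots> = (\<integral>x. H (w, x) *\<^sub>R x \<partial>K w) \<bullet> axis i 1"
          using elim by (intro integral_inner_left) simp
        also have "\<dots> = - a w $ i" using elim by (simp add: cart_eq_inner_axis)
        finally show ?case .
      qed
    qed
    then show ?thesis by (simp add: hX_def)
  qed
  \<comment> \<open>The cut-off here and the absolute value in \<open>\<xi>\<close> change these functions on null sets only; they make
    \<open>\<xi>\<close> non-negative everywhere.\<close>
  define b where "b w = max 0 (\<beta> w) + hX w" for w
  define e where "e w = c w + mH w" for w
  define \<xi> where "\<xi> w = b w / \<bar>e w\<bar>" for w
  have m\<beta>: "AE w in M. max 0 (\<beta> w) = \<beta> w" using \<beta>(3) by eventually_elim simp
  have b_G': "b \<in> borel_measurable G'"
    unfolding b_def by (intro borel_measurable_add borel_measurable_max borel_measurable_const \<beta>(1) hX_G')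
  have b_M: "b \<in> borel_measurable M" by (rule measurable_from_subalg[OF G'(2) b_G'])
  have b_nonneg: "0 \<le> b w" for w by (simp add: b_def hX_def H(2))
  have b_AE: "AE w in M. b w = \<beta> w + hX w" using m\<beta> by eventually_elim (simp add: b_def)
  have sum_int: "integrable M (\<lambda>w. \<beta> w + hX w)" using \<beta>(2) hX_int by simp
  have b_int: "integrable M b"
    by (rule integrable_cong_AE_imp[OF sum_int b_M]) (use b_AE in \<open>auto elim: eventually_mono\<close>)
  have e_G: "e \<in> borel_measurable G" unfolding e_def by (intro borel_measurable_add cG mH_G)
  have ce_b: "AE w in M. real_cond_exp M G b w = e w"
    using real_cond_exp_cong[OF b_AE b_M borel_measurable_integrable[OF sum_int]]
      real_cond_exp_add[OF \<beta>(2) hX_int] ce_hX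
    by eventually_elim (simp add: e_def c_def)
  have ce_b_i: "AE w in M. real_cond_exp M G (\<lambda>w. b w * X w $ i) w = 0" for i
  proof -
    have i1: "integrable M (\<lambda>w. \<beta> w * X w $ i)" and i2: "integrable M (\<lambda>w. hX w * X w $ i)"
      and i3: "integrable M (\<lambda>w. b w * X w $ i)"
      by (intro integrable_times_X \<beta>(2) hX_int b_int)+
    have i4: "integrable M (\<lambda>w. \<beta> w * X w $ i + hX w * X w $ i)" using i1 i2 by simp
    have eq: "AE w in M. b w * X w $ i = \<beta> w * X w $ i + hX w * X w $ i"
      using b_AE by eventually_elim (simp add: algebra_simps)
    have "a w $ i = real_cond_exp M G (\<lambda>w. \<beta> w * X w $ i) w" for w
      by (simp add: a_def vec_cond_exp_def)
    with real_cond_exp_cong[OF eq borel_measurable_integrable[OF i3] borel_measurable_integrable[OF i4]]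
      real_cond_exp_add[OF i1 i2] ce_hX_i[of i]
    show ?thesis by (auto elim!: eventually_elim2)
  qed
  have e_bounds: "AE w in M. 0 < e w \<and> e w \<le> 3 * l w \<and> 0 < l w"
    using c_pos l_bounds mH_le by eventually_elim (auto simp: e_def)
  show thesis
  proof (rule that[of \<xi>])
    show "\<xi> \<in> borel_measurable G'"
      unfolding \<xi>_def
      by (intro borel_measurable_divide borel_measurable_abs b_G' measurable_from_subalg[OF G'(1) e_G])
    show "0 \<le> \<xi> w" for w by (simp add: \<xi>_def b_nonneg)
    show "AE w in M. 0 < l w \<and> \<beta> w \<le> 3 * l w * \<xi> w"
      using e_bounds b_AE \<beta>(3)
    proof eventually_elim
      case (elim w)
      have "\<beta> w \<le> b w" using elim H(2) by (simp add: hX_def)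
      also have "b w = e w * \<xi> w" using elim by (simp add: \<xi>_def)
      also have "\<dots> \<le> 3 * l w * \<xi> w"
        using elim(1) b_nonneg[of w] by (intro mult_right_mono) (simp_all add: \<xi>_def)
      finally show ?case using elim by simp
    qed
    fix Z :: "'a \<Rightarrow> real" assume Z: "Z \<in> borel_measurable G" "integrable M Z"
    define f where "f w = Z w / \<bar>e w\<bar>" for w
    have f_G: "f \<in> borel_measurable G"
      unfolding f_def by (intro borel_measurable_divide borel_measurable_abs Z(1) e_G)
    have fb: "Z w * \<xi> w = f w * b w" for w by (simp add: f_def \<xi>_def)
    have fe: "AE w in M. f w * e w = Z w" using e_bounds by eventually_elim (simp add: f_def)
    have fe_M: "(\<lambda>w. f w * e w) \<in> borel_measurable M"
      by (intro G_measurable borel_measurable_times f_G e_G)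
    have fe_int: "integrable M (\<lambda>w. f w * e w)"
      by (rule integrable_cong_AE_imp[OF Z(2) fe_M]) (use fe in \<open>auto elim: eventually_mono\<close>)
    have int: "integrable M (\<lambda>w. f w * b w)"
      by (rule integrable_mult_of_cond_exp[OF b_int b_nonneg f_G e_G ce_b fe_int])
    have "(\<integral>w. f w * b w \<partial>M) = (\<integral>w. f w * real_cond_exp M G b w \<partial>M)"
      by (rule real_cond_exp_intg(2)[OF int f_G b_M, symmetric])
    also have "\<dots> = (\<integral>w. Z w \<partial>M)"
    proof (rule integral_cong_AE)
      show "(\<lambda>w. f w * real_cond_exp M G b w) \<in> borel_measurable M"
        by (intro G_measurable borel_measurable_times f_G borel_measurable_cond_exp)
      show "AE w in M. f w * real_cond_exp M G b w = Z w"
        using ce_b fe by eventually_elim simp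
    qed (use Z in simp)
    finally have mean: "(\<integral>w. f w * b w \<partial>M) = (\<integral>w. Z w \<partial>M)" .
    have "(\<integral>w. f w * b w * X w $ i \<partial>M) = 0" for i
    proof -
      have i1: "integrable M (\<lambda>w. f w * (b w * X w $ i))"
        using integrable_times_X[OF int, of i] by (simp add: mult.assoc)
      have bX: "(\<lambda>w. b w * X w $ i) \<in> borel_measurable M"
        by (intro borel_measurable_times b_M borel_measurable_vec_nth X_measurable)
      have "(\<integral>w. f w * (b w * X w $ i) \<partial>M) = (\<integral>w. f w * real_cond_exp M G (\<lambda>w. b w * X w $ i) w \<partial>M)"
        by (rule real_cond_exp_intg(2)[OF i1 f_G bX, symmetric])
      also have "\<dots> = 0"
        by (rule integral_eq_zero_AE) (use ce_b_i[of i] in \<open>auto elim!: eventually_mono\<close>)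
      finally show ?thesis by (simp add: mult.assoc)
    qed
    then show "integrable M (\<lambda>w. Z w * \<xi> w) \<and> (\<integral>w. Z w * \<xi> w \<partial>M) = (\<integral>w. Z w \<partial>M)
       \<and> (\<forall>i. (\<integral>w. Z w * \<xi> w * X w $ i \<partial>M) = 0)"
      unfolding fb using int mean by simp
  qed
qed

end
section \<open>The market\<close>

lemma Linf_iff:
  assumes "subalgebra M G"
  shows "\<eta> \<in> Linf M G A \<longleftrightarrow>
    \<eta> \<in> borel_measurable G \<and> (\<exists>B. AE w in M. norm (\<eta> w) \<le> B) \<and> (AE w in M. \<eta> w \<in> A w)"
proof -
  have "Linf_norm M \<eta> < \<infinity> \<longleftrightarrow> (\<exists>B. AE w in M. norm (\<eta> w) \<le> B)" if \<eta>: "\<eta> \<in> borel_measurable G"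
  proof
    have m: "(\<lambda>w. ereal (norm (\<eta> w))) \<in> borel_measurable M"
      by (intro borel_measurable_ereal measurable_compose[OF _ borel_measurable_norm]
          measurable_from_subalg[OF assms \<eta>])
    {
      assume "Linf_norm M \<eta> < \<infinity>"
      then obtain B where B: "Linf_norm M \<eta> \<le> ereal B" by (cases "Linf_norm M \<eta>") auto
      have "AE w in M. ereal (norm (\<eta> w)) \<le> Linf_norm M \<eta>"
        unfolding Linf_norm_def by (rule esssup_AE)
      then have "AE w in M. norm (\<eta> w) \<le> B"
        by eventually_elim (use B order_trans in fastforce)
      then show "\<exists>B. AE w in M. norm (\<eta> w) \<le> B" ..
    }
    {
      assume "\<exists>B. AE w in M. norm (\<eta> w) \<le> B"
      then obtain B where "AE w in M. ereal (norm (\<eta> w)) \<le> ereal B" by auto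
      then have "Linf_norm M \<eta> \<le> ereal B"
        unfolding Linf_norm_def by (rule esssup_I[OF m])
      then show "Linf_norm M \<eta> < \<infinity>" by (rule order.strict_trans1) simp
    }
  qed
  then show ?thesis unfolding Linf_def by auto
qed

locale market = prob_space M for M :: "'a measure" +
  fixes F :: "nat \<Rightarrow> 'a measure" and N :: nat
    and S :: "nat \<Rightarrow> 'a \<Rightarrow> real ^ 'd" and P :: "nat \<Rightarrow> 'a \<Rightarrow> (real ^ 'd) measure"
  assumes filtration: "discrete_filtration M F N"
    and S_Linf: "\<And>n. n \<le> N \<Longrightarrow> S n \<in> Linf M (F n) (\<lambda>_. UNIV)"
    and P_law: "\<And>n. n < N \<Longrightarrow> regular_cond_distr M (F n) (increment S (Suc n)) (P n)"
    and NA: "no_arbitrage M F N S"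
begin

abbreviation "\<Delta> \<equiv> increment S"

text \<open>The Minkowski term of the recurrence.\<close>
abbreviation penalty :: "nat \<Rightarrow> ('a \<Rightarrow> real) \<Rightarrow> 'a \<Rightarrow> ereal" where
  "penalty n \<beta> w \<equiv> minkowski (- vec_cond_exp M (F n) (\<lambda>w. \<beta> w *\<^sub>R \<Delta> (Suc n) w) w)
     (convex hull (closed_support (P n w)))"

lemma subalg: "n \<le> N \<Longrightarrow> subalgebra M (F n)"
  and subalg_mono: "m \<le> n \<Longrightarrow> n \<le> N \<Longrightarrow> subalgebra (F n) (F m)"
  using filtration by (auto simp: discrete_filtration_def)

lemma measurable_mono: "f \<in> borel_measurable (F m) \<Longrightarrow> m \<le> n \<Longrightarrow> n \<le> N \<Longrightarrow> f \<in> borel_measurable (F n)"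
  using measurable_from_subalg[OF subalg_mono] by blast

lemma measurable_M: "f \<in> borel_measurable (F m) \<Longrightarrow> m \<le> N \<Longrightarrow> f \<in> borel_measurable M"
  using measurable_from_subalg[OF subalg] by blast

lemma sets_mono: "m \<le> n \<Longrightarrow> n \<le> N \<Longrightarrow> A \<in> sets (F m) \<Longrightarrow> A \<in> sets (F n)"
  using subalg_mono by (auto simp: subalgebra_def)

lemma S_measurable: "n \<le> N \<Longrightarrow> S n \<in> borel_measurable (F n)"
  using S_Linf by (simp add: Linf_def)

lemma S_bounded: "\<exists>B. \<forall>n\<le>N. AE w in M. norm (S n w) \<le> B"
proof -
  have "\<forall>n. \<exists>B. n \<le> N \<longrightarrow> (AE w in M. norm (S n w) \<le> B)"
    using S_Linf Linf_iff[OF subalg] by blast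
  then obtain B where B: "\<And>n. n \<le> N \<Longrightarrow> AE w in M. norm (S n w) \<le> B n" by metis
  have "AE w in M. norm (S n w) \<le> Max (B ` {..N})" if "n \<le> N" for n
    using B[OF that] by eventually_elim (rule order_trans[OF _ Max_ge], use that in auto)
  then show ?thesis by blast
qed

definition bnd :: real where "bnd = (SOME B. \<forall>n\<le>N. AE w in M. norm (S n w) \<le> B)"

lemma S_le_bnd: "n \<le> N \<Longrightarrow> AE w in M. norm (S n w) \<le> bnd"
  using someI_ex[OF S_bounded] unfolding bnd_def by blast

lemma inc_measurable:
  assumes "1 \<le> n" "n \<le> N"
  shows "\<Delta> n \<in> borel_measurable (F n)"
  unfolding increment_def[abs_def]
  by (intro borel_measurable_diff S_measurable measurable_mono[OF S_measurable]) (use assms in auto)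

lemma inc_bounded:
  assumes "1 \<le> n" "n \<le> N"
  shows "AE w in M. norm (\<Delta> n w) \<le> 2 * bnd"
proof -
  have "n - 1 \<le> N" using assms by simp
  from S_le_bnd[OF assms(2)] S_le_bnd[OF this] show ?thesis
  proof eventually_elim
    case (elim w)
    then show ?case
      using norm_triangle_ineq4[of "S n w" "S (n - 1) w"] unfolding increment_def by linarith
  qed
qed

text \<open>A one-step arbitrage is the gain of a strategy that trades in a single period.\<close>
lemma step_law:
  assumes n: "n < N"
  shows "na_law M (F n) (\<Delta> (Suc n)) (P n) (2 * bnd)"
proof -
  interpret cond_law M "F n" "\<Delta> (Suc n)" "P n" "2 * bnd"
  proof
    show "subalgebra M (F n)" using n by (intro subalg) simp
    show "\<Delta> (Suc n) \<in> borel_measurable M"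
      by (rule measurable_M[OF inc_measurable]) (use n in auto)
    show "AE w in M. norm (\<Delta> (Suc n) w) \<le> 2 * bnd" by (rule inc_bounded) (use n in auto)
    show "regular_cond_distr M (F n) (\<Delta> (Suc n)) (P n)" by (rule P_law[OF n])
  qed
  show ?thesis
  proof
    show "AE w in M. arbitrage_free (P n w)"
    proof (rule AE_arbitrage_free)
      fix h assume h: "h \<in> borel_measurable (F n)" and nn: "AE w in M. 0 \<le> h w \<bullet> \<Delta> (Suc n) w"
      define \<gamma> where "\<gamma> k = (if k = Suc n then h else (\<lambda>_. 0))" for k
      have g: "gain S \<gamma> N w = h w \<bullet> \<Delta> (Suc n) w" for w
      proof -
        have "gain S \<gamma> N w = (\<Sum>k\<in>{1..N}. if k = Suc n then h w \<bullet> \<Delta> (Suc n) w else 0)"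
          unfolding gain_def by (intro sum.cong) (auto simp: \<gamma>_def)
        also have "\<dots> = h w \<bullet> \<Delta> (Suc n) w" using n by simp
        finally show ?thesis .
      qed
      have "predictable F N \<gamma>" using h by (auto simp: predictable_def \<gamma>_def)
      then show "AE w in M. h w \<bullet> \<Delta> (Suc n) w = 0"
        using NA nn unfolding no_arbitrage_def g[symmetric] by blast
    qed
  qed
qed

abbreviation "strategies \<equiv> \<lambda>n. {\<gamma>. \<forall>k\<in>{1..n}. \<gamma> k \<in> Linf M (F (k - 1)) (supp_span P (k - 1))}"

lemma strategiesD:
  assumes "\<gamma> \<in> strategies n" "n \<le> N" "1 \<le> k" "k \<le> n"
  shows "\<gamma> k \<in> borel_measurable (F (k - 1))" "\<exists>B. AE w in M. norm (\<gamma> k w) \<le> B"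
proof -
  have "subalgebra M (F (k - 1))" using assms by (intro subalg) simp
  moreover have "\<gamma> k \<in> Linf M (F (k - 1)) (supp_span P (k - 1))" using assms by auto
  ultimately show "\<gamma> k \<in> borel_measurable (F (k - 1))" "\<exists>B. AE w in M. norm (\<gamma> k w) \<le> B"
    by (simp_all add: Linf_iff)
qed

lemma gain_Suc: "gain S \<gamma> (Suc n) w = gain S \<gamma> n w + \<gamma> (Suc n) w \<bullet> \<Delta> (Suc n) w"
  by (simp add: gain_def)

lemma gain_measurable_bounded:
  assumes "\<gamma> \<in> strategies n" "n \<le> N"
  shows "gain S \<gamma> n \<in> borel_measurable (F n)" "\<exists>B. AE w in M. \<bar>gain S \<gamma> n w\<bar> \<le> B"
proof -
  have "gain S \<gamma> n \<in> borel_measurable (F n) \<and> (\<exists>B. AE w in M. \<bar>gain S \<gamma> n w\<bar> \<le> B)"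
    using assms
  proof (induction n)
    case 0
    then show ?case by (auto simp: gain_def[abs_def] intro: exI[of _ 0])
  next
    case (Suc n)
    then have IH: "gain S \<gamma> n \<in> borel_measurable (F n)" "\<exists>B. AE w in M. \<bar>gain S \<gamma> n w\<bar> \<le> B" by auto
    have \<gamma>: "\<gamma> (Suc n) \<in> borel_measurable (F n)" "\<exists>B. AE w in M. norm (\<gamma> (Suc n) w) \<le> B"
      using strategiesD[OF Suc.prems, of "Suc n"] by auto
    have le: "n \<le> Suc n" by simp
    have "gain S \<gamma> (Suc n) \<in> borel_measurable (F (Suc n))"
      unfolding gain_Suc[abs_def]
      by (intro borel_measurable_add borel_measurable_inner inc_measurable
          measurable_mono[OF IH(1) le Suc.prems(2)] measurable_mono[OF \<gamma>(1) le Suc.prems(2)])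
        (use Suc.prems in auto)
    moreover obtain B B' where "AE w in M. \<bar>gain S \<gamma> n w\<bar> \<le> B" "AE w in M. norm (\<gamma> (Suc n) w) \<le> B'"
      using IH \<gamma> by blast
    then have "AE w in M. \<bar>gain S \<gamma> (Suc n) w\<bar> \<le> B + B' * (2 * bnd)"
      using inc_bounded[OF le_add1[of 1 n, unfolded plus_1_eq_Suc] Suc.prems(2)]
    proof eventually_elim
      case (elim w)
      have "\<bar>\<gamma> (Suc n) w \<bullet> \<Delta> (Suc n) w\<bar> \<le> norm (\<gamma> (Suc n) w) * norm (\<Delta> (Suc n) w)"
        by (rule Cauchy_Schwarz_ineq2)
      also have "\<dots> \<le> B' * (2 * bnd)"
        using elim order_trans[OF norm_ge_zero elim(2)] by (intro mult_mono) auto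
      finally show ?case using elim(1) by (simp add: gain_Suc)
    qed
    ultimately show ?case by blast
  qed
  then show "gain S \<gamma> n \<in> borel_measurable (F n)" "\<exists>B. AE w in M. \<bar>gain S \<gamma> n w\<bar> \<le> B" by auto
qed

lemma integrable_times_gain:
  assumes "\<gamma> \<in> strategies n" "n \<le> N" "integrable M g"
  shows "integrable M (\<lambda>w. g w * gain S \<gamma> n w)"
proof -
  obtain B where B: "AE w in M. \<bar>gain S \<gamma> n w\<bar> \<le> B"
    using gain_measurable_bounded(2)[OF assms(1,2)] by blast
  show ?thesis
  proof (rule Bochner_Integration.integrable_bound)
    show "integrable M (\<lambda>w. B * g w)" using assms(3) by simp
    show "(\<lambda>w. g w * gain S \<gamma> n w) \<in> borel_measurable M"
      by (intro borel_measurable_times borel_measurable_integrable[OF assms(3)]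
          measurable_M[OF gain_measurable_bounded(1)[OF assms(1,2)] assms(2)])
    show "AE w in M. norm (g w * gain S \<gamma> n w) \<le> norm (B * g w)"
      using B
    proof eventually_elim
      case (elim w)
      then have "\<bar>gain S \<gamma> n w\<bar> \<le> \<bar>B\<bar>" by linarith
      then have "\<bar>g w\<bar> * \<bar>gain S \<gamma> n w\<bar> \<le> \<bar>g w\<bar> * \<bar>B\<bar>" by (rule mult_left_mono) simp
      then show ?case by (simp add: abs_mult mult.commute)
    qed
  qed
qed

lemma Linf_norm_negative_part:
  assumes "X \<in> borel_measurable M"
  shows "Linf_norm M (\<lambda>w. max (- X w) 0) \<le> 1 \<longleftrightarrow> (AE w in M. - 1 \<le> (X w :: real))"
proof
  assume *: "Linf_norm M (\<lambda>w. max (- X w) 0) \<le> 1"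
  have "AE w in M. ereal (norm (max (- X w) 0)) \<le> Linf_norm M (\<lambda>w. max (- X w) 0)"
    unfolding Linf_norm_def by (rule esssup_AE)
  then show "AE w in M. - 1 \<le> X w"
  proof eventually_elim
    case (elim w)
    then have "ereal (norm (max (- X w) 0)) \<le> 1" using * by (rule order_trans)
    then show ?case by (simp add: one_ereal_def split: if_splits)
  qed
next
  assume *: "AE w in M. - 1 \<le> X w"
  show "Linf_norm M (\<lambda>w. max (- X w) 0) \<le> 1"
    unfolding Linf_norm_def
  proof (rule esssup_I)
    show "(\<lambda>w. ereal (norm (max (- X w) 0))) \<in> borel_measurable M"
      by (intro borel_measurable_ereal measurable_compose[OF _ borel_measurable_norm] borel_measurable_max borel_measurable_uminus
          borel_measurable_const assms)
    show "AE w in M. ereal (norm (max (- X w) 0)) \<le> 1"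
      using * by eventually_elim (simp add: one_ereal_def)
  qed
qed

section \<open>A dominating martingale measure bounds the gains\<close>

lemma expectation_gain_zero:
  assumes Q: "martingale_measure M F N S Q" and AE_Q: "\<And>R. AE w in M. R w \<Longrightarrow> AE w in Q. R w"
    and \<gamma>: "\<gamma> \<in> strategies n" "n \<le> N"
  shows "integrable Q (gain S \<gamma> n)" "(\<integral>w. gain S \<gamma> n w \<partial>Q) = 0"
proof -
  interpret Q: prob_space Q using Q by (simp add: martingale_measure_def)
  have sets_Q: "sets Q = sets M" using Q by (simp add: martingale_measure_def)
  have subQ: "subalgebra Q (F k)" if "k \<le> N" for k
    using subalg[OF that] sets_Q sets_eq_imp_space_eq[OF sets_Q] by (auto simp: subalgebra_def)
  have S_int: "integrable Q (\<lambda>w. S k w $ i)" if "k \<le> N" for k i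
  proof (rule Q.integrable_const_bound)
    show "AE w in Q. norm (S k w $ i) \<le> bnd"
      using AE_Q[OF S_le_bnd[OF that]]
      by eventually_elim (use component_le_norm_cart order_trans in fastforce)
    show "(\<lambda>w. S k w $ i) \<in> borel_measurable Q"
      by (intro borel_measurable_vec_nth measurable_from_subalg[OF subQ[OF that] S_measurable[OF that]])
  qed
  have tm: "integrable Q (\<lambda>w. \<gamma> k w \<bullet> \<Delta> k w) \<and> (\<integral>w. \<gamma> k w \<bullet> \<Delta> k w \<partial>Q) = 0"
    if k: "1 \<le> k" "k \<le> n" for k
  proof -
    have kN: "k \<le> N" "k - 1 \<le> N" using k \<gamma>(2) by auto
    interpret fQ: finite_measure_subalgebra Q "F (k - 1)"
      by unfold_locales (rule subQ[OF kN(2)])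
    note \<gamma>k = strategiesD[OF \<gamma> k]
    obtain B where B: "AE w in M. norm (\<gamma> k w) \<le> B" using \<gamma>k(2) by blast
    have int: "integrable Q (\<lambda>w. \<gamma> k w $ i * S j w $ i)" if j: "j = k \<or> j = k - 1" for i j
    proof (rule Bochner_Integration.integrable_bound)
      have jN: "j \<le> N" using j kN by auto
      show "integrable Q (\<lambda>w. B * S j w $ i)" using S_int[OF jN] by simp
      show "(\<lambda>w. \<gamma> k w $ i * S j w $ i) \<in> borel_measurable Q"
        by (intro borel_measurable_times borel_measurable_vec_nth
            measurable_from_subalg[OF subQ[OF jN] S_measurable[OF jN]]
            measurable_from_subalg[OF subQ[OF kN(2)] \<gamma>k(1)])
      show "AE w in Q. norm (\<gamma> k w $ i * S j w $ i) \<le> norm (B * S j w $ i)"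
        using AE_Q[OF B]
      proof eventually_elim
        case (elim w)
        then have "\<bar>\<gamma> k w $ i\<bar> \<le> \<bar>B\<bar>" using component_le_norm_cart[of "\<gamma> k w" i] by linarith
        then show ?case by (simp add: abs_mult mult_right_mono)
      qed
    qed
    have ce: "AE w in Q. real_cond_exp Q (F (k - 1)) (\<lambda>w. S k w $ i) w = S (k - 1) w $ i" for i
    proof -
      have "AE w in Q. vec_cond_exp Q (F (k - 1)) (S k) w = S (k - 1) w"
        using Q kN by (auto simp: martingale_measure_def is_martingale_def)
      then show ?thesis by eventually_elim (auto simp: vec_cond_exp_def vec_eq_iff)
    qed
    have eq: "(\<integral>w. \<gamma> k w $ i * S k w $ i \<partial>Q) = (\<integral>w. \<gamma> k w $ i * S (k - 1) w $ i \<partial>Q)" for i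
    proof -
      have Sm: "(\<lambda>w. S k w $ i) \<in> borel_measurable Q"
        by (rule borel_measurable_integrable[OF S_int[OF kN(1)]])
      have \<gamma>m: "(\<lambda>w. \<gamma> k w $ i) \<in> borel_measurable (F (k - 1))"
        by (intro borel_measurable_vec_nth \<gamma>k(1))
      have ik: "integrable Q (\<lambda>w. \<gamma> k w $ i * S k w $ i)" by (rule int) simp
      have "(\<integral>w. \<gamma> k w $ i * S k w $ i \<partial>Q)
          = (\<integral>w. \<gamma> k w $ i * real_cond_exp Q (F (k - 1)) (\<lambda>w. S k w $ i) w \<partial>Q)"
        by (rule fQ.real_cond_exp_intg(2)[OF ik \<gamma>m Sm, symmetric])
      also have "\<dots> = (\<integral>w. \<gamma> k w $ i * S (k - 1) w $ i \<partial>Q)"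
      proof (rule integral_cong_AE)
        show "(\<lambda>w. \<gamma> k w $ i * real_cond_exp Q (F (k - 1)) (\<lambda>w. S k w $ i) w) \<in> borel_measurable Q"
          by (intro measurable_from_subalg[OF subQ[OF kN(2)]] borel_measurable_times \<gamma>m
              borel_measurable_cond_exp)
        show "(\<lambda>w. \<gamma> k w $ i * S (k - 1) w $ i) \<in> borel_measurable Q"
          by (rule borel_measurable_integrable[OF int]) simp
        show "AE w in Q. \<gamma> k w $ i * real_cond_exp Q (F (k - 1)) (\<lambda>w. S k w $ i) w
            = \<gamma> k w $ i * S (k - 1) w $ i"
          using ce[of i] by eventually_elim simp
      qed
      finally show ?thesis .
    qed
    have ex: "\<gamma> k w \<bullet> \<Delta> k w = (\<Sum>i\<in>UNIV. \<gamma> k w $ i * S k w $ i - \<gamma> k w $ i * S (k - 1) w $ i)" for w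
      by (simp add: inner_vec_def increment_def right_diff_distrib)
    have i1: "integrable Q (\<lambda>w. \<gamma> k w $ i * S k w $ i - \<gamma> k w $ i * S (k - 1) w $ i)" for i
      by (intro Bochner_Integration.integrable_diff int) auto
    have i2: "(\<integral>w. \<gamma> k w $ i * S k w $ i - \<gamma> k w $ i * S (k - 1) w $ i \<partial>Q) = 0" for i
      by (subst Bochner_Integration.integral_diff) (auto intro: int simp: eq)
    show ?thesis
      unfolding ex using i1 i2
      by (subst Bochner_Integration.integral_sum) (auto intro!: Bochner_Integration.integrable_sum)
  qed
  show "integrable Q (gain S \<gamma> n)"
    unfolding gain_def[abs_def] using tm by (intro Bochner_Integration.integrable_sum) auto
  show "(\<integral>w. gain S \<gamma> n w \<partial>Q) = 0"
    unfolding gain_def using tm by (subst Bochner_Integration.integral_sum) auto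
qed

text \<open>The positive and the negative part of a gain have the same expectation under the martingale
  measure, and the negative part is at most one.\<close>
lemma gains_bounded_of_martingale_measure:
  assumes Q: "martingale_measure M F N S Q" and eq: "equivalent_measures M Q"
    and c: "0 < c" "AE w in M. ennreal (c * f w) \<le> RN_deriv M Q w"
    and f: "f \<in> L1pp M"
    and \<gamma>: "\<gamma> \<in> strategies N" and X1: "AE w in M. - 1 \<le> gain S \<gamma> N w"
  shows "(\<integral>w. f w * gain S \<gamma> N w \<partial>M) \<le> 1 / c"
proof -
  interpret Q: prob_space Q using Q by (simp add: martingale_measure_def)
  have sets_Q: "sets Q = sets M" using Q by (simp add: martingale_measure_def)
  have null: "null_sets Q = null_sets M" using eq by (simp add: equivalent_measures_def)
  have AE_Q: "AE w in Q. R w" if "AE w in M. R w" for R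
    using that null sets_eq_imp_space_eq[OF sets_Q] by (simp add: eventually_ae_filter)
  have ac: "absolutely_continuous M Q" by (simp add: absolutely_continuous_def null)
  have dens: "density M (RN_deriv M Q) = Q" by (rule density_RN_deriv[OF ac sets_Q])
  define X where "X = gain S \<gamma> N"
  have XQ: "integrable Q X" "(\<integral>w. X w \<partial>Q) = 0"
    unfolding X_def using expectation_gain_zero[OF Q AE_Q \<gamma>] by auto
  have XM: "X \<in> borel_measurable M"
    unfolding X_def by (rule measurable_M[OF gain_measurable_bounded(1)[OF \<gamma>]]) auto
  have f_int: "integrable M f" and f_pos: "AE w in M. 0 < f w" using f by (auto simp: L1pp_def)
  have fX: "integrable M (\<lambda>w. f w * X w)"
    unfolding X_def by (rule integrable_times_gain[OF \<gamma> _ f_int]) simp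
  define Xp where "Xp w = max 0 (X w)" for w
  have XpM: "Xp \<in> borel_measurable M"
    unfolding Xp_def by (intro borel_measurable_max borel_measurable_const XM)
  have XpQ: "integrable Q Xp"
    unfolding Xp_def by (intro integrable_max XQ(1)) simp
  have "(\<integral>w. Xp w \<partial>Q) \<le> 1"
  proof -
    have "(\<integral>w. Xp w - X w \<partial>Q) \<le> (\<integral>w. 1 \<partial>Q)"
    proof (rule integral_mono_AE)
      show "AE w in Q. Xp w - X w \<le> 1"
        using AE_Q[OF X1] by eventually_elim (simp add: Xp_def X_def)
    qed (use XpQ XQ in auto)
    then show ?thesis using XpQ XQ by (simp add: Q.prob_space)
  qed
  have "(\<integral>\<^sup>+w. ennreal (c * (f w * Xp w)) \<partial>M) \<le> (\<integral>\<^sup>+w. RN_deriv M Q w * ennreal (Xp w) \<partial>M)"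
  proof (rule nn_integral_mono_AE)
    show "AE w in M. ennreal (c * (f w * Xp w)) \<le> RN_deriv M Q w * ennreal (Xp w)"
      using c(2) f_pos
    proof eventually_elim
      case (elim w)
      have "ennreal (c * (f w * Xp w)) = ennreal (c * f w) * ennreal (Xp w)"
        using c(1) elim ennreal_mult[of "c * f w" "Xp w"] by (simp add: mult.assoc Xp_def)
      also have "\<dots> \<le> RN_deriv M Q w * ennreal (Xp w)" using elim(1) by (rule mult_right_mono) simp
      finally show ?case .
    qed
  qed
  also have "\<dots> = (\<integral>\<^sup>+w. ennreal (Xp w) \<partial>Q)"
    using XpM by (subst (2) dens[symmetric]) (rule nn_integral_density[symmetric], auto)
  also have "\<dots> = ennreal (\<integral>w. Xp w \<partial>Q)"
    by (rule nn_integral_eq_integral[OF XpQ]) (simp add: Xp_def)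
  also have "\<dots> \<le> ennreal 1" using \<open>(\<integral>w. Xp w \<partial>Q) \<le> 1\<close> by (rule ennreal_leI)
  finally have le1: "(\<integral>\<^sup>+w. ennreal (c * (f w * Xp w)) \<partial>M) \<le> ennreal 1" .
  have "(\<integral>\<^sup>+w. ennreal (c * (f w * X w)) \<partial>M) \<le> (\<integral>\<^sup>+w. ennreal (c * (f w * Xp w)) \<partial>M)"
  proof (rule nn_integral_mono_AE)
    show "AE w in M. ennreal (c * (f w * X w)) \<le> ennreal (c * (f w * Xp w))"
      using f_pos by eventually_elim (use c(1) in \<open>auto simp: Xp_def intro!: ennreal_leI mult_left_mono\<close>)
  qed
  then have le2: "(\<integral>\<^sup>+w. ennreal (c * (f w * X w)) \<partial>M) \<le> ennreal 1" using le1 by (rule order_trans)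
  have cfX: "integrable M (\<lambda>w. c * (f w * X w))" using fX by simp
  have "(\<integral>w. c * (f w * X w) \<partial>M) \<le> enn2real (\<integral>\<^sup>+w. ennreal (c * (f w * X w)) \<partial>M)"
    unfolding real_lebesgue_integral_def[OF cfX] by (simp add: enn2real_nonneg)
  also have "\<dots> \<le> enn2real (ennreal 1)" by (rule enn2real_mono[OF le2]) simp
  finally have "c * (\<integral>w. f w * X w \<partial>M) \<le> 1" by simp
  then show ?thesis using c(1) by (simp add: X_def field_simps)
qed

end
section \<open>Bounded gains give an integrable recurrence\<close>

context market
begin

text \<open>One backward step: a gain \<open>X\<close> up to time \<open>n\<close> is continued by the position \<open>(1 + X) \<gamma>\<close> with \<open>\<gamma>\<close> almost
  optimal for the Minkowski functional, which multiplies \<open>1 + X\<close> by \<open>1 + (\<gamma>, \<Delta>)\<close>.\<close>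
lemma backward_step:
  fixes \<beta> :: "'a \<Rightarrow> real"
  assumes n: "n < N"
    and \<beta>: "integrable M \<beta>" "AE w in M. 0 < \<beta> w"
    and W: "0 \<le> W" "\<And>\<gamma>. \<gamma> \<in> strategies (Suc n) \<Longrightarrow> AE w in M. - 1 \<le> gain S \<gamma> (Suc n) w \<Longrightarrow>
        (\<integral>\<^sup>+w. ennreal (\<beta> w * (1 + gain S \<gamma> (Suc n) w)) \<partial>M) \<le> ennreal W"
  obtains l where "l \<in> borel_measurable (F n)" "integrable M l" "AE w in M. 0 < l w"
    "AE w in M. ereal (l w) = ereal (real_cond_exp M (F n) \<beta> w)
      + penalty n \<beta> w"
    "\<And>\<gamma>. \<gamma> \<in> strategies n \<Longrightarrow> AE w in M. - 1 \<le> gain S \<gamma> n w \<Longrightarrow>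
        (\<integral>\<^sup>+w. ennreal (l w * (1 + gain S \<gamma> n w)) \<partial>M) \<le> ennreal W"
proof -
  have nN: "n \<le> N" using n by simp
  interpret L: na_law M "F n" "\<Delta> (Suc n)" "P n" "2 * bnd" by (rule step_law[OF n])
  define c where "c = real_cond_exp M (F n) \<beta>"
  define a where "a = vec_cond_exp M (F n) (\<lambda>w. \<beta> w *\<^sub>R \<Delta> (Suc n) w)"
  have cF: "c \<in> borel_measurable (F n)" by (simp add: c_def)
  have aF: "a \<in> borel_measurable (F n)" by (simp add: a_def)
  have \<beta>M: "\<beta> \<in> borel_measurable M" using \<beta>(1) by simp
  have c_pos: "AE w in M. 0 < c w"
    unfolding c_def by (rule L.real_cond_exp_gr_c[OF \<beta>])
  have span_a: "AE w in M. a w \<in> span (closed_support (P n w))"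
    unfolding a_def by (rule L.cond_mean_in_span[OF \<beta>(1)])
  obtain g :: "nat \<Rightarrow> 'a \<Rightarrow> real ^ 'd" where gF: "\<And>J. g J \<in> borel_measurable (F n)"
    and gB: "\<And>J. \<exists>B. \<forall>w\<in>space M. norm (g J w) \<le> B"
    and gD: "\<And>J. AE w in M. g J w \<in> span (closed_support (P n w))"
    and g1: "\<And>J. AE w in M. - 1 \<le> g J w \<bullet> \<Delta> (Suc n) w"
    and g0: "\<And>J w. 0 \<le> g J w \<bullet> a w"
    and g_inc: "\<And>w. incseq (\<lambda>J. g J w \<bullet> a w)"
    and g_sup: "AE w in M. minkowski (- a w) (convex hull (closed_support (P n w))) = (SUP J. ereal (g J w \<bullet> a w))"
    using L.approximating_strategies[OF aF span_a] by blast
  have extended: "(\<integral>\<^sup>+w. ennreal ((1 + gain S \<gamma> n w) * (c w + g J w \<bullet> a w)) \<partial>M) \<le> ennreal W"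
    if \<gamma>: "\<gamma> \<in> strategies n" and X1: "AE w in M. - 1 \<le> gain S \<gamma> n w" for \<gamma> J
  proof -
    obtain B where B: "AE w in M. \<bar>gain S \<gamma> n w\<bar> \<le> B"
      using gain_measurable_bounded(2)[OF \<gamma> nN] by blast
    obtain C where C: "\<forall>w\<in>space M. norm (g J w) \<le> C" using gB by blast
    \<comment> \<open>The bound on the gain holds only almost surely; the truncation \<open>Y\<close> of \<open>1 + X\<close> is bounded
      everywhere.\<close>
    define Y where "Y w = max 0 (min (1 + B) (1 + gain S \<gamma> n w))" for w
    have Y_eq: "AE w in M. Y w = 1 + gain S \<gamma> n w"
      using B X1 by eventually_elim (auto simp: Y_def)
    have YF: "Y \<in> borel_measurable (F n)"
      unfolding Y_def
      by (intro borel_measurable_max borel_measurable_min borel_measurable_add borel_measurable_const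
          gain_measurable_bounded(1)[OF \<gamma> nN])
    have Y0: "0 \<le> Y w" and YB: "Y w \<le> \<bar>1 + B\<bar>" for w by (auto simp: Y_def)
    define u where "u w = Y w *\<^sub>R g J w" for w
    have uF: "u \<in> borel_measurable (F n)"
      unfolding u_def by (intro borel_measurable_scaleR YF gF)
    have uB: "norm (u w) \<le> \<bar>1 + B\<bar> * C" if "w \<in> space M" for w
      using C that Y0[of w] YB[of w] by (auto simp: u_def intro!: mult_mono)
    define \<gamma>' where "\<gamma>' = \<gamma>(Suc n := u)"
    have gain_eq: "gain S \<gamma>' n w = gain S \<gamma> n w" for w
      unfolding gain_def \<gamma>'_def by (intro sum.cong) auto
    have last_u: "\<gamma>' (Suc n) = u" by (simp add: \<gamma>'_def)
    have gain': "AE w in M. 1 + gain S \<gamma>' (Suc n) w = Y w * (1 + g J w \<bullet> \<Delta> (Suc n) w)"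
      using Y_eq by eventually_elim (simp add: gain_Suc gain_eq last_u u_def algebra_simps)
    have \<gamma>': "\<gamma>' \<in> strategies (Suc n)"
    proof -
      have "u \<in> Linf M (F n) (supp_span P n)"
        unfolding Linf_iff[OF subalg[OF nN]]
      proof (intro conjI uF exI[of _ "\<bar>1 + B\<bar> * C"])
        show "AE w in M. norm (u w) \<le> \<bar>1 + B\<bar> * C" using uB by (intro AE_I2)
        show "AE w in M. u w \<in> supp_span P n w"
          using gD[of J] by eventually_elim (simp add: u_def supp_span_def span_scale)
      qed
      then show ?thesis using \<gamma> by (auto simp: \<gamma>'_def le_Suc_eq)
    qed
    have "AE w in M. - 1 \<le> gain S \<gamma>' (Suc n) w"
      using gain' g1[of J]
    proof eventually_elim
      case (elim w)
      then have "0 \<le> Y w * (1 + g J w \<bullet> \<Delta> (Suc n) w)" using Y0[of w] by (intro mult_nonneg_nonneg) auto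
      then show ?case using elim(1) by linarith
    qed
    from W(2)[OF \<gamma>' this]
    have le: "(\<integral>\<^sup>+w. ennreal (\<beta> w * (1 + gain S \<gamma>' (Suc n) w)) \<partial>M) \<le> ennreal W" .
    note ci = L.cond_exp_inner[OF \<beta>(1) uF uB]
    have iY: "integrable M (\<lambda>w. Y w * \<beta> w)"
    proof (rule Bochner_Integration.integrable_bound)
      show "integrable M (\<lambda>w. \<bar>1 + B\<bar> * \<beta> w)" using \<beta>(1) by simp
      show "(\<lambda>w. Y w * \<beta> w) \<in> borel_measurable M"
        by (intro borel_measurable_times \<beta>M measurable_M[OF YF nN])
      show "AE w in M. norm (Y w * \<beta> w) \<le> norm (\<bar>1 + B\<bar> * \<beta> w)"
        using Y0 YB by (intro AE_I2) (auto simp: abs_mult intro!: mult_right_mono)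
    qed
    have iYc: "integrable M (\<lambda>w. Y w * c w)" "(\<integral>w. Y w * c w \<partial>M) = (\<integral>w. Y w * \<beta> w \<partial>M)"
      unfolding c_def by (intro L.real_cond_exp_intg iY YF \<beta>M)+
    have "(\<integral>\<^sup>+w. ennreal ((1 + gain S \<gamma> n w) * (c w + g J w \<bullet> a w)) \<partial>M)
        = (\<integral>\<^sup>+w. ennreal (Y w * c w + u w \<bullet> a w) \<partial>M)"
    proof (rule nn_integral_cong_AE)
      show "AE w in M. ennreal ((1 + gain S \<gamma> n w) * (c w + g J w \<bullet> a w)) = ennreal (Y w * c w + u w \<bullet> a w)"
        using Y_eq by eventually_elim (simp add: u_def algebra_simps)
    qed
    also have "\<dots> = ennreal (\<integral>w. Y w * c w + u w \<bullet> a w \<partial>M)"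
    proof (rule nn_integral_eq_integral)
      show "integrable M (\<lambda>w. Y w * c w + u w \<bullet> a w)"
        using iYc(1) ci(2) unfolding a_def by (rule Bochner_Integration.integrable_add)
      show "AE w in M. 0 \<le> Y w * c w + u w \<bullet> a w"
        using c_pos by eventually_elim (simp add: u_def Y0 g0)
    qed
    also have "(\<integral>w. Y w * c w + u w \<bullet> a w \<partial>M) = (\<integral>w. Y w * \<beta> w \<partial>M) + (\<integral>w. \<beta> w * (u w \<bullet> \<Delta> (Suc n) w) \<partial>M)"
      using iYc ci(2,3) unfolding a_def by simp
    also have "\<dots> = (\<integral>w. Y w * \<beta> w + \<beta> w * (u w \<bullet> \<Delta> (Suc n) w) \<partial>M)"
      by (rule Bochner_Integration.integral_add[symmetric, OF iY ci(1)])
    also have "ennreal \<dots> = (\<integral>\<^sup>+w. ennreal (Y w * \<beta> w + \<beta> w * (u w \<bullet> \<Delta> (Suc n) w)) \<partial>M)"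
    proof (rule nn_integral_eq_integral[symmetric])
      show "integrable M (\<lambda>w. Y w * \<beta> w + \<beta> w * (u w \<bullet> \<Delta> (Suc n) w))"
        by (rule Bochner_Integration.integrable_add[OF iY ci(1)])
      show "AE w in M. 0 \<le> Y w * \<beta> w + \<beta> w * (u w \<bullet> \<Delta> (Suc n) w)"
        using g1[of J] \<beta>(2)
      proof eventually_elim
        case (elim w)
        then have "0 \<le> \<beta> w * (Y w * (1 + g J w \<bullet> \<Delta> (Suc n) w))"
          using Y0[of w] by (intro mult_nonneg_nonneg) auto
        then show ?case by (simp add: u_def algebra_simps)
      qed
    qed
    also have "\<dots> = (\<integral>\<^sup>+w. ennreal (\<beta> w * (1 + gain S \<gamma>' (Suc n) w)) \<partial>M)"
    proof (rule nn_integral_cong_AE)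
      show "AE w in M. ennreal (Y w * \<beta> w + \<beta> w * (u w \<bullet> \<Delta> (Suc n) w)) = ennreal (\<beta> w * (1 + gain S \<gamma>' (Suc n) w))"
        using gain'
      proof eventually_elim
        case (elim w)
        show ?case unfolding elim by (simp add: u_def algebra_simps)
      qed
    qed
    finally show ?thesis using le by simp
  qed
  have zero_strat: "(\<lambda>_ _. 0) \<in> strategies n"
    using nN by (auto simp: Linf_iff[OF subalg] supp_span_def span_zero intro!: exI[of _ 0])
  have ga_F: "(\<lambda>w. g J w \<bullet> a w) \<in> borel_measurable (F n)" for J
    by (intro borel_measurable_inner gF aF)
  have cga_M: "(\<lambda>w. c w + g J w \<bullet> a w) \<in> borel_measurable M" for J
    by (intro measurable_M[OF _ nN] borel_measurable_add cF ga_F)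
  have bdd: "AE w in M. (SUP J. ennreal (c w + g J w \<bullet> a w)) \<noteq> \<infinity>"
  proof (rule nn_integral_noteq_infinite)
    show "(\<lambda>w. SUP J. ennreal (c w + g J w \<bullet> a w)) \<in> borel_measurable M"
      by (intro borel_measurable_SUP countableI_type measurable_compose[OF cga_M measurable_ennreal])
    have "(\<integral>\<^sup>+w. (SUP J. ennreal (c w + g J w \<bullet> a w)) \<partial>M) = (SUP J. \<integral>\<^sup>+w. ennreal (c w + g J w \<bullet> a w) \<partial>M)"
    proof (rule nn_integral_monotone_convergence_SUP)
      show "incseq (\<lambda>J w. ennreal (c w + g J w \<bullet> a w))"
        using g_inc by (auto simp: incseq_def le_fun_def intro!: ennreal_leI)
    qed (rule measurable_compose[OF cga_M measurable_ennreal])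
    also have "\<dots> \<le> ennreal W"
    proof (rule SUP_least)
      fix J
      show "(\<integral>\<^sup>+w. ennreal (c w + g J w \<bullet> a w) \<partial>M) \<le> ennreal W"
        using extended[OF zero_strat, of J] by (simp add: gain_def)
    qed
    finally show "(\<integral>\<^sup>+w. (SUP J. ennreal (c w + g J w \<bullet> a w)) \<partial>M) \<noteq> \<infinity>"
      by (auto simp: top_unique)
  qed
  define l where "l w = c w + real_of_ereal (SUP J. ereal (g J w \<bullet> a w))" for w
  have lF: "l \<in> borel_measurable (F n)"
    unfolding l_def
    by (intro borel_measurable_add cF borel_measurable_real_of_ereal borel_measurable_SUP countableI_type
        borel_measurable_ereal ga_F)
  have lM: "l \<in> borel_measurable M" by (rule measurable_M[OF lF nN])
  have limit: "AE w in M. \<exists>t. (SUP J. ereal (g J w \<bullet> a w)) = ereal t \<and> 0 \<le> t \<and> l w = c w + t \<and>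
      (\<lambda>J. c w + g J w \<bullet> a w) \<longlonglongrightarrow> l w"
    using bdd c_pos
  proof eventually_elim
    case (elim w)
    then obtain R where R: "(SUP J. ennreal (c w + g J w \<bullet> a w)) = ennreal R" "0 \<le> R"
      by (cases "SUP J. ennreal (c w + g J w \<bullet> a w)") auto
    have "g J w \<bullet> a w \<le> R" for J
    proof -
      have "ennreal (c w + g J w \<bullet> a w) \<le> ennreal R" unfolding R(1)[symmetric] by (rule SUP_upper) simp
      then show ?thesis using elim(2) R(2) by simp
    qed
    then have "(SUP J. ereal (g J w \<bullet> a w)) \<le> ereal R" by (intro SUP_least) simp
    moreover have "0 \<le> (SUP J. ereal (g J w \<bullet> a w))"
      by (rule SUP_upper2[of 0]) (simp_all add: g0)
    ultimately obtain t where t: "(SUP J. ereal (g J w \<bullet> a w)) = ereal t" "0 \<le> t"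
      by (cases "SUP J. ereal (g J w \<bullet> a w)") auto
    have "incseq (\<lambda>J. ereal (g J w \<bullet> a w))" using g_inc[of w] by (simp add: incseq_def)
    from LIMSEQ_SUP[OF this] have "(\<lambda>J. g J w \<bullet> a w) \<longlonglongrightarrow> t" unfolding t(1) by simp
    then have "(\<lambda>J. c w + g J w \<bullet> a w) \<longlonglongrightarrow> c w + t" by (intro tendsto_add tendsto_const)
    then show ?case using t by (auto simp: l_def)
  qed
  have main: "(\<integral>\<^sup>+w. ennreal (l w * (1 + gain S \<gamma> n w)) \<partial>M) \<le> ennreal W"
    if \<gamma>: "\<gamma> \<in> strategies n" and X1: "AE w in M. - 1 \<le> gain S \<gamma> n w" for \<gamma>
  proof -
    \<comment> \<open>Fatou's lemma along the almost optimal positions.\<close>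
    let ?f = "\<lambda>J w. ennreal ((1 + gain S \<gamma> n w) * (c w + g J w \<bullet> a w))"
    have "(\<integral>\<^sup>+w. ennreal (l w * (1 + gain S \<gamma> n w)) \<partial>M) = (\<integral>\<^sup>+w. liminf (\<lambda>J. ?f J w) \<partial>M)"
    proof (rule nn_integral_cong_AE)
      show "AE w in M. ennreal (l w * (1 + gain S \<gamma> n w)) = liminf (\<lambda>J. ?f J w)"
        using limit
      proof eventually_elim
        case (elim w)
        then have "(\<lambda>J. ?f J w) \<longlonglongrightarrow> ennreal ((1 + gain S \<gamma> n w) * l w)"
          by (intro tendsto_ennrealI tendsto_mult tendsto_const) blast
        from lim_imp_Liminf[OF sequentially_bot this] show ?case by (simp add: mult.commute)
      qed
    qed
    also have "\<dots> \<le> liminf (\<lambda>J. \<integral>\<^sup>+w. ?f J w \<partial>M)"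
      by (intro nn_integral_liminf measurable_compose[OF _ measurable_ennreal] borel_measurable_times
          borel_measurable_add borel_measurable_const cga_M measurable_M[OF gain_measurable_bounded(1)[OF \<gamma> nN] nN])
        (intro measurable_M[OF cF nN] measurable_M[OF ga_F nN])+
    also have "\<dots> \<le> liminf (\<lambda>J. ennreal W)"
      by (rule Liminf_mono) (intro always_eventually allI extended \<gamma> X1)
    also have "\<dots> = ennreal W" by (simp add: Liminf_const)
    finally show ?thesis .
  qed
  have l_pos: "AE w in M. 0 < l w" using limit c_pos by eventually_elim auto
  show thesis
  proof (rule that[OF lF _ l_pos _ main])
    show "integrable M l"
    proof (rule integrableI_nonneg[OF lM])
      show "AE w in M. 0 \<le> l w" using l_pos by eventually_elim simp
      have "(\<integral>\<^sup>+w. ennreal (l w) \<partial>M) \<le> ennreal W" using main[OF zero_strat] by (simp add: gain_def)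
      then show "(\<integral>\<^sup>+w. ennreal (l w) \<partial>M) < \<infinity>" by (rule order.strict_trans1) simp
    qed
    show "AE w in M. ereal (l w) = ereal (real_cond_exp M (F n) \<beta> w)
      + penalty n \<beta> w"
      unfolding c_def[symmetric] a_def[symmetric]
      using limit g_sup by eventually_elim auto
  qed
qed

text \<open>Downward induction on \<open>n\<close>, with the invariant \<open>E(\<beta>\<^sub>n (1 + X)) \<le> W\<close> for all gains \<open>X \<ge> -1\<close> up to
  time \<open>n\<close>. At \<open>n = N\<close> it is the hypothesis; \<open>X = 0\<close> gives the integrability of \<open>\<beta>\<^sub>n\<close>.\<close>
lemma recursion_of_bounded_gains:
  assumes f: "f \<in> L1pp M"
    and V: "\<And>\<gamma>. \<gamma> \<in> strategies N \<Longrightarrow> AE w in M. - 1 \<le> gain S \<gamma> N w \<Longrightarrow>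
       (\<integral>w. f w * gain S \<gamma> N w \<partial>M) \<le> V"
  shows "\<exists>\<beta>. integrable_beta_recursion M F N S P f \<beta>"
proof -
  have f_int: "integrable M f" and f_pos: "AE w in M. 0 < f w" using f by (auto simp: L1pp_def)
  define W where "W = \<bar>V\<bar> + (\<integral>w. f w \<partial>M)"
  have "0 \<le> (\<integral>w. f w \<partial>M)" by (rule integral_nonneg_AE) (use f_pos in \<open>auto elim: eventually_mono\<close>)
  then have W0: "0 \<le> W" by (simp add: W_def)
  define good where "good n \<beta> \<longleftrightarrow>
     (\<forall>k. n \<le> k \<and> k \<le> N \<longrightarrow> \<beta> k \<in> borel_measurable (F k) \<and> integrable M (\<beta> k)) \<and>
     (AE w in M. \<beta> N w = f w) \<and>
     (\<forall>k. n \<le> k \<and> k < N \<longrightarrow> (AE w in M. ereal (\<beta> k w) = ereal (real_cond_exp M (F k) (\<beta> (Suc k)) w)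
        + penalty k (\<beta> (Suc k)) w)) \<and>
     (AE w in M. 0 < \<beta> n w) \<and>
     (\<forall>\<gamma>\<in>strategies n. (AE w in M. - 1 \<le> gain S \<gamma> n w) \<longrightarrow>
        (\<integral>\<^sup>+w. ennreal (\<beta> n w * (1 + gain S \<gamma> n w)) \<partial>M) \<le> ennreal W)" for n \<beta>
  have "\<exists>\<beta>. good n \<beta>" if "n \<le> N" for n
    using that
  proof (induction rule: inc_induct)
    case base
    have "f \<in> borel_measurable (F N)"
      using f_int filtration subalg[of N]
      by (subst measurable_cong_sets[of _ M]) (auto simp: discrete_filtration_def)
    moreover have "(\<integral>\<^sup>+w. ennreal (f w * (1 + gain S \<gamma> N w)) \<partial>M) \<le> ennreal W"
      if \<gamma>: "\<gamma> \<in> strategies N" and X1: "AE w in M. - 1 \<le> gain S \<gamma> N w" for \<gamma>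
    proof -
      have fX: "integrable M (\<lambda>w. f w * gain S \<gamma> N w)"
        by (rule integrable_times_gain[OF \<gamma> _ f_int]) simp
      have "(\<integral>\<^sup>+w. ennreal (f w * (1 + gain S \<gamma> N w)) \<partial>M) = ennreal (\<integral>w. f w * (1 + gain S \<gamma> N w) \<partial>M)"
      proof (rule nn_integral_eq_integral)
        show "integrable M (\<lambda>w. f w * (1 + gain S \<gamma> N w))"
          using f_int fX by (simp add: distrib_left)
        show "AE w in M. 0 \<le> f w * (1 + gain S \<gamma> N w)"
          using X1 f_pos by eventually_elim (intro mult_nonneg_nonneg; simp)
      qed
      also have "(\<integral>w. f w * (1 + gain S \<gamma> N w) \<partial>M) = (\<integral>w. f w \<partial>M) + (\<integral>w. f w * gain S \<gamma> N w \<partial>M)"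
        using f_int fX by (simp add: distrib_left)
      also have "\<dots> \<le> W" using V[OF \<gamma> X1] by (simp add: W_def)
      finally show ?thesis by (simp add: ennreal_leI)
    qed
    ultimately have "good N (\<lambda>_. f)"
      unfolding good_def using f_int f_pos by auto
    then show ?case by (intro exI[of _ "\<lambda>_. f"])
  next
    case (step n)
    then obtain \<beta> where \<beta>: "good (Suc n) \<beta>" by blast
    have b: "integrable M (\<beta> (Suc n))" "AE w in M. 0 < \<beta> (Suc n) w"
      "\<And>\<gamma>. \<gamma> \<in> strategies (Suc n) \<Longrightarrow> AE w in M. - 1 \<le> gain S \<gamma> (Suc n) w \<Longrightarrow>
        (\<integral>\<^sup>+w. ennreal (\<beta> (Suc n) w * (1 + gain S \<gamma> (Suc n) w)) \<partial>M) \<le> ennreal W"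
      using \<beta> step.hyps unfolding good_def by auto
    obtain l where l: "l \<in> borel_measurable (F n)" "integrable M l" "AE w in M. 0 < l w"
      "AE w in M. ereal (l w) = ereal (real_cond_exp M (F n) (\<beta> (Suc n)) w)
        + penalty n (\<beta> (Suc n)) w"
      "\<And>\<gamma>. \<gamma> \<in> strategies n \<Longrightarrow> AE w in M. - 1 \<le> gain S \<gamma> n w \<Longrightarrow>
        (\<integral>\<^sup>+w. ennreal (l w * (1 + gain S \<gamma> n w)) \<partial>M) \<le> ennreal W"
      by (rule backward_step[OF step.hyps(2) b(1,2) W0 b(3)]) (assumption | rule that)+
    have "good n (\<beta>(n := l))"
      unfolding good_def
    proof (intro conjI allI impI ballI)
      fix k
      show "(\<beta>(n := l)) k \<in> borel_measurable (F k)" "integrable M ((\<beta>(n := l)) k)" if "n \<le> k \<and> k \<le> N"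
      proof -
        have "(\<beta>(n := l)) k \<in> borel_measurable (F k) \<and> integrable M ((\<beta>(n := l)) k)"
        proof (cases "k = n")
          case True
          then show ?thesis using l(1,2) by simp
        next
          case False
          then have "Suc n \<le> k \<and> k \<le> N" using that by simp
          then show ?thesis using False \<beta> unfolding good_def by simp
        qed
        then show "(\<beta>(n := l)) k \<in> borel_measurable (F k)" "integrable M ((\<beta>(n := l)) k)" by auto
      qed
      show "AE w in M. ereal ((\<beta>(n := l)) k w) = ereal (real_cond_exp M (F k) ((\<beta>(n := l)) (Suc k)) w)
        + penalty k ((\<beta>(n := l)) (Suc k)) w" if "n \<le> k \<and> k < N"
      proof (cases "k = n")
        case True
        then show ?thesis using l(4) by simp
      next
        case False
        then show ?thesis using \<beta> that unfolding good_def by simp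
      qed
    next
      show "AE w in M. (\<beta>(n := l)) N w = f w" using \<beta> step.hyps(2) unfolding good_def by simp
      show "AE w in M. 0 < (\<beta>(n := l)) n w" using l(3) by simp
      fix \<gamma> assume "\<gamma> \<in> strategies n" "AE w in M. - 1 \<le> gain S \<gamma> n w"
      then show "(\<integral>\<^sup>+w. ennreal ((\<beta>(n := l)) n w * (1 + gain S \<gamma> n w)) \<partial>M) \<le> ennreal W"
        using l(5) by simp
    qed
    then show ?case by (intro exI[of _ "\<beta>(n := l)"])
  qed
  from this[of 0] obtain \<beta> where "good 0 \<beta>" by auto
  then have "integrable_beta_recursion M F N S P f \<beta>"
    unfolding good_def integrable_beta_recursion_def Let_def by simp
  then show ?thesis by blast
qed

end
section \<open>An integrable recurrence gives a dominating martingale measure\<close>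

context market
begin

text \<open>The density process is the product of the one-step densities, started from the normalised
  \<open>\<beta>\<^sub>0\<close>. Since \<open>\<beta>\<^sub>n\<^sub>+\<^sub>1 \<le> 3 \<beta>\<^sub>n \<xi>\<close>, its domination of \<open>\<beta>\<close> survives each step with a third of
  the constant.\<close>
lemma density_of_recursion:
  assumes rec: "integrable_beta_recursion M F N S P f \<beta>" and f: "f \<in> L1pp M" and n: "n \<le> N"
  shows "\<exists>Z c. Z \<in> borel_measurable (F n) \<and> (\<forall>w. 0 \<le> Z w) \<and> integrable M Z \<and> (\<integral>w. Z w \<partial>M) = 1
    \<and> 0 < c \<and> (AE w in M. c * \<beta> n w \<le> Z w)
    \<and> (\<forall>k\<in>{1..n}. \<forall>A\<in>sets (F (k - 1)). \<forall>i. (\<integral>w. indicat_real A w * Z w * \<Delta> k w $ i \<partial>M) = 0)"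
proof -
  have \<beta>F: "\<beta> k \<in> borel_measurable (F k)" and \<beta>_int: "integrable M (\<beta> k)" if "k \<le> N" for k
    using rec that by (auto simp: integrable_beta_recursion_def)
  have \<beta>_rec: "AE w in M. ereal (\<beta> k w) = ereal (real_cond_exp M (F k) (\<beta> (Suc k)) w)
      + penalty k (\<beta> (Suc k)) w" if "k < N" for k
    using rec that by (simp add: integrable_beta_recursion_def Let_def)
  have \<beta>_pos: "AE w in M. 0 < \<beta> k w" if "k \<le> N" for k
    using that
  proof (induction rule: inc_induct)
    case base
    have "AE w in M. \<beta> N w = f w" using rec by (simp add: integrable_beta_recursion_def)
    moreover have "AE w in M. 0 < f w" using f by (simp add: L1pp_def)
    ultimately show ?case by eventually_elim simp
  next
    case (step k)
    interpret L: na_law M "F k" "\<Delta> (Suc k)" "P k" "2 * bnd" by (rule step_law[OF step.hyps(2)])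
    have "AE w in M. 0 < real_cond_exp M (F k) (\<beta> (Suc k)) w"
      by (rule L.real_cond_exp_gr_c[OF \<beta>_int step.IH]) (use step.hyps in simp)
    with \<beta>_rec[OF step.hyps(2)] show ?case
    proof eventually_elim
      case (elim w)
      let ?m = "penalty k (\<beta> (Suc k)) w"
      have "0 \<le> ?m" by (rule minkowski_nonneg)
      then have "ereal (real_cond_exp M (F k) (\<beta> (Suc k)) w) \<le> ereal (\<beta> k w)"
        unfolding elim(1) by (rule ereal_le_add_self)
      then show ?case using elim(2) by simp
    qed
  qed
  show ?thesis
    using n
  proof (induction n)
    case 0
    define m where "m = (\<integral>w. \<beta> 0 w \<partial>M)"
    have nn: "AE w in M. 0 \<le> \<beta> 0 w" using \<beta>_pos[of 0] by (auto elim: eventually_mono)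
    have "m \<noteq> 0"
    proof
      assume "m = 0"
      then have "AE w in M. \<beta> 0 w = 0"
        unfolding m_def using integral_nonneg_eq_0_iff_AE[OF \<beta>_int nn] by simp
      with \<beta>_pos[OF le0] have "AE w in M. False" by eventually_elim simp
      then show False by (simp add: AE_False)
    qed
    moreover have "0 \<le> m" unfolding m_def by (rule integral_nonneg_AE[OF nn])
    ultimately have m: "0 < m" by simp
    define Z where "Z w = max 0 (\<beta> 0 w) / m" for w
    have ZF: "Z \<in> borel_measurable (F 0)"
      unfolding Z_def by (intro borel_measurable_divide borel_measurable_max borel_measurable_const \<beta>F) simp
    have Z_eq: "AE w in M. Z w = \<beta> 0 w / m" using nn by eventually_elim (simp add: Z_def)
    have ZM: "Z \<in> borel_measurable M" by (rule measurable_M[OF ZF]) simp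
    have i0: "integrable M (\<lambda>w. \<beta> 0 w / m)" using \<beta>_int[of 0] by simp
    have Zi: "integrable M Z"
      by (rule integrable_cong_AE_imp[OF i0 ZM]) (use Z_eq in \<open>auto elim: eventually_mono\<close>)
    have "(\<integral>w. Z w \<partial>M) = (\<integral>w. \<beta> 0 w / m \<partial>M)"
      by (rule integral_cong_AE[OF ZM borel_measurable_integrable[OF i0] Z_eq])
    also have "\<dots> = 1" using m by (simp add: m_def[symmetric])
    finally have Z1: "(\<integral>w. Z w \<partial>M) = 1" .
    have "AE w in M. 1 / m * \<beta> 0 w \<le> Z w" using Z_eq by eventually_elim simp
    moreover have "0 \<le> Z w" for w using m by (simp add: Z_def)
    ultimately show ?case using ZF Zi Z1 m
      by (intro exI[of _ Z] exI[of _ "1 / m"]) simp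
  next
    case (Suc n)
    then have nN: "n < N" "n \<le> N" by auto
    from Suc obtain Z c where Z: "Z \<in> borel_measurable (F n)" "\<And>w. 0 \<le> Z w" "integrable M Z" "(\<integral>w. Z w \<partial>M) = 1"
      and c: "0 < c" "AE w in M. c * \<beta> n w \<le> Z w"
      and mart: "\<And>k A i. k \<in> {1..n} \<Longrightarrow> A \<in> sets (F (k - 1)) \<Longrightarrow>
          (\<integral>w. indicat_real A w * Z w * \<Delta> k w $ i \<partial>M) = 0" by auto
    interpret L: na_law M "F n" "\<Delta> (Suc n)" "P n" "2 * bnd" by (rule step_law[OF nN(1)])
    have sub: "subalgebra (F (Suc n)) (F n)" "subalgebra M (F (Suc n))"
      using Suc.prems by (auto intro: subalg_mono subalg)
    have inc: "\<Delta> (Suc n) \<in> borel_measurable (F (Suc n))" by (rule inc_measurable) (use Suc.prems in auto)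
    obtain \<xi> where \<xi>: "\<xi> \<in> borel_measurable (F (Suc n))" "\<And>w. 0 \<le> \<xi> w"
      and \<xi>_ge: "AE w in M. 0 < \<beta> n w \<and> \<beta> (Suc n) w \<le> 3 * \<beta> n w * \<xi> w"
      and \<xi>_mart: "\<And>Z. Z \<in> borel_measurable (F n) \<Longrightarrow> integrable M Z \<Longrightarrow>
       integrable M (\<lambda>w. Z w * \<xi> w) \<and> (\<integral>w. Z w * \<xi> w \<partial>M) = (\<integral>w. Z w \<partial>M)
       \<and> (\<forall>i. (\<integral>w. Z w * \<xi> w * \<Delta> (Suc n) w $ i \<partial>M) = 0)"
      by (rule L.one_step_density[OF sub inc \<beta>F[OF Suc.prems] \<beta>_int[OF Suc.prems] \<beta>_pos[OF Suc.prems]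
            \<beta>F[OF nN(2)] \<beta>_int[OF nN(2)] \<beta>_rec[OF nN(1)]]) (assumption | rule that)+
    define Z' where "Z' w = Z w * \<xi> w" for w
    have Z'F: "Z' \<in> borel_measurable (F (Suc n))"
      unfolding Z'_def by (intro borel_measurable_times measurable_from_subalg[OF sub(1) Z(1)] \<xi>(1))
    have "AE w in M. c / 3 * \<beta> (Suc n) w \<le> Z' w"
      using c(2) \<xi>_ge
    proof eventually_elim
      case (elim w)
      have "c / 3 * \<beta> (Suc n) w \<le> c / 3 * (3 * \<beta> n w * \<xi> w)"
        using elim c(1) by (intro mult_left_mono) auto
      also have "\<dots> = c * \<beta> n w * \<xi> w" by simp
      also have "\<dots> \<le> Z' w" unfolding Z'_def using elim \<xi>(2) by (intro mult_right_mono) auto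
      finally show ?case .
    qed
    moreover have "(\<integral>w. indicat_real A w * Z' w * \<Delta> k w $ i \<partial>M) = 0"
      if k: "k \<in> {1..Suc n}" and A: "A \<in> sets (F (k - 1))" for k A i
    proof (cases "k = Suc n")
      case True
      have A': "A \<in> sets (F n)" using A True by simp
      have m: "(\<lambda>w. indicat_real A w * Z w) \<in> borel_measurable (F n)"
        by (intro borel_measurable_times borel_measurable_indicator A' Z(1))
      have i: "integrable M (\<lambda>w. indicat_real A w * Z w)"
        using integrable_mult_indicator[OF L.sets_G[OF A'] Z(3)] by simp
      show ?thesis using \<xi>_mart[OF m i] True by (simp add: Z'_def mult.assoc)
    next
      case False
      then have k': "k \<in> {1..n}" "1 \<le> k" "k \<le> n" "k \<le> N" "k - 1 \<le> n" using k nN by auto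
      have A': "A \<in> sets (F n)" by (rule sets_mono[OF k'(5) nN(2) A])
      have km: "(\<lambda>w. \<Delta> k w $ i) \<in> borel_measurable (F n)"
        by (intro borel_measurable_vec_nth measurable_mono[OF inc_measurable[OF k'(2,4)] k'(3) nN(2)])
      have m: "(\<lambda>w. indicat_real A w * Z w * \<Delta> k w $ i) \<in> borel_measurable (F n)"
        by (intro borel_measurable_times borel_measurable_indicator A' Z(1) km)
      have i: "integrable M (\<lambda>w. indicat_real A w * Z w * \<Delta> k w $ i)"
      proof (rule Bochner_Integration.integrable_bound)
        show "integrable M (\<lambda>w. 2 * bnd * Z w)" using Z(3) by simp
        show "AE w in M. norm (indicat_real A w * Z w * \<Delta> k w $ i) \<le> norm (2 * bnd * Z w)"
          using inc_bounded[OF k'(2,4)]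
        proof eventually_elim
          case (elim w)
          have "\<bar>\<Delta> k w $ i\<bar> \<le> \<bar>2 * bnd\<bar>"
            using elim component_le_norm_cart[of "\<Delta> k w" i] by linarith
          then have "\<bar>Z w\<bar> * \<bar>\<Delta> k w $ i\<bar> \<le> \<bar>Z w\<bar> * \<bar>2 * bnd\<bar>" by (rule mult_left_mono) simp
          then show ?case by (auto simp: abs_mult indicator_def mult_ac)
        qed
      qed (rule L.G_measurable[OF m])
      have "(\<integral>w. indicat_real A w * Z' w * \<Delta> k w $ i \<partial>M)
          = (\<integral>w. (indicat_real A w * Z w * \<Delta> k w $ i) * \<xi> w \<partial>M)"
        by (intro Bochner_Integration.integral_cong) (auto simp: Z'_def)
      also have "\<dots> = 0" using \<xi>_mart[OF m i] mart[OF k'(1) A, of i] by simp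
      finally show ?thesis .
    qed
    moreover have "integrable M Z'" "(\<integral>w. Z' w \<partial>M) = 1"
      using \<xi>_mart[OF Z(1,3)] Z(4) by (simp_all add: Z'_def[abs_def])
    moreover have "0 \<le> Z' w" for w using Z(2) \<xi>(2) by (simp add: Z'_def)
    ultimately show ?case using Z'F c(1)
      by (intro exI[of _ Z'] exI[of _ "c / 3"]) auto
  qed
qed

lemma martingale_measure_of_recursion:
  assumes rec: "integrable_beta_recursion M F N S P f \<beta>" and f: "f \<in> L1pp M"
  shows "\<exists>Q. martingale_measure M F N S Q \<and> equivalent_measures M Q \<and>
             (\<exists>c>0. AE w in M. ennreal (c * f w) \<le> RN_deriv M Q w)"
proof -
  obtain Z c where Z: "Z \<in> borel_measurable (F N)" "\<And>w. 0 \<le> Z w" "integrable M Z" "(\<integral>w. Z w \<partial>M) = 1"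
    and c: "0 < c" "AE w in M. c * \<beta> N w \<le> Z w"
    and mart: "\<And>k A i. k \<in> {1..N} \<Longrightarrow> A \<in> sets (F (k - 1)) \<Longrightarrow>
        (\<integral>w. indicat_real A w * Z w * \<Delta> k w $ i \<partial>M) = 0"
    using density_of_recursion[OF rec f order_refl] by auto
  have ZM: "Z \<in> borel_measurable M" using Z(3) by simp
  have cf: "AE w in M. c * f w \<le> Z w"
  proof -
    have "AE w in M. \<beta> N w = f w" using rec by (simp add: integrable_beta_recursion_def)
    with c(2) show ?thesis by eventually_elim simp
  qed
  have Z_pos: "AE w in M. 0 < Z w"
  proof -
    have "AE w in M. 0 < f w" using f by (simp add: L1pp_def)
    with cf show ?thesis
    proof eventually_elim
      case (elim w)
      then have "0 < c * f w" using c(1) by simp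
      then show ?case using elim(1) by linarith
    qed
  qed
  define Q where "Q = density M (\<lambda>w. ennreal (Z w))"
  have enZ: "(\<lambda>w. ennreal (Z w)) \<in> borel_measurable M" by (rule measurable_compose[OF ZM measurable_ennreal])
  have sets_Q: "sets Q = sets M" and space_Q: "space Q = space M" by (simp_all add: Q_def)
  have "emeasure Q (space Q) = (\<integral>\<^sup>+w. ennreal (Z w) \<partial>M)"
    unfolding Q_def by (subst emeasure_density[OF enZ]) (auto intro!: nn_integral_cong simp: indicator_def)
  also have "\<dots> = 1" using nn_integral_eq_integral[OF Z(3)] Z(2,4) by simp
  finally interpret Q: prob_space Q by (rule prob_spaceI)
  have AE_Q: "AE w in Q. R w" if "AE w in M. R w" for R
    unfolding Q_def AE_density[OF enZ] using that by (auto elim: eventually_mono)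
  have AE_M: "AE w in M. R w" if "AE w in Q. R w" for R
    using that Z_pos unfolding Q_def AE_density[OF enZ] by eventually_elim simp
  have "A \<in> null_sets Q \<longleftrightarrow> A \<in> null_sets M" if "A \<in> sets M" for A
    unfolding AE_iff_null_sets[OF that] AE_iff_null_sets[OF that[folded sets_Q]]
    by (rule iffI) (erule AE_M, erule AE_Q)
  then have "null_sets Q = null_sets M"
    unfolding set_eq_iff by (metis null_setsD2 sets_Q)
  then have equiv: "equivalent_measures M Q" by (simp add: equivalent_measures_def sets_Q)
  have "AE w in M. ennreal (Z w) = RN_deriv M Q w"
    by (rule RN_deriv_unique[OF enZ]) (simp add: Q_def)
  then have dom: "AE w in M. ennreal (c * f w) \<le> RN_deriv M Q w"
    using cf
  proof eventually_elim
    case (elim w)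
    then show ?case by (metis ennreal_leI)
  qed
  have subQ: "subalgebra Q (F k)" if "k \<le> N" for k
    using subalg[OF that] by (auto simp: subalgebra_def sets_Q space_Q)
  have S_Q: "S k \<in> borel_measurable Q" if "k \<le> N" for k
    by (rule measurable_from_subalg[OF subQ[OF that] S_measurable[OF that]])
  have S_int: "integrable Q (S k)" if "k \<le> N" for k
    by (rule Q.integrable_const_bound[where B=bnd])
      (use AE_Q[OF S_le_bnd[OF that]] S_Q[OF that] in auto)
  have Si_int: "integrable Q (\<lambda>w. S k w $ i)" if "k \<le> N" for k i
    unfolding cart_eq_inner_axis by (intro integrable_inner_left S_int[OF that])
  have incr: "(\<integral>w. indicat_real A w * S n w $ i \<partial>Q) = (\<integral>w. indicat_real A w * S m w $ i \<partial>Q)"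
    if A: "A \<in> sets (F m)" and mn: "m \<le> n" "n \<le> N" for A m n i
    using mn
  proof (induction rule: dec_induct)
    case base
    show ?case ..
  next
    case (step k)
    have kN: "k \<le> N" "Suc k \<le> N" "Suc k \<in> {1..N}" using step.prems by auto
    have AQ: "A \<in> sets Q" using A mn subQ[of m] by (auto simp: subalgebra_def)
    have i: "integrable Q (\<lambda>w. indicat_real A w * S j w $ i)" if "j \<le> N" for j
      using integrable_mult_indicator[OF AQ Si_int[OF that]] by simp
    have Ak: "A \<in> sets (F (Suc k - 1))" using sets_mono[OF step.hyps(1) kN(1) A] by simp
    have d: "(\<lambda>w. indicat_real A w * \<Delta> (Suc k) w $ i) \<in> borel_measurable M"
      using AQ kN
      by (intro borel_measurable_times borel_measurable_indicator borel_measurable_vec_nth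
          measurable_M[OF inc_measurable]) (auto simp: sets_Q)
    have "(\<integral>w. indicat_real A w * S (Suc k) w $ i \<partial>Q) - (\<integral>w. indicat_real A w * S k w $ i \<partial>Q)
        = (\<integral>w. indicat_real A w * \<Delta> (Suc k) w $ i \<partial>Q)"
      by (subst Bochner_Integration.integral_diff[symmetric, OF i[OF kN(2)] i[OF kN(1)]])
        (simp add: increment_def right_diff_distrib)
    also have "\<dots> = (\<integral>w. Z w *\<^sub>R (indicat_real A w * \<Delta> (Suc k) w $ i) \<partial>M)"
      unfolding Q_def using Z(2) by (intro integral_density d ZM AE_I2)
    also have "\<dots> = (\<integral>w. indicat_real A w * Z w * \<Delta> (Suc k) w $ i \<partial>M)"
      by (intro Bochner_Integration.integral_cong) auto
    also have "\<dots> = 0" by (rule mart[OF kN(3) Ak])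
    finally show ?case using step by simp
  qed
  have "is_martingale Q F N S"
    unfolding is_martingale_def
  proof (intro conjI allI impI)
    fix n m assume n: "n \<le> N"
    show "S n \<in> borel_measurable (F n)" by (rule S_measurable[OF n])
    show "integrable Q (S n)" by (rule S_int[OF n])
    assume m: "m \<le> n"
    then have mN: "m \<le> N" using n by simp
    interpret fQ: finite_measure_subalgebra Q "F m" by unfold_locales (rule subQ[OF mN])
    have "AE w in Q. real_cond_exp Q (F m) (\<lambda>w. S n w $ i) w = S m w $ i" for i
    proof (rule fQ.real_cond_exp_charact)
      show "(\<integral>w\<in>A. S n w $ i \<partial>Q) = (\<integral>w\<in>A. S m w $ i \<partial>Q)" if "A \<in> sets (F m)" for A
        using incr[OF that m n] by (simp add: set_lebesgue_integral_def)
      show "(\<lambda>w. S m w $ i) \<in> borel_measurable (F m)"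
        by (intro borel_measurable_vec_nth S_measurable[OF mN])
    qed (intro Si_int n mN)+
    then have "AE w in Q. \<forall>i. real_cond_exp Q (F m) (\<lambda>w. S n w $ i) w = S m w $ i"
      by (subst AE_all_countable) blast
    then show "AE w in Q. vec_cond_exp Q (F m) (S n) w = S m w"
      by eventually_elim (simp add: vec_cond_exp_def vec_eq_iff)
  qed
  then have "martingale_measure M F N S Q"
    by (simp add: martingale_measure_def sets_Q Q.prob_space_axioms)
  then show ?thesis using equiv dom c(1) by blast
qed

end


theorem theorem4p1:
  fixes M :: "'a measure" and F :: "nat \<Rightarrow> 'a measure" and N :: nat
    and S :: "nat \<Rightarrow> 'a \<Rightarrow> real ^ 'd"
    and P :: "nat \<Rightarrow> 'a \<Rightarrow> (real ^ 'd) measure"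
    and f :: "'a \<Rightarrow> real"
  assumes "prob_space M"
    and "discrete_filtration M F N"
    and "\<And>n. n \<le> N \<Longrightarrow> S n \<in> Linf M (F n) (\<lambda>_. UNIV)"
    and "\<And>n. n < N \<Longrightarrow> regular_cond_distr M (F n) (increment S (Suc n)) (P n)"
    and "no_arbitrage M F N S"
    and "f \<in> L1pp M"
  defines "v \<equiv> (SUP X \<in> {X \<in> bounded_gains M F N S P. Linf_norm M (\<lambda>\<omega>. max (- X \<omega>) 0) \<le> 1}.
                  ereal (\<integral>\<omega>. f \<omega> * X \<omega> \<partial>M))"
  shows "(v < \<infinity> \<longleftrightarrow>
           (\<exists>Q. martingale_measure M F N S Q \<and> equivalent_measures M Q \<and>
             (\<exists>c>0. AE \<omega> in M. ennreal (c * f \<omega>) \<le> RN_deriv M Q \<omega>))) \<and>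
         ((\<exists>Q. martingale_measure M F N S Q \<and> equivalent_measures M Q \<and>
             (\<exists>c>0. AE \<omega> in M. ennreal (c * f \<omega>) \<le> RN_deriv M Q \<omega>)) \<longleftrightarrow>
           (\<exists>\<beta>. integrable_beta_recursion M F N S P f \<beta>))"
proof -
  interpret market M F N S P
    using assms(1-5) by (simp add: market_def market_axioms_def)
  have f: "f \<in> L1pp M" by fact
  let ?A = "{X \<in> bounded_gains M F N S P. Linf_norm M (\<lambda>\<omega>. max (- X \<omega>) 0) \<le> 1}"
  let ?i = "v < \<infinity>"
  let ?ii = "\<exists>Q. martingale_measure M F N S Q \<and> equivalent_measures M Q \<and>
    (\<exists>c>0. AE \<omega> in M. ennreal (c * f \<omega>) \<le> RN_deriv M Q \<omega>)"
  let ?iii = "\<exists>\<beta>. integrable_beta_recursion M F N S P f \<beta>"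
  have gains: "bounded_gains M F N S P = (\<lambda>\<gamma>. gain S \<gamma> N) ` strategies N"
    by (auto simp: bounded_gains_def)
  have A_iff: "gain S \<gamma> N \<in> ?A \<longleftrightarrow> (AE \<omega> in M. - 1 \<le> gain S \<gamma> N \<omega>)" if "\<gamma> \<in> strategies N" for \<gamma>
  proof -
    have "gain S \<gamma> N \<in> borel_measurable M"
      by (rule measurable_M[OF gain_measurable_bounded(1)[OF that]]) auto
    then show ?thesis using that Linf_norm_negative_part unfolding gains by blast
  qed
  have "?i \<Longrightarrow> ?iii"
  proof -
    assume "?i"
    then obtain V where V: "v \<le> ereal V" by (cases v) auto
    show ?iii
    proof (rule recursion_of_bounded_gains[OF f])
      fix \<gamma> assume \<gamma>: "\<gamma> \<in> strategies N" "AE \<omega> in M. - 1 \<le> gain S \<gamma> N \<omega>"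
      then have "gain S \<gamma> N \<in> ?A" using A_iff by blast
      then have "ereal (\<integral>\<omega>. f \<omega> * gain S \<gamma> N \<omega> \<partial>M) \<le> v" unfolding v_def by (rule SUP_upper)
      then show "(\<integral>\<omega>. f \<omega> * gain S \<gamma> N \<omega> \<partial>M) \<le> V" using V by (metis ereal_less_eq(3) order_trans)
    qed
  qed
  moreover have "?iii \<Longrightarrow> ?ii" using martingale_measure_of_recursion[OF _ f] by blast
  moreover have "?ii \<Longrightarrow> ?i"
  proof -
    assume ?ii
    then obtain Q c where Q: "martingale_measure M F N S Q" "equivalent_measures M Q"
      and c: "0 < c" "AE \<omega> in M. ennreal (c * f \<omega>) \<le> RN_deriv M Q \<omega>" by blast
    have "v \<le> ereal (1 / c)"
      unfolding v_def
    proof (rule SUP_least)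
      fix X assume X: "X \<in> ?A"
      then obtain \<gamma> where \<gamma>: "\<gamma> \<in> strategies N" "X = gain S \<gamma> N" unfolding gains by blast
      then have "AE \<omega> in M. - 1 \<le> gain S \<gamma> N \<omega>" using A_iff X by blast
      from gains_bounded_of_martingale_measure[OF Q c f \<gamma>(1) this]
      show "ereal (\<integral>\<omega>. f \<omega> * X \<omega> \<partial>M) \<le> ereal (1 / c)" by (simp add: \<gamma>(2))
    qed
    then show ?i by (rule order.strict_trans1) simp
  qed
  ultimately show ?thesis by blast
qed

end
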